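(* Let $R=k[S]_{\mathfrak m_S}$ be the localization of an affine semigroup ring at its maximal monomial ideal (as in the context). Let $\mathfrak a\subseteq R$ be an $\mathfrak m_S$-primary monomial ideal and let $\mathfrak b\subseteq R$ be any nonzero monomial ideal. Then $$\mathcal L_{\mathfrak b}(\mathfrak a)=\max_{u\in\mathcal N(\mathfrak a)}\frac{h_{\operatorname{NP}(\mathfrak a)}(u)}{h_{\operatorname{NP}(\mathfrak b)}(u)}.$$ In particular, $\mathcal L_{\mathfrak b}(\mathfrak a)$ is attained by a toric divisorial valuation $v_u$ with $u\in\mathcal N(\mathfrak a)$.
   Context: Toric setting: $k$ is a field, $N\cong\mathbb Z^n$ a lattice, $M=\operatorname{Hom}_{\mathbb Z}(N,\mathbb Z)$, and $S\subseteq M$ a finitely generated (not necessarily saturated) subsemigroup such that $\sigma^\vee:=\mathbb R_{\ge0}\cdot S\subseteq M_{\mathbb R}$ is a pointed rational polyhedral cone of full dimension $n$; $\sigma\subseteq N_{\mathbb R}$ is its dual cone, with relative interior $\sigma^\circ$. $k[S]$ has monomials $\chi^m$, $m\in S$, and $\mathfrak m_S=(\chi^m:m\in S\setminus\{0\})$. An ideal of $R$ is monomial if it is generated by monomials. Ideals are always proper. Newton polyhedron: $E(I)=\{m\in S:\chi^m\in I\}$ and $\operatorname{NP}(I)=\operatorname{conv}(E(I))+\sigma^\vee\subseteq M_{\mathbb R}$. Support function: for a nonempty closed convex set $C$ with $C+\sigma^\vee=C$ and $u\in\sigma$, $h_C(u)=\inf\{\langle u,x\rangle:x\in C\}$. Toric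 valuation: for $u\in\sigma\cap N$, $v_u$ is the valuation on $R$ determined by $v_u(\chi^m)=\langle u,m\rangle$ (the value of a sum of monomials being the minimum over its terms). A compact facet of $\operatorname{NP}(\mathfrak a)$ is a facet not parallel to $\sigma^\vee$, i.e. one such that the linear hyperplane parallel to its supporting hyperplane meets $\sigma^\vee$ only at the origin; equivalently, its inward normal lies in $\sigma^\circ$. $\mathcal N(\mathfrak a)$ is the finite set of primitive inward normals $u_F\in\sigma\cap N$ to the compact facets $F$ of $\operatorname{NP}(\mathfrak a)$. Exponent: $\mathcal L_{\mathfrak b}(\mathfrak a):=\inf\{\frac qp\in\mathbb Q_{>0}:\ \mathfrak b^{qt}\subseteq\overline{\mathfrak a^{pt}}\text{ for all integers }t\gg1\}$, with $\inf\emptyset=\infty$, where $\overline I$ denotes integral closure. *)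

theory Defs
  imports
    "HOL-Analysis.Analysis"
    "HOL-Library.Poly_Mapping"
    "HOL-Algebra.Ring"
    "HOL-Algebra.Ideal"
    "HOL-Algebra.Ideal_Product"
begin

section \<open>Commutative algebra\<close>

text \<open>
  Localization of a commutative ring \<open>A\<close> at a multiplicative subset \<open>W\<close>: fractions \<open>a/s\<close> are
  classes of pairs \<open>(a, s)\<close>, with \<open>a/s = b/t\<close> iff \<open>w (t a - s b) = 0\<close> for some \<open>w \<in> W\<close>.
\<close>

definition frac_rel :: "('a, 'c) ring_scheme \<Rightarrow> 'a set \<Rightarrow> (('a \<times> 'a) \<times> ('a \<times> 'a)) set" where
  "frac_rel A W = {((a, s), (b, t)). a \<in> carrier A \<and> s \<in> W \<and> b \<in> carrier A \<and> t \<in> W \<and>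
     (\<exists>w\<in>W. w \<otimes>\<^bsub>A\<^esub> ((t \<otimes>\<^bsub>A\<^esub> a) \<ominus>\<^bsub>A\<^esub> (s \<otimes>\<^bsub>A\<^esub> b)) = \<zero>\<^bsub>A\<^esub>)}"

definition frac :: "('a, 'c) ring_scheme \<Rightarrow> 'a set \<Rightarrow> 'a \<Rightarrow> 'a \<Rightarrow> ('a \<times> 'a) set" where
  "frac A W a s = frac_rel A W `` {(a, s)}"

definition localization :: "('a, 'c) ring_scheme \<Rightarrow> 'a set \<Rightarrow> ('a \<times> 'a) set ring" where
  "localization A W =
     \<lparr>carrier = (carrier A \<times> W) // frac_rel A W,
      mult = (\<lambda>X Y. \<Union>(a, s)\<in>X. \<Union>(b, t)\<in>Y. frac A W (a \<otimes>\<^bsub>A\<^esub> b) (s \<otimes>\<^bsub>A\<^esub> t)),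
      one = frac A W \<one>\<^bsub>A\<^esub> \<one>\<^bsub>A\<^esub>,
      zero = frac A W \<zero>\<^bsub>A\<^esub> \<one>\<^bsub>A\<^esub>,
      add = (\<lambda>X Y. \<Union>(a, s)\<in>X. \<Union>(b, t)\<in>Y.
               frac A W ((t \<otimes>\<^bsub>A\<^esub> a) \<oplus>\<^bsub>A\<^esub> (s \<otimes>\<^bsub>A\<^esub> b)) (s \<otimes>\<^bsub>A\<^esub> t))\<rparr>"

definition radical :: "('a, 'c) ring_scheme \<Rightarrow> 'a set \<Rightarrow> 'a set" where
  "radical R I = {x \<in> carrier R. \<exists>n::nat. x [^]\<^bsub>R\<^esub> n \<in> I}"

definition primary_ideal :: "('a, 'c) ring_scheme \<Rightarrow> 'a set \<Rightarrow> bool" where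
  "primary_ideal R Q \<longleftrightarrow> ideal Q R \<and> Q \<noteq> carrier R \<and>
     (\<forall>x\<in>carrier R. \<forall>y\<in>carrier R. x \<otimes>\<^bsub>R\<^esub> y \<in> Q \<longrightarrow> x \<in> Q \<or> (\<exists>n::nat. y [^]\<^bsub>R\<^esub> n \<in> Q))"

definition primary_to :: "('a, 'c) ring_scheme \<Rightarrow> 'a set \<Rightarrow> 'a set \<Rightarrow> bool" where
  "primary_to R P Q \<longleftrightarrow> primary_ideal R Q \<and> radical R Q = P"

text \<open>Powers of ideals are powers in \<^const>\<open>ideals_set\<close>, whose multiplication is \<^const>\<open>ideal_prod\<close>.\<close>

definition integral_closure :: "('a, 'c) ring_scheme \<Rightarrow> 'a set \<Rightarrow> 'a set" where
  "integral_closure R I = {x \<in> carrier R. \<exists>(n::nat)\<ge>1. \<exists>c.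
     (\<forall>i\<in>{1..n}. c i \<in> I [^]\<^bsub>ideals_set R\<^esub> i) \<and>
     (x [^]\<^bsub>R\<^esub> n) \<oplus>\<^bsub>R\<^esub> (\<Oplus>\<^bsub>R\<^esub>i\<in>{1..n}. c i \<otimes>\<^bsub>R\<^esub> (x [^]\<^bsub>R\<^esub> (n - i))) = \<zero>\<^bsub>R\<^esub>}"

text \<open>\<open>exponent R b a\<close> is \<open>\<L>\<^sub>b(a)\<close>; in \<^typ>\<open>ereal\<close> the infimum of the empty set is \<open>\<infinity>\<close>.\<close>

definition exponent :: "('a, 'c) ring_scheme \<Rightarrow> 'a set \<Rightarrow> 'a set \<Rightarrow> ereal" where
  "exponent R b a = Inf {ereal (real q / real p) | p q. p > 0 \<and> q > 0 \<and>
     (\<forall>\<^sub>F t in sequentially. b [^]\<^bsub>ideals_set R\<^esub> (q * t)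
        \<subseteq> integral_closure R (a [^]\<^bsub>ideals_set R\<^esub> (p * t)))}"


section \<open>Affine semigroups and their cones\<close>

text \<open>
  A lattice of rank \<open>n \<ge> 1\<close> is \<open>\<int>\<^sup>n\<close>, with \<open>n = CARD('n)\<close>. Both \<open>N\<close> and its dual \<open>M\<close> are
  \<^typ>\<open>int ^ 'n\<close>, paired by \<^const>\<open>scalar_product\<close>; \<open>N\<^sub>\<real>\<close> and \<open>M\<^sub>\<real>\<close> are \<^typ>\<open>real ^ 'n\<close>,
  paired by the inner product.
\<close>

definition rvec :: "int ^ 'n \<Rightarrow> real ^ 'n" where
  "rvec u = (\<chi> i. real_of_int (u $ i))"

definition add_submonoid :: "'m::comm_monoid_add set \<Rightarrow> bool" where
  "add_submonoid S \<longleftrightarrow> 0 \<in> S \<and> (\<forall>x\<in>S. \<forall>y\<in>S. x + y \<in> S)"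

definition fin_gen_submonoid :: "'m::comm_monoid_add set \<Rightarrow> bool" where
  "fin_gen_submonoid S \<longleftrightarrow> (\<exists>G. finite G \<and> S = add_submonoid hull G)"

text \<open>\<open>wt_cone S\<close> is \<open>\<sigma>\<^sup>\<or> = \<real>\<^sub>\<ge>\<^sub>0 \<cdot> S\<close>, the cone generated by \<open>S\<close>, and \<open>dual_cone S\<close> is \<open>\<sigma>\<close>.\<close>

definition wt_cone :: "(int ^ 'n) set \<Rightarrow> (real ^ 'n) set" where
  "wt_cone S = convex_cone hull (rvec ` S)"

definition dual_cone :: "(int ^ 'n) set \<Rightarrow> (real ^ 'n) set" where
  "dual_cone S = {u. \<forall>x\<in>wt_cone S. 0 \<le> u \<bullet> x}"

text \<open>The cone of a finitely generated semigroup is automatically rational polyhedral.\<close>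

definition affine_semigroup :: "(int ^ 'n) set \<Rightarrow> bool" where
  "affine_semigroup S \<longleftrightarrow> fin_gen_submonoid S \<and>
     wt_cone S \<inter> uminus ` wt_cone S = {0} \<and>
     aff_dim (wt_cone S) = int CARD('n)"


section \<open>The local ring of an affine semigroup\<close>

text \<open>
  \<^typ>\<open>(int ^ 'n) \<Rightarrow>\<^sub>0 'k\<close> with convolution is the group ring \<open>k[M]\<close>, and \<open>k[S]\<close> consists of its
  elements supported on \<open>S\<close>. The monomial \<open>\<chi>\<^sup>m\<close> is \<^term>\<open>Poly_Mapping.single m 1\<close>.
\<close>

definition semigroup_ring :: "'m::comm_monoid_add set \<Rightarrow> ('m \<Rightarrow>\<^sub>0 'k::comm_ring_1) ring" where
  "semigroup_ring S = \<lparr>carrier = {f. Poly_Mapping.keys f \<subseteq> S},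
     mult = (*), one = 1, zero = 0, add = (+)\<rparr>"

definition irrelevant_ideal :: "'m::comm_monoid_add set \<Rightarrow> ('m \<Rightarrow>\<^sub>0 'k::comm_ring_1) set" where
  "irrelevant_ideal S =
     Idl\<^bsub>semigroup_ring S\<^esub> ((\<lambda>m. Poly_Mapping.single m 1) ` (S - {0}))"

definition units_at :: "'m::comm_monoid_add set \<Rightarrow> ('m \<Rightarrow>\<^sub>0 'k::comm_ring_1) set" where
  "units_at S = carrier (semigroup_ring S) - irrelevant_ideal S"

type_synonym ('m, 'k) germ = "(('m \<Rightarrow>\<^sub>0 'k) \<times> ('m \<Rightarrow>\<^sub>0 'k)) set"

definition local_ring :: "'m::comm_monoid_add set \<Rightarrow> ('m, 'k::comm_ring_1) germ ring" where
  "local_ring S = localization (semigroup_ring S) (units_at S)"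

definition chi :: "'m::comm_monoid_add set \<Rightarrow> 'm \<Rightarrow> ('m, 'k::comm_ring_1) germ" where
  "chi S m = frac (semigroup_ring S) (units_at S) (Poly_Mapping.single m 1) 1"

definition local_max_ideal :: "'m::comm_monoid_add set \<Rightarrow> ('m, 'k::comm_ring_1) germ set" where
  "local_max_ideal S = Idl\<^bsub>local_ring S\<^esub> (chi S ` (S - {0}))"

definition monomial_ideal ::
    "'m::comm_monoid_add set \<Rightarrow> ('m, 'k::comm_ring_1) germ set \<Rightarrow> bool" where
  "monomial_ideal S I \<longleftrightarrow> (\<exists>B\<subseteq>S. I = Idl\<^bsub>local_ring S\<^esub> (chi S ` B))"

text \<open>
  The value of \<open>f/s\<close> is \<open>v\<^sub>u(f) - v\<^sub>u(s)\<close>, computed on any representative; the infimum over the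
  empty support gives \<open>v\<^sub>u(0) = \<infinity>\<close>.
\<close>

definition poly_val :: "int ^ 'n \<Rightarrow> ((int ^ 'n) \<Rightarrow>\<^sub>0 'k::field) \<Rightarrow> ereal" where
  "poly_val u f = (INF m\<in>Poly_Mapping.keys f. ereal (real_of_int (scalar_product u m)))"

definition toric_val :: "int ^ 'n \<Rightarrow> (int ^ 'n, 'k::field) germ \<Rightarrow> ereal" where
  "toric_val u x = (case (SOME r. r \<in> x) of (f, s) \<Rightarrow> poly_val u f - poly_val u s)"

definition ideal_val :: "('a \<Rightarrow> ereal) \<Rightarrow> 'a set \<Rightarrow> ereal" where
  "ideal_val v I = (INF x\<in>I. v x)"


section \<open>Newton polyhedra\<close>

definition exponent_set ::
    "'m::comm_monoid_add set \<Rightarrow> ('m, 'k::comm_ring_1) germ set \<Rightarrow> 'm set" where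
  "exponent_set S I = {m \<in> S. chi S m \<in> I}"

definition newton_polyhedron ::
    "(int ^ 'n) set \<Rightarrow> (int ^ 'n, 'k::field) germ set \<Rightarrow> (real ^ 'n) set" where
  "newton_polyhedron S I =
     {x + y | x y. x \<in> convex hull (rvec ` exponent_set S I) \<and> y \<in> wt_cone S}"

definition support_fun :: "'v::real_inner set \<Rightarrow> 'v \<Rightarrow> real" where
  "support_fun C u = (INF x\<in>C. u \<bullet> x)"

definition inward_normal :: "'v::real_inner set \<Rightarrow> 'v set \<Rightarrow> 'v \<Rightarrow> bool" where
  "inward_normal C F u \<longleftrightarrow> u \<noteq> 0 \<and>
     (\<exists>c. C \<subseteq> {x. c \<le> u \<bullet> x} \<and> F = C \<inter> {x. u \<bullet> x = c})"

definition compact_facet ::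
    "(int ^ 'n) set \<Rightarrow> (real ^ 'n) set \<Rightarrow> (real ^ 'n) set \<Rightarrow> bool" where
  "compact_facet S C F \<longleftrightarrow> F facet_of C \<and>
     (\<exists>u. inward_normal C F u \<and> {x. u \<bullet> x = 0} \<inter> wt_cone S = {0})"

definition primitive :: "int ^ 'n \<Rightarrow> bool" where
  "primitive u \<longleftrightarrow> (GCD i\<in>UNIV. u $ i) = 1"

definition compact_normals ::
    "(int ^ 'n) set \<Rightarrow> (int ^ 'n, 'k::field) germ set \<Rightarrow> (int ^ 'n) set" where
  "compact_normals S I = {u. primitive u \<and> rvec u \<in> dual_cone S \<and>
     (\<exists>F. compact_facet S (newton_polyhedron S I) F \<and>
          inward_normal (newton_polyhedron S I) F (rvec u))}"

end

theory Submission
  imports Defs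
begin

text \<open>
  A monomial ideal of \<open>R\<close> consists of the fractions \<open>f/s\<close> whose numerator is supported on its set
  \<open>E\<close> of exponents, and products of ideals correspond to sums of exponent sets. A monomial
  integral over \<open>I\<close> has value at least \<open>h\<^bsub>NP(I)\<^esub>(u)\<close> under every \<open>v\<^sub>u\<close>. Conversely, if
  \<open>m\<close> lies in \<open>NP(I)\<close> then some multiple \<open>K m\<close> is a sum of \<open>K\<close> exponents of \<open>I\<close> and an
  element of \<open>S\<close>, and a polynomial all of whose monomials have this property is integral over
  \<open>I\<close> because it maps a module spanned by finitely many monomials into \<open>I\<close> times this module.
  So \<open>b\<^bsup>qt\<^esup>\<close> is contained in the integral closure of \<open>a\<^bsup>pt\<^esup>\<close> iff \<open>q NP(b) \<subseteq> p NP(a)\<close>. The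
  right hand side can be tested on the facet normals of \<open>NP(a)\<close>; on the noncompact facets the
  support function of \<open>NP(a)\<close> vanishes, because \<open>a\<close> contains a power of every monomial of
  \<open>S\<close> other than 1.
\<close>

section \<open>Localization at regular elements\<close>

text \<open>Integrality of single monomials does not by itself give integrality of a sum. The module
  argument therefore runs on a whole numerator \<open>f\<close> with all its monomials together,
  while the opposite inequality is tested on single monomials, one weight at a time. Denominators
  are the polynomials with nonzero constant term. A linear functional that is positive on the
  nonzero points of the cone grades \<open>S\<close>; among the terms of a numerator outside a given
  monomial ideal, one of least degree survives multiplication by a denominator, so membership in the
  ideal can be read from any numerator. From there on, ideals are replaced by their exponent sets.
  The quotients of support functions make sense because the normal of a compact facet is positive on
  all nonzero points of the cone, and the exponent set of a proper nonzero monomial ideal is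
  nonempty and avoids 0; its least value under such a normal is then positive.\<close>

locale regular_localization =
  fixes A W :: "'a::comm_ring_1 set"
  assumes A_zero: "0 \<in> A" and A_one: "1 \<in> A"
    and A_add: "\<And>x y. x \<in> A \<Longrightarrow> y \<in> A \<Longrightarrow> x + y \<in> A"
    and A_uminus: "\<And>x. x \<in> A \<Longrightarrow> - x \<in> A"
    and A_mult: "\<And>x y. x \<in> A \<Longrightarrow> y \<in> A \<Longrightarrow> x * y \<in> A"
    and W_subset: "W \<subseteq> A" and W_one: "1 \<in> W"
    and W_mult: "\<And>x y. x \<in> W \<Longrightarrow> y \<in> W \<Longrightarrow> x * y \<in> W"
    and W_regular: "\<And>w x. w \<in> W \<Longrightarrow> x \<in> A \<Longrightarrow> w * x = 0 \<Longrightarrow> x = 0"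
begin

text \<open>The record view of the subset \<open>A\<close>. Identities between fractions become
  equations of the ambient type, where \<open>algebra_simps\<close> applies.\<close>

definition base :: "'a ring" where
  "base = \<lparr>carrier = A, mult = (*), one = 1, zero = 0, add = (+)\<rparr>"

abbreviation fr :: "'a \<Rightarrow> 'a \<Rightarrow> ('a \<times> 'a) set" where "fr \<equiv> frac base W"
abbreviation L :: "('a \<times> 'a) set ring" where "L \<equiv> localization base W"

lemma base_simps [simp]:
  "carrier base = A" "mult base = (*)" "one base = 1" "zero base = 0" "add base = (+)"
  by (simp_all add: base_def)

lemma cring_base: "cring base"
proof (rule cringI)
  show "abelian_group base"
  proof (rule abelian_groupI)
    show "\<exists>y\<in>carrier base. y \<oplus>\<^bsub>base\<^esub> x = \<zero>\<^bsub>base\<^esub>" if "x \<in> carrier base" for x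
      using that A_uminus by (intro bexI[of _ "- x"]) auto
  qed (auto simp: A_zero A_add algebra_simps)
  show "comm_monoid base"
    by (rule comm_monoidI) (auto simp: A_one A_mult algebra_simps)
qed (auto simp: algebra_simps)

lemma W_in_A: "w \<in> W \<Longrightarrow> w \<in> A"
  using W_subset by auto

lemma W_power: "w \<in> W \<Longrightarrow> w ^ n \<in> W"
  by (induction n) (auto simp: W_one W_mult)

lemma A_power: "x \<in> A \<Longrightarrow> x ^ n \<in> A"
  by (induction n) (auto simp: A_one A_mult)

lemma A_diff: "x \<in> A \<Longrightarrow> y \<in> A \<Longrightarrow> x - y \<in> A"
  using A_add[of x "- y"] A_uminus[of y] by simp

lemma W_cancel: "w \<in> W \<Longrightarrow> x \<in> A \<Longrightarrow> y \<in> A \<Longrightarrow> w * x = w * y \<Longrightarrow> x = y"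
  using W_regular[of w "x - y"] A_diff[of x y] by (simp add: algebra_simps)

lemma minus_base: "x \<in> A \<Longrightarrow> y \<in> A \<Longrightarrow> x \<ominus>\<^bsub>base\<^esub> y = x - y"
proof -
  assume xy: "x \<in> A" "y \<in> A"
  interpret cring base by (rule cring_base)
  have "\<ominus>\<^bsub>base\<^esub> y = - y"
    by (rule minus_equality) (use xy A_uminus in auto)
  then show ?thesis by (simp add: a_minus_def)
qed

text \<open>The factor \<open>w\<close> in the definition of equal fractions is regular and cancels,
  so equality is plain cross multiplication.\<close>

lemma frac_rel_iff:
  "((a, s), (b, t)) \<in> frac_rel base W \<longleftrightarrow> a \<in> A \<and> s \<in> W \<and> b \<in> A \<and> t \<in> W \<and> t * a = s * b"
proof -
  have "(\<exists>w\<in>W. w * (t * a \<ominus>\<^bsub>base\<^esub> s * b) = 0) \<longleftrightarrow> t * a = s * b"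
    if "a \<in> A" "s \<in> W" "b \<in> A" "t \<in> W"
  proof -
    have ta: "t * a \<in> A" and sb: "s * b \<in> A" using that by (auto simp: A_mult W_in_A)
    then show ?thesis
      using W_regular[OF _ A_diff[OF ta sb]] W_one by (auto simp: minus_base)
  qed
  then show ?thesis by (auto simp: frac_rel_def)
qed

lemma equiv_frac_rel: "equiv (A \<times> W) (frac_rel base W)"
proof (rule equivI)
  show "trans (frac_rel base W)"
  proof (rule transI, clarsimp simp: frac_rel_iff)
    fix a s b t c r
    assume *: "a \<in> A" "s \<in> W" "b \<in> A" "t \<in> W" "c \<in> A" "r \<in> W"
      "t * a = s * b" "r * b = t * c"
    have "t * (r * a) = r * (t * a)" by (simp add: ac_simps)
    also have "\<dots> = s * (r * b)" unfolding *(7) by (simp add: ac_simps)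
    also have "\<dots> = t * (s * c)" unfolding *(8) by (simp add: ac_simps)
    finally show "r * a = s * c"
      by (rule W_cancel[rotated 3]) (simp_all only: *(1-6) A_mult W_in_A)
  qed
qed (auto simp: refl_on_def sym_def frac_rel_iff)

lemma mem_fr_iff:
  assumes "a \<in> A" "s \<in> W"
  shows "(b, t) \<in> fr a s \<longleftrightarrow> b \<in> A \<and> t \<in> W \<and> t * a = s * b"
  using assms by (simp add: frac_def frac_rel_iff)

lemma fr_eq_iff:
  assumes "a \<in> A" "s \<in> W" "b \<in> A" "t \<in> W"
  shows "fr a s = fr b t \<longleftrightarrow> t * a = s * b"
  using eq_equiv_class_iff[OF equiv_frac_rel, of "(a, s)" "(b, t)"] assms
  by (simp add: frac_def frac_rel_iff)

lemma carrier_L: "carrier L = {fr a s |a s. a \<in> A \<and> s \<in> W}"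
  by (auto simp: localization_def quotient_def frac_def)

lemma fr_closed: "a \<in> A \<Longrightarrow> s \<in> W \<Longrightarrow> fr a s \<in> carrier L"
  by (auto simp: carrier_L)

text \<open>The operations of \<open>localization\<close> are unions over all pairs of
  representatives. Such a union collapses to one member once its members do not depend on the
  representatives.\<close>

lemma UN_fr:
  assumes a: "a \<in> A" "s \<in> W" and b: "b \<in> A" "t \<in> W"
    and eq: "\<And>a' s' b' t'. (a', s') \<in> fr a s \<Longrightarrow> (b', t') \<in> fr b t \<Longrightarrow> F a' s' b' t' = F a s b t"
  shows "(\<Union>(a', s')\<in>fr a s. \<Union>(b', t')\<in>fr b t. F a' s' b' t') = F a s b t"
proof -
  have "(a, s) \<in> fr a s" "(b, t) \<in> fr b t"
    using a b by (auto simp: mem_fr_iff)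
  with eq show ?thesis by fast
qed

lemma mult_fr:
  assumes "a \<in> A" "s \<in> W" "b \<in> A" "t \<in> W"
  shows "fr a s \<otimes>\<^bsub>L\<^esub> fr b t = fr (a * b) (s * t)"
proof -
  have "(\<Union>(a', s')\<in>fr a s. \<Union>(b', t')\<in>fr b t. fr (a' * b') (s' * t')) = fr (a * b) (s * t)"
  proof (rule UN_fr[OF assms])
    fix a' s' b' t' assume "(a', s') \<in> fr a s" "(b', t') \<in> fr b t"
    with assms have *: "a' \<in> A" "s' \<in> W" "s' * a = s * a'" "b' \<in> A" "t' \<in> W" "t' * b = t * b'"
      by (auto simp: mem_fr_iff)
    have "(s * t) * (a' * b') = (s * a') * (t * b')" by (simp add: ac_simps)
    also have "\<dots> = (s' * a) * (t' * b)" using * by simp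
    also have "\<dots> = (s' * t') * (a * b)" by (simp add: ac_simps)
    finally show "fr (a' * b') (s' * t') = fr (a * b) (s * t)"
      using assms * by (subst fr_eq_iff) (auto intro: A_mult W_mult)
  qed
  then show ?thesis by (simp add: localization_def)
qed

lemma add_fr:
  assumes "a \<in> A" "s \<in> W" "b \<in> A" "t \<in> W"
  shows "fr a s \<oplus>\<^bsub>L\<^esub> fr b t = fr (t * a + s * b) (s * t)"
proof -
  have "(\<Union>(a', s')\<in>fr a s. \<Union>(b', t')\<in>fr b t. fr (t' * a' + s' * b') (s' * t'))
      = fr (t * a + s * b) (s * t)"
  proof (rule UN_fr[OF assms])
    fix a' s' b' t' assume "(a', s') \<in> fr a s" "(b', t') \<in> fr b t"
    with assms have *: "a' \<in> A" "s' \<in> W" "s' * a = s * a'" "b' \<in> A" "t' \<in> W" "t' * b = t * b'"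
      by (auto simp: mem_fr_iff)
    have "(s * t) * (t' * a' + s' * b') = t * t' * (s * a') + s * s' * (t * b')"
      by (simp add: algebra_simps)
    also have "\<dots> = t * t' * (s' * a) + s * s' * (t' * b)" using * by simp
    also have "\<dots> = (s' * t') * (t * a + s * b)" by (simp add: algebra_simps)
    finally show "fr (t' * a' + s' * b') (s' * t') = fr (t * a + s * b) (s * t)"
      using assms * by (subst fr_eq_iff) (auto simp: A_mult A_add W_mult W_in_A)
  qed
  then show ?thesis by (simp add: localization_def)
qed

lemma one_L: "\<one>\<^bsub>L\<^esub> = fr 1 1" and zero_L: "\<zero>\<^bsub>L\<^esub> = fr 0 1"
  by (simp_all add: localization_def)

lemmas closures = A_zero A_one A_uminus A_add A_mult W_one W_mult W_in_A

lemma carrier_LE: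
  assumes "x \<in> carrier L"
  obtains a s where "x = fr a s" "a \<in> A" "s \<in> W"
  using assms by (auto simp: carrier_L)

lemma fr_eqI: "a \<in> A \<Longrightarrow> s \<in> W \<Longrightarrow> b \<in> A \<Longrightarrow> t \<in> W \<Longrightarrow> t * a = s * b \<Longrightarrow> fr a s = fr b t"
  by (simp add: fr_eq_iff)

lemma cring_L: "cring L"
proof (rule cringI)
  show "abelian_group L"
  proof (rule abelian_groupI)
    fix x y z assume "x \<in> carrier L" "y \<in> carrier L" "z \<in> carrier L"
    then obtain a s b t c r where *: "x = fr a s" "y = fr b t" "z = fr c r"
      and mem: "a \<in> A" "s \<in> W" "b \<in> A" "t \<in> W" "c \<in> A" "r \<in> W"
      by (elim carrier_LE)
    show "x \<oplus>\<^bsub>L\<^esub> y \<in> carrier L"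
      unfolding * by (simp add: add_fr mem fr_closed closures)
    show "(x \<oplus>\<^bsub>L\<^esub> y) \<oplus>\<^bsub>L\<^esub> z = x \<oplus>\<^bsub>L\<^esub> (y \<oplus>\<^bsub>L\<^esub> z)"
      unfolding * by (simp add: add_fr mem closures) (simp add: algebra_simps)
    show "x \<oplus>\<^bsub>L\<^esub> y = y \<oplus>\<^bsub>L\<^esub> x"
      unfolding * by (simp add: add_fr mem) (simp only: ac_simps)
    show "\<zero>\<^bsub>L\<^esub> \<oplus>\<^bsub>L\<^esub> x = x"
      unfolding * by (simp add: zero_L add_fr mem closures)
    have "fr (- a) s \<oplus>\<^bsub>L\<^esub> x = \<zero>\<^bsub>L\<^esub>"
      unfolding * zero_L by (simp add: add_fr mem closures) (rule fr_eqI; simp add: mem closures)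
    then show "\<exists>y\<in>carrier L. y \<oplus>\<^bsub>L\<^esub> x = \<zero>\<^bsub>L\<^esub>"
      using fr_closed[of "- a" s] mem closures by blast
  qed (simp add: zero_L fr_closed closures)
  show "comm_monoid L"
  proof (rule comm_monoidI)
    fix x y z assume "x \<in> carrier L" "y \<in> carrier L" "z \<in> carrier L"
    then obtain a s b t c r where *: "x = fr a s" "y = fr b t" "z = fr c r"
      and mem: "a \<in> A" "s \<in> W" "b \<in> A" "t \<in> W" "c \<in> A" "r \<in> W"
      by (elim carrier_LE)
    show "x \<otimes>\<^bsub>L\<^esub> y \<in> carrier L"
      unfolding * by (simp add: mult_fr mem fr_closed closures)
    show "(x \<otimes>\<^bsub>L\<^esub> y) \<otimes>\<^bsub>L\<^esub> z = x \<otimes>\<^bsub>L\<^esub> (y \<otimes>\<^bsub>L\<^esub> z)"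
      unfolding * by (simp add: mult_fr mem closures) (simp only: ac_simps)
    show "x \<otimes>\<^bsub>L\<^esub> y = y \<otimes>\<^bsub>L\<^esub> x"
      unfolding * by (simp add: mult_fr mem) (simp only: ac_simps)
    show "\<one>\<^bsub>L\<^esub> \<otimes>\<^bsub>L\<^esub> x = x"
      unfolding * by (simp add: one_L mult_fr mem closures)
  qed (simp add: one_L fr_closed closures)
  fix x y z assume "x \<in> carrier L" "y \<in> carrier L" "z \<in> carrier L"
  then obtain a s b t c r where *: "x = fr a s" "y = fr b t" "z = fr c r"
    and mem: "a \<in> A" "s \<in> W" "b \<in> A" "t \<in> W" "c \<in> A" "r \<in> W"
    by (elim carrier_LE)
  have "(x \<oplus>\<^bsub>L\<^esub> y) \<otimes>\<^bsub>L\<^esub> z = fr ((t * a + s * b) * c) (s * t * r)"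
    unfolding * by (simp add: mult_fr add_fr mem closures)
  also have "\<dots> = fr (t * r * (a * c) + s * r * (b * c)) (s * r * (t * r))"
    by (rule fr_eqI) (simp_all add: mem closures, simp add: algebra_simps)
  also have "\<dots> = x \<otimes>\<^bsub>L\<^esub> z \<oplus>\<^bsub>L\<^esub> y \<otimes>\<^bsub>L\<^esub> z"
    unfolding * by (simp add: mult_fr add_fr mem closures)
  finally show "(x \<oplus>\<^bsub>L\<^esub> y) \<otimes>\<^bsub>L\<^esub> z = x \<otimes>\<^bsub>L\<^esub> z \<oplus>\<^bsub>L\<^esub> y \<otimes>\<^bsub>L\<^esub> z" .
qed

lemma pow_fr:
  assumes "a \<in> A" "s \<in> W"
  shows "fr a s [^]\<^bsub>L\<^esub> (n::nat) = fr (a ^ n) (s ^ n)"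
proof -
  interpret cring L by (rule cring_L)
  show ?thesis
    using assms by (induction n) (auto simp: one_L mult_fr A_power W_power mult.commute)
qed

lemma add_fr_same:
  assumes "a \<in> A" "b \<in> A" "s \<in> W"
  shows "fr a s \<oplus>\<^bsub>L\<^esub> fr b s = fr (a + b) s"
  using assms
  by (simp add: add_fr, subst fr_eq_iff) (auto simp: A_mult A_add W_mult W_in_A algebra_simps)

text \<open>Membership of the sum in \<open>A\<close> is proved along with the equation because the
  induction step adds a fraction whose numerator is the partial sum.\<close>

lemma finsum_fr:
  assumes "finite I" "\<And>i. i \<in> I \<Longrightarrow> a i \<in> A" "s \<in> W"
  shows "(\<Oplus>\<^bsub>L\<^esub>i\<in>I. fr (a i) s) = fr (\<Sum>i\<in>I. a i) s \<and> (\<Sum>i\<in>I. a i) \<in> A"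
proof -
  interpret cring L by (rule cring_L)
  have "fr 0 1 = fr 0 s" using assms by (subst fr_eq_iff) (auto simp: A_zero W_one)
  with assms show ?thesis
    by (induction I) (auto simp: zero_L A_zero fr_closed add_fr_same A_add)
qed

end

section \<open>Monomial ideals of the local ring\<close>

definition supported_on :: "'m set \<Rightarrow> ('m \<Rightarrow>\<^sub>0 'k::zero) set" where
  "supported_on E = {f. Poly_Mapping.keys f \<subseteq> E}"

definition msum :: "'m::plus set \<Rightarrow> 'm set \<Rightarrow> 'm set" where
  "msum E F = {x + y |x y. x \<in> E \<and> y \<in> F}"

lemma supported_on_zero [simp]: "0 \<in> supported_on E"
  by (simp add: supported_on_def)

lemma supported_on_add: "f \<in> supported_on E \<Longrightarrow> g \<in> supported_on E \<Longrightarrow> f + g \<in> supported_on E"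
  using Poly_Mapping.keys_add[of f g] by (auto simp: supported_on_def)

lemma supported_on_uminus: "f \<in> supported_on E \<Longrightarrow> - f \<in> supported_on (E :: 'm set)"
  for f :: "'m \<Rightarrow>\<^sub>0 'k::ab_group_add"
  by (auto simp: supported_on_def in_keys_iff)

lemma supported_on_mono: "f \<in> supported_on E \<Longrightarrow> E \<subseteq> F \<Longrightarrow> f \<in> supported_on F"
  by (auto simp: supported_on_def)

lemma supported_on_mult:
  fixes f g :: "'m::comm_monoid_add \<Rightarrow>\<^sub>0 'k::comm_ring_1"
  shows "f \<in> supported_on E \<Longrightarrow> g \<in> supported_on F \<Longrightarrow> f * g \<in> supported_on (msum E F)"
  using keys_mult[of f g] by (fastforce simp: supported_on_def msum_def)

lemma supported_on_single: "m \<in> E \<Longrightarrow> Poly_Mapping.single m c \<in> supported_on E"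
  by (auto simp: supported_on_def)

lemma single_one_in_supported_on [simp]:
  "Poly_Mapping.single m (1 :: 'k::zero_neq_one) \<in> supported_on E \<longleftrightarrow> m \<in> E"
  by (auto simp: supported_on_def)

lemma poly_mapping_sum_singles:
  fixes f :: "'m \<Rightarrow>\<^sub>0 'k::comm_monoid_add"
  shows "f = (\<Sum>m\<in>Poly_Mapping.keys f. Poly_Mapping.single m (Poly_Mapping.lookup f m))"
proof (rule poly_mapping_eqI)
  fix k
  show "Poly_Mapping.lookup f k = Poly_Mapping.lookup
      (\<Sum>m\<in>Poly_Mapping.keys f. Poly_Mapping.single m (Poly_Mapping.lookup f m)) k"
    by (auto simp: lookup_sum lookup_single when_def in_keys_iff)
qed

lemma lookup_const_mult:
  fixes f :: "'m::comm_monoid_add \<Rightarrow>\<^sub>0 'k::comm_ring_1"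
  shows "Poly_Mapping.lookup (Poly_Mapping.single 0 c * f) m = c * Poly_Mapping.lookup f m"
  by (subst mult_map_scale_conv_mult[symmetric]) (auto simp: Poly_Mapping.map.rep_eq when_def)

section \<open>Semigroups graded by a positive weight\<close>

locale graded_semigroup =
  fixes S :: "'m::ab_group_add set" and ell :: "'m \<Rightarrow> real"
  assumes submonoid: "add_submonoid S"
    and ell_add: "\<And>x y. ell (x + y) = ell x + ell y"
    and ell_pos: "\<And>x. x \<in> S \<Longrightarrow> x \<noteq> 0 \<Longrightarrow> ell x > 0"
begin

lemma zero_in_S [simp]: "0 \<in> S" and S_add: "x \<in> S \<Longrightarrow> y \<in> S \<Longrightarrow> x + y \<in> S"
  using submonoid by (auto simp: add_submonoid_def)

lemma ell_zero [simp]: "ell 0 = 0"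
  using ell_add[of 0 0] by simp

lemma ell_nonneg: "x \<in> S \<Longrightarrow> ell x \<ge> 0"
  using ell_pos[of x] by (cases "x = 0") auto

lemma S_sum_eq_0: "x \<in> S \<Longrightarrow> y \<in> S \<Longrightarrow> x + y = 0 \<Longrightarrow> x = 0"
  by (metis add_pos_nonneg ell_add ell_nonneg ell_pos ell_zero order_less_irrefl)

text \<open>Semigroup ideals. They are the exponent sets of monomial ideals; the empty set belongs
  to the zero ideal.\<close>

definition sideal :: "'m set \<Rightarrow> bool" where
  "sideal E \<longleftrightarrow> E \<subseteq> S \<and> msum E S \<subseteq> E"

lemma msumI: "x \<in> E \<Longrightarrow> y \<in> F \<Longrightarrow> x + y \<in> msum E F"
  unfolding msum_def by blast

lemma msumE:
  assumes "z \<in> msum E F" obtains x y where "z = x + y" "x \<in> E" "y \<in> F"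
  using assms unfolding msum_def by blast

lemma sideal_subset: "sideal E \<Longrightarrow> E \<subseteq> S"
  by (simp add: sideal_def)

lemma sideal_add: "sideal E \<Longrightarrow> x \<in> E \<Longrightarrow> y \<in> S \<Longrightarrow> x + y \<in> E"
  using msumI[of x E y S] by (auto simp: sideal_def)

lemma sidealI:
  assumes "E \<subseteq> S" "\<And>x y. x \<in> E \<Longrightarrow> y \<in> S \<Longrightarrow> x + y \<in> E"
  shows "sideal E"
  using assms by (auto simp: sideal_def elim: msumE)

lemma sideal_S: "sideal S"
  by (rule sidealI) (auto intro: S_add)

lemma sideal_empty: "sideal {}"
  by (rule sidealI) auto

lemma sideal_pos: "sideal (S - {0})"
  by (rule sidealI) (use S_sum_eq_0 in \<open>auto intro: S_add\<close>)

lemma sideal_msum: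
  assumes E: "sideal E" and F: "sideal F"
  shows "sideal (msum E F)"
proof (rule sidealI)
  show "msum E F \<subseteq> S"
    using sideal_subset[OF E] sideal_subset[OF F] by (auto elim!: msumE intro!: S_add)
  fix z y assume "z \<in> msum E F" "y \<in> S"
  then obtain e f where "z = e + f" "e \<in> E" "f \<in> F" by (elim msumE)
  then show "z + y \<in> msum E F"
    using msumI[of e E "f + y" F] sideal_add[OF F] \<open>y \<in> S\<close> by (simp add: add.assoc)
qed

lemma sideal_msum_S:
  assumes B: "B \<subseteq> S"
  shows "sideal (msum B S)"
proof (rule sidealI)
  show "msum B S \<subseteq> S"
    using B by (auto elim!: msumE intro!: S_add)
  fix z y assume "z \<in> msum B S" "y \<in> S"
  then obtain e f where "z = e + f" "e \<in> B" "f \<in> S" by (elim msumE)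
  then show "z + y \<in> msum B S"
    using msumI[of e B "f + y" S] S_add \<open>y \<in> S\<close> by (simp add: add.assoc)
qed

lemma subset_msum_S: "B \<subseteq> msum B S"
  using msumI[of _ B 0 S] by auto

lemma msum_S_eq: "sideal E \<Longrightarrow> msum E S = E"
  using subset_msum_S[of E] by (auto simp: sideal_def)

lemma supported_on_sideal_mult:
  fixes f g :: "'m \<Rightarrow>\<^sub>0 'k::field"
  shows "sideal E \<Longrightarrow> f \<in> supported_on E \<Longrightarrow> g \<in> supported_on S \<Longrightarrow> f * g \<in> supported_on E"
  using supported_on_mult[of f E g S] by (auto simp: msum_S_eq)

text \<open>An explicit form of the denominators \<open>units_at S\<close>: the irrelevant ideal
  consists of the elements of \<open>k[S]\<close> without constant term.\<close>

definition const_units :: "('m \<Rightarrow>\<^sub>0 'k::field) set" where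
  "const_units = {f \<in> supported_on S. Poly_Mapping.lookup f 0 \<noteq> 0}"

lemma split_const:
  fixes f :: "'m \<Rightarrow>\<^sub>0 'k::field"
  assumes "f \<in> supported_on S"
  obtains f' where "f' \<in> supported_on (S - {0})"
    "f = Poly_Mapping.single 0 (Poly_Mapping.lookup f 0) + f'"
proof
  let ?f' = "f - Poly_Mapping.single 0 (Poly_Mapping.lookup f 0)"
  have "Poly_Mapping.lookup ?f' 0 = 0" by (simp add: lookup_minus)
  moreover have "?f' \<in> supported_on S"
    using supported_on_add[OF assms supported_on_uminus[OF supported_on_single[of 0 S]]] by simp
  ultimately show "?f' \<in> supported_on (S - {0})"
    by (auto simp: supported_on_def in_keys_iff)
qed simp

text \<open>\<open>S - {0}\<close> is a semigroup ideal, so what remains of \<open>f\<close> after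
  removal of its constant term contributes nothing to the constant term of the product.\<close>

lemma lookup_mult_zero:
  fixes f g :: "'m \<Rightarrow>\<^sub>0 'k::field"
  assumes "f \<in> supported_on S" "g \<in> supported_on S"
  shows "Poly_Mapping.lookup (f * g) 0 = Poly_Mapping.lookup f 0 * Poly_Mapping.lookup g 0"
proof -
  obtain f' where f': "f' \<in> supported_on (S - {0})"
    "f = Poly_Mapping.single 0 (Poly_Mapping.lookup f 0) + f'"
    using split_const[OF assms(1)] .
  have "f' * g \<in> supported_on (S - {0})"
    using supported_on_sideal_mult[OF sideal_pos f'(1) assms(2)] .
  then have "Poly_Mapping.lookup (f' * g) 0 = 0"
    by (auto simp: supported_on_def in_keys_iff)
  moreover have "f * g = Poly_Mapping.single 0 (Poly_Mapping.lookup f 0) * g + f' * g"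
    by (subst f'(2)) (simp add: algebra_simps)
  ultimately show ?thesis by (simp add: lookup_add lookup_const_mult)
qed

text \<open>Look at a term of \<open>f\<close> outside \<open>E\<close> of least degree: it is not cancelled in \<open>z * f\<close>.\<close>

lemma supported_on_cancel:
  fixes f z :: "'m \<Rightarrow>\<^sub>0 'k::field"
  assumes E: "sideal E" and f: "f \<in> supported_on S" and z: "z \<in> const_units"
    and zf: "z * f \<in> supported_on E"
  shows "f \<in> supported_on E"
proof (rule ccontr)
  assume "f \<notin> supported_on E"
  then have ne: "Poly_Mapping.keys f - E \<noteq> {}" by (auto simp: supported_on_def)
  obtain m where m: "m \<in> Poly_Mapping.keys f - E"
    "\<And>m'. m' \<in> Poly_Mapping.keys f - E \<Longrightarrow> ell m \<le> ell m'"
    using ex_min_if_finite[of "ell ` (Poly_Mapping.keys f - E)"] ne by (force simp: not_less)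
  have zS: "z \<in> supported_on S" and z0: "Poly_Mapping.lookup z 0 \<noteq> 0"
    using z by (auto simp: const_units_def)
  obtain z' where z': "z' \<in> supported_on (S - {0})"
    "z = Poly_Mapping.single 0 (Poly_Mapping.lookup z 0) + z'"
    using split_const[OF zS] .
  have "m \<notin> Poly_Mapping.keys (z' * f)"
  proof
    assume "m \<in> Poly_Mapping.keys (z' * f)"
    then obtain k m' where km: "m = k + m'" "k \<in> Poly_Mapping.keys z'" "m' \<in> Poly_Mapping.keys f"
      using keys_mult[of z' f] by blast
    then have k: "k \<in> S" "k \<noteq> 0" using z'(1) by (auto simp: supported_on_def)
    then have "ell m' < ell m" using ell_pos ell_add km by simp
    then have "m' \<in> E" using m(2)[of m'] km by auto
    then show False using sideal_add[OF E, of m' k] m(1) km k by (simp add: add.commute)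
  qed
  moreover have "z * f = Poly_Mapping.single 0 (Poly_Mapping.lookup z 0) * f + z' * f"
    by (subst z'(2)) (simp add: algebra_simps)
  ultimately have "Poly_Mapping.lookup (z * f) m = Poly_Mapping.lookup z 0 * Poly_Mapping.lookup f m"
    by (simp add: lookup_add lookup_const_mult in_keys_iff)
  then have "m \<in> Poly_Mapping.keys (z * f)" using z0 m(1) by (simp add: in_keys_iff)
  then show False using zf m(1) by (auto simp: supported_on_def)
qed

end

sublocale graded_semigroup \<subseteq> regular_localization "supported_on S :: ('m \<Rightarrow>\<^sub>0 'k::field) set" const_units
proof
  fix x y :: "'m \<Rightarrow>\<^sub>0 'k"
  show "x \<in> supported_on S \<Longrightarrow> y \<in> supported_on S \<Longrightarrow> x * y \<in> supported_on S"
    by (rule supported_on_sideal_mult[OF sideal_S])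
  then show "x \<in> const_units \<Longrightarrow> y \<in> const_units \<Longrightarrow> x * y \<in> const_units"
    by (auto simp: const_units_def lookup_mult_zero)
  \<comment> \<open>Regularity is cancellation for the empty semigroup ideal, since only 0 has empty
    support.\<close>
  show "x \<in> const_units \<Longrightarrow> y \<in> supported_on S \<Longrightarrow> x * y = 0 \<Longrightarrow> y = 0"
    using supported_on_cancel[OF sideal_empty, of y x] by (simp add: supported_on_def)
qed (auto simp: const_units_def supported_on_add supported_on_uminus supported_on_single simp flip: single_one)

section \<open>The local ring and its monomial ideals\<close>

context graded_semigroup
begin

lemma semigroup_ring_eq: "semigroup_ring S = (base :: ('m \<Rightarrow>\<^sub>0 'k::field) ring)"
  unfolding base_def unfolding semigroup_ring_def supported_on_def ..

lemma ideal_supported_on: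
  assumes "sideal E"
  shows "ideal (supported_on E :: ('m \<Rightarrow>\<^sub>0 'k::field) set) base"
proof -
  interpret cring "base :: ('m \<Rightarrow>\<^sub>0 'k) ring" by (rule cring_base)
  show ?thesis
  proof (rule idealI)
    show "subgroup (supported_on E) (add_monoid (base :: ('m \<Rightarrow>\<^sub>0 'k) ring))"
    proof (rule add.subgroupI)
      show "\<ominus>\<^bsub>base\<^esub> f \<in> supported_on E" if "f \<in> supported_on E" for f :: "'m \<Rightarrow>\<^sub>0 'k"
      proof -
        have "f \<in> supported_on S" using that sideal_subset[OF assms] by (rule supported_on_mono)
        then have "\<ominus>\<^bsub>base\<^esub> f = - f"
          by (intro minus_equality) (auto intro: supported_on_uminus)
        then show ?thesis using supported_on_uminus[OF that] by simp
      qed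
      show "supported_on E \<noteq> ({} :: ('m \<Rightarrow>\<^sub>0 'k) set)" using supported_on_zero by blast
    qed (use assms sideal_subset in \<open>auto intro: supported_on_mono supported_on_add\<close>)
  qed (use assms in \<open>auto intro: supported_on_sideal_mult ring_axioms simp: mult.commute\<close>)
qed

lemma irrelevant_ideal_eq:
  "irrelevant_ideal S = (supported_on (S - {0}) :: ('m \<Rightarrow>\<^sub>0 'k::field) set)"
proof
  interpret cring "base :: ('m \<Rightarrow>\<^sub>0 'k) ring" by (rule cring_base)
  let ?X = "(\<lambda>m. Poly_Mapping.single m (1::'k)) ` (S - {0})"
  show "irrelevant_ideal S \<subseteq> (supported_on (S - {0}) :: ('m \<Rightarrow>\<^sub>0 'k) set)"
    unfolding irrelevant_ideal_def semigroup_ring_eq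
    by (rule genideal_minimal[OF ideal_supported_on[OF sideal_pos]]) auto
  have X: "?X \<subseteq> carrier base" by auto
  then have id: "ideal (Idl\<^bsub>base\<^esub> ?X) base" by (rule genideal_ideal)
  show "(supported_on (S - {0}) :: ('m \<Rightarrow>\<^sub>0 'k) set) \<subseteq> irrelevant_ideal S"
    unfolding irrelevant_ideal_def semigroup_ring_eq
  proof
    fix f :: "'m \<Rightarrow>\<^sub>0 'k" assume f: "f \<in> supported_on (S - {0})"
    have "(\<Sum>m\<in>K. Poly_Mapping.single m (Poly_Mapping.lookup f m)) \<in> Idl\<^bsub>base\<^esub> ?X"
      if "K \<subseteq> S - {0}" "finite K" for K
      using that(2,1)
    proof (induction K)
      case empty
      then show ?case using additive_subgroup.zero_closed[OF ideal.axioms(1)[OF id]] by simp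
    next
      case (insert m K)
      have "Poly_Mapping.single 0 (Poly_Mapping.lookup f m) \<otimes>\<^bsub>base\<^esub> Poly_Mapping.single m 1 \<in> Idl\<^bsub>base\<^esub> ?X"
        using insert.prems genideal_self[OF X]
        by (intro ideal.I_l_closed[OF id]) (auto simp: supported_on_single)
      then have "Poly_Mapping.single m (Poly_Mapping.lookup f m) \<in> Idl\<^bsub>base\<^esub> ?X"
        by (simp add: mult_single)
      then show ?case
        using insert additive_subgroup.a_closed[OF ideal.axioms(1)[OF id]] by simp
    qed
    from this[of "Poly_Mapping.keys f"] show "f \<in> Idl\<^bsub>base\<^esub> ?X"
      using f poly_mapping_sum_singles[of f] by (simp add: supported_on_def)
  qed
qed

lemma units_at_eq: "units_at S = (const_units :: ('m \<Rightarrow>\<^sub>0 'k::field) set)"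
  unfolding units_at_def semigroup_ring_eq irrelevant_ideal_eq base_simps
  by (auto simp: const_units_def supported_on_def in_keys_iff)

lemma local_ring_eq: "local_ring S = (L :: ('m, 'k::field) germ ring)"
  by (simp add: local_ring_def semigroup_ring_eq units_at_eq)

lemma chi_eq: "(chi S m :: ('m, 'k::field) germ) = fr (Poly_Mapping.single m 1) 1"
  by (simp add: chi_def semigroup_ring_eq units_at_eq)

text \<open>The extension to the local ring of the ideal of \<open>k[S]\<close> spanned by the
  monomials with exponents in \<open>E\<close>.\<close>

definition Loc :: "'m set \<Rightarrow> ('m, 'k::field) germ set" where
  "Loc E = {fr f s |f s. f \<in> supported_on E \<and> s \<in> const_units}"

lemma LocI: "f \<in> supported_on E \<Longrightarrow> s \<in> const_units \<Longrightarrow> fr f s \<in> Loc E"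
  by (auto simp: Loc_def)

text \<open>Two numerators of the same fraction agree up to factors from \<open>const_units\<close>,
  and \<open>supported_on_cancel\<close> removes such factors.\<close>

lemma fr_in_Loc_iff:
  fixes f s :: "'m \<Rightarrow>\<^sub>0 'k::field"
  assumes E: "sideal E" and f: "f \<in> supported_on S" and s: "s \<in> const_units"
  shows "fr f s \<in> Loc E \<longleftrightarrow> f \<in> supported_on E"
proof
  assume "fr f s \<in> Loc E"
  then obtain f' s' where *: "fr f s = fr f' s'" "f' \<in> supported_on E" "s' \<in> const_units"
    by (auto simp: Loc_def)
  moreover have "f' \<in> supported_on S" using * sideal_subset[OF E] supported_on_mono by blast
  ultimately have "s' * f = s * f'" using fr_eq_iff f s by blast
  also have "\<dots> \<in> supported_on E"
    using supported_on_sideal_mult[OF E *(2) W_in_A[OF s]] by (simp add: mult.commute)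
  finally show "f \<in> supported_on E" using supported_on_cancel[OF E f *(3)] by blast
qed (use s in \<open>auto simp: Loc_def\<close>)

lemma Loc_subset: "sideal E \<Longrightarrow> Loc E \<subseteq> (carrier L :: ('m, 'k::field) germ set)"
  using supported_on_mono[OF _ sideal_subset] by (auto simp: Loc_def intro!: fr_closed)

lemma Loc_S: "Loc S = (carrier L :: ('m, 'k::field) germ set)"
  by (auto simp: Loc_def carrier_L)

lemma chi_in_L: "m \<in> S \<Longrightarrow> (chi S m :: ('m, 'k::field) germ) \<in> carrier L"
  by (auto simp: chi_eq intro!: fr_closed W_one)

lemma chi_in_Loc_iff:
  "sideal E \<Longrightarrow> m \<in> S \<Longrightarrow> (chi S m :: ('m, 'k::field) germ) \<in> Loc E \<longleftrightarrow> m \<in> E"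
  unfolding chi_eq by (subst fr_in_Loc_iff) (auto simp: W_one)

lemma ideal_Loc:
  assumes E: "sideal E"
  shows "ideal (Loc E :: ('m, 'k::field) germ set) L"
proof -
  interpret cring "L :: ('m, 'k) germ ring" by (rule cring_L)
  have ES: "f \<in> supported_on S" if "f \<in> supported_on E" for f :: "'m \<Rightarrow>\<^sub>0 'k"
    using that sideal_subset[OF E] by (rule supported_on_mono)
  have mult: "x \<otimes>\<^bsub>L\<^esub> y \<in> Loc E" if "x \<in> Loc E" "y \<in> carrier L" for x y :: "('m, 'k) germ"
  proof -
    from that obtain f s g t where *: "x = fr f s" "f \<in> supported_on E" "s \<in> const_units"
      "y = fr g t" "g \<in> supported_on S" "t \<in> const_units"
      by (auto simp: Loc_def carrier_L)
    then have "x \<otimes>\<^bsub>L\<^esub> y = fr (f * g) (s * t)" by (simp add: mult_fr ES)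
    then show ?thesis
      using LocI[OF supported_on_sideal_mult[OF E *(2,5)] W_mult[OF *(3,6)]] by simp
  qed
  show ?thesis
  proof (rule idealI)
    show "subgroup (Loc E) (add_monoid (L :: ('m, 'k) germ ring))"
    proof (rule add.subgroupI)
      have "fr 0 1 \<in> Loc E" by (simp add: LocI W_one)
      then show "Loc E \<noteq> ({} :: ('m, 'k) germ set)" by blast
      fix x y :: "('m, 'k) germ" assume "x \<in> Loc E" "y \<in> Loc E"
      then obtain f s g t where *: "x = fr f s" "f \<in> supported_on E" "s \<in> const_units"
        "y = fr g t" "g \<in> supported_on E" "t \<in> const_units"
        by (auto simp: Loc_def)
      have "\<ominus>\<^bsub>L\<^esub> x = fr (- f) s"
        using * ES
        by (intro minus_equality)
           (auto simp: add_fr_same A_uminus zero_L fr_eq_iff W_one intro!: fr_closed)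
      then show "\<ominus>\<^bsub>L\<^esub> x \<in> Loc E"
        using LocI[OF supported_on_uminus[OF *(2)] *(3)] *(1) by simp
      have "t * f + s * g \<in> supported_on E"
        using * supported_on_sideal_mult[OF E] W_in_A
        by (intro supported_on_add) (auto simp: mult.commute)
      then show "x \<oplus>\<^bsub>L\<^esub> y \<in> Loc E"
        using LocI[OF _ W_mult[OF *(3,6)]] * ES by (simp add: add_fr)
    qed (use Loc_subset[OF E] in auto)
  qed (use mult Loc_subset[OF E] in \<open>auto intro: ring_axioms simp: m_comm subset_iff\<close>)
qed

text \<open>A numerator is the sum of its terms over the same denominator, so additive closure
  reduces membership to single terms. This is how \<open>Loc\<close> is shown to lie in generated
  ideals and in products.\<close>

lemma fr_in_ideal:
  fixes f s :: "'m \<Rightarrow>\<^sub>0 'k::field"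
  assumes J: "ideal J L" and f: "f \<in> supported_on S" and s: "s \<in> const_units"
    and terms: "\<And>m c. m \<in> Poly_Mapping.keys f \<Longrightarrow> fr (Poly_Mapping.single m c) s \<in> J"
  shows "fr f s \<in> J"
proof -
  interpret ideal J L by (rule J)
  have "fr (\<Sum>m\<in>K. Poly_Mapping.single m (Poly_Mapping.lookup f m)) s \<in> J \<and>
     (\<Sum>m\<in>K. Poly_Mapping.single m (Poly_Mapping.lookup f m)) \<in> supported_on S"
    if "K \<subseteq> Poly_Mapping.keys f" "finite K" for K
    using that(2,1)
  proof (induction K)
    case empty
    have "fr 0 s = \<zero>\<^bsub>L\<^esub>" using s by (simp add: zero_L, subst fr_eq_iff) (auto simp: W_one)
    then show ?case using zero_closed by simp
  next
    case (insert m K)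
    have m: "Poly_Mapping.single m (Poly_Mapping.lookup f m) \<in> supported_on S"
      using insert.prems f by (intro supported_on_single) (auto simp: supported_on_def)
    let ?g = "\<Sum>m\<in>K. Poly_Mapping.single m (Poly_Mapping.lookup f m)"
    have g: "fr ?g s \<in> J" "?g \<in> supported_on S" using insert by auto
    have "fr (Poly_Mapping.single m (Poly_Mapping.lookup f m)) s \<oplus>\<^bsub>L\<^esub> fr ?g s \<in> J"
      using insert.prems g(1) by (intro additive_subgroup.a_closed[OF ideal.axioms(1)[OF J]] terms) auto
    then show ?case
      using insert.hyps A_add[OF m g(2)] by (simp add: add_fr_same m g(2) s)
  qed
  from this[of "Poly_Mapping.keys f"] show ?thesis
    using poly_mapping_sum_singles[of f] by simp
qed

lemma genideal_chi:
  assumes B: "B \<subseteq> S"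
  shows "Idl\<^bsub>L\<^esub> (chi S ` B) = (Loc (msum B S) :: ('m, 'k::field) germ set)"
proof
  interpret cring "L :: ('m, 'k) germ ring" by (rule cring_L)
  have s: "sideal (msum B S)" using B by (rule sideal_msum_S)
  have X: "chi S ` B \<subseteq> (carrier L :: ('m, 'k) germ set)" using B chi_in_L by auto
  show "Idl\<^bsub>L\<^esub> (chi S ` B) \<subseteq> (Loc (msum B S) :: ('m, 'k) germ set)"
    using B subset_msum_S[of B] chi_in_Loc_iff[OF s]
    by (intro genideal_minimal[OF ideal_Loc[OF s]]) auto
  show "(Loc (msum B S) :: ('m, 'k) germ set) \<subseteq> Idl\<^bsub>L\<^esub> (chi S ` B)"
  proof
    fix x :: "('m, 'k) germ" assume "x \<in> Loc (msum B S)"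
    then obtain f s where x: "x = fr f s" "f \<in> supported_on (msum B S)" "s \<in> const_units"
      by (auto simp: Loc_def)
    have id: "ideal (Idl\<^bsub>L\<^esub> (chi S ` B) :: ('m, 'k) germ set) L" using X by (rule genideal_ideal)
    show "x \<in> Idl\<^bsub>L\<^esub> (chi S ` B)"
      unfolding x(1)
    proof (rule fr_in_ideal[OF id _ x(3)])
      show "f \<in> supported_on S" using x(2) sideal_subset[OF s] by (rule supported_on_mono)
      fix m and c :: 'k assume "m \<in> Poly_Mapping.keys f"
      then obtain b k where m: "m = b + k" "b \<in> B" "k \<in> S"
        using x(2) unfolding supported_on_def msum_def by blast
      \<comment> \<open>Coefficient and denominator both go into the second factor, which leaves a
        pure generator as the first.\<close>
      have "chi S b \<otimes>\<^bsub>L\<^esub> fr (Poly_Mapping.single k c) s \<in> Idl\<^bsub>L\<^esub> (chi S ` B)"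
        using m genideal_self[OF X] x(3)
        by (intro ideal.I_r_closed[OF id]) (auto intro!: fr_closed supported_on_single)
      then show "fr (Poly_Mapping.single m c) s \<in> Idl\<^bsub>L\<^esub> (chi S ` B)"
        using m B x(3) by (simp add: chi_eq mult_fr W_one supported_on_single mult_single subset_iff)
    qed
  qed
qed

lemma ideal_prod_Loc:
  assumes E: "sideal E" and F: "sideal F"
  shows "ideal_prod L (Loc E) (Loc F) = (Loc (msum E F) :: ('m, 'k::field) germ set)"
proof
  interpret cring "L :: ('m, 'k) germ ring" by (rule cring_L)
  have EF: "sideal (msum E F)" using E F by (rule sideal_msum)
  have ES: "f \<in> supported_on S" if "f \<in> supported_on E" for f :: "'m \<Rightarrow>\<^sub>0 'k"
    using that sideal_subset[OF E] by (rule supported_on_mono)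
  have FS: "f \<in> supported_on S" if "f \<in> supported_on F" for f :: "'m \<Rightarrow>\<^sub>0 'k"
    using that sideal_subset[OF F] by (rule supported_on_mono)
  show "ideal_prod L (Loc E) (Loc F) \<subseteq> (Loc (msum E F) :: ('m, 'k) germ set)"
  proof
    fix x :: "('m, 'k) germ" assume "x \<in> ideal_prod L (Loc E) (Loc F)"
    then show "x \<in> Loc (msum E F)"
    proof induction
      case (prod x y)
      then obtain f s g t where *: "x = fr f s" "f \<in> supported_on E" "s \<in> const_units"
        "y = fr g t" "g \<in> supported_on F" "t \<in> const_units"
        by (auto simp: Loc_def)
      then have "x \<otimes>\<^bsub>L\<^esub> y = fr (f * g) (s * t)" by (simp add: mult_fr ES FS)
      then show ?case
        using LocI[OF supported_on_mult[OF *(2,5)] W_mult[OF *(3,6)]] by simp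
    qed (use ideal_Loc[OF EF] in \<open>auto intro: additive_subgroup.a_closed ideal.axioms(1)\<close>)
  qed
  have id: "ideal (ideal_prod L (Loc E) (Loc F) :: ('m, 'k) germ set) L"
    by (intro ideal_prod_is_ideal ideal_Loc E F)
  show "(Loc (msum E F) :: ('m, 'k) germ set) \<subseteq> ideal_prod L (Loc E) (Loc F)"
  proof
    fix x :: "('m, 'k) germ" assume "x \<in> Loc (msum E F)"
    then obtain f s where x: "x = fr f s" "f \<in> supported_on (msum E F)" "s \<in> const_units"
      by (auto simp: Loc_def)
    show "x \<in> ideal_prod L (Loc E) (Loc F)"
      unfolding x(1)
    proof (rule fr_in_ideal[OF id _ x(3)])
      show "f \<in> supported_on S" using x(2) sideal_subset[OF EF] by (rule supported_on_mono)
      fix m and c :: 'k assume "m \<in> Poly_Mapping.keys f"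
      then obtain e e' where m: "m = e + e'" "e \<in> E" "e' \<in> F"
        using x(2) unfolding supported_on_def msum_def by blast
      have e: "e \<in> S" "e' \<in> S" using m sideal_subset E F by auto
      have "chi S e \<otimes>\<^bsub>L\<^esub> fr (Poly_Mapping.single e' c) s \<in> ideal_prod L (Loc E) (Loc F)"
        using m x(3) e chi_in_Loc_iff[OF E]
        by (intro ideal_prod.prod) (auto intro!: LocI supported_on_single)
      then show "fr (Poly_Mapping.single m c) s \<in> ideal_prod L (Loc E) (Loc F)"
        using m e x(3) by (simp add: chi_eq mult_fr W_one supported_on_single mult_single)
    qed
  qed
qed

text \<open>The zeroth power is \<open>S\<close> and not \<open>{0}\<close>: it has to match the
  unit ideal, and every power of a semigroup ideal is then again one.\<close>

primrec npow :: "'m set \<Rightarrow> nat \<Rightarrow> 'm set" where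
  "npow E 0 = S"
| "npow E (Suc n) = msum (npow E n) E"

lemma sideal_npow: "sideal E \<Longrightarrow> sideal (npow E n)"
  by (induction n) (auto simp: sideal_S sideal_msum)

lemma pow_Loc:
  assumes "sideal E"
  shows "(Loc E :: ('m, 'k::field) germ set) [^]\<^bsub>ideals_set L\<^esub> (n::nat) = Loc (npow E n)"
  by (induction n) (use assms in \<open>auto simp: ideals_set_def nat_pow_def Loc_S ideal_prod_Loc sideal_npow\<close>)

end

section \<open>Integral closure\<close>

text \<open>\<open>P i\<close> models the \<open>i\<close>-th power of an ideal, as in a Rees
  algebra.\<close>

locale graded_family =
  fixes f :: "'a::comm_ring_1" and P :: "nat \<Rightarrow> 'a set"
  assumes P_zero: "0 \<in> P i" and P_add: "\<And>x y. x \<in> P i \<Longrightarrow> y \<in> P i \<Longrightarrow> x + y \<in> P i"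
    and P_uminus: "\<And>x. x \<in> P i \<Longrightarrow> - x \<in> P i"
    and P_mult: "\<And>x y. x \<in> P i \<Longrightarrow> y \<in> P j \<Longrightarrow> x * y \<in> P (i + j)"
begin

text \<open>Homogeneous expressions of degree \<open>d\<close>, where \<open>f\<close> counts as
  degree 1 and \<open>P i\<close> as degree \<open>i\<close>, without a pure power of
  \<open>f\<close>. The set \<open>mon d\<close> consists of \<open>f ^ d\<close> plus such
  expressions, so an integral equation of degree \<open>d\<close> for \<open>f\<close> amounts to
  \<open>0\<close> being in \<open>mon d\<close>.\<close>

definition H :: "nat \<Rightarrow> 'a set" where
  "H d = {\<Sum>i\<in>{1..d}. c i * f ^ (d - i) |c. \<forall>i\<in>{1..d}. c i \<in> P i}"

definition mon :: "nat \<Rightarrow> 'a set" where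
  "mon d = {h. h - f ^ d \<in> H d}"

lemma H_I: "(\<And>i. i \<in> {1..d} \<Longrightarrow> c i \<in> P i) \<Longrightarrow> (\<Sum>i\<in>{1..d}. c i * f ^ (d - i)) \<in> H d"
  unfolding H_def by (intro CollectI exI[of _ c]) auto

lemma H_E:
  assumes "x \<in> H d"
  obtains c where "x = (\<Sum>i\<in>{1..d}. c i * f ^ (d - i))" "\<forall>i\<in>{1..d}. c i \<in> P i"
  using assms unfolding H_def by blast

lemma H_add:
  assumes "x \<in> H d" "y \<in> H d"
  shows "x + y \<in> H d"
proof -
  from assms(1) obtain c where c: "x = (\<Sum>i\<in>{1..d}. c i * f ^ (d - i))" "\<forall>i\<in>{1..d}. c i \<in> P i"
    by (rule H_E)
  from assms(2) obtain c' where c': "y = (\<Sum>i\<in>{1..d}. c' i * f ^ (d - i))" "\<forall>i\<in>{1..d}. c' i \<in> P i"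
    by (rule H_E)
  have "x + y = (\<Sum>i\<in>{1..d}. (c i + c' i) * f ^ (d - i))"
    unfolding c(1) c'(1) by (simp add: sum.distrib distrib_right)
  also have "\<dots> \<in> H d" by (intro H_I P_add bspec[OF c(2)] bspec[OF c'(2)])
  finally show ?thesis .
qed

lemma H_term:
  assumes "c \<in> P i" "1 \<le> i" "i \<le> d"
  shows "c * f ^ (d - i) \<in> H d"
proof -
  have "c * f ^ (d - i) = (\<Sum>j\<in>{1..d}. (if j = i then c else 0) * f ^ (d - j))"
    using assms by (subst sum.remove[of _ i]) (auto intro!: sum.neutral)
  also have "\<dots> \<in> H d" by (rule H_I) (simp add: assms(1) P_zero)
  finally show ?thesis .
qed

lemma H_zero: "0 \<in> H d"
  using H_I[of d "\<lambda>_. 0"] P_zero by simp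

lemma H_sum: "(\<And>i. i \<in> I \<Longrightarrow> x i \<in> H d) \<Longrightarrow> (\<Sum>i\<in>I. x i) \<in> H d"
  by (induction I rule: infinite_finite_induct) (auto intro: H_zero H_add)

lemma H_uminus:
  assumes "x \<in> H d"
  shows "- x \<in> H d"
proof -
  from assms obtain c where c: "x = (\<Sum>i\<in>{1..d}. c i * f ^ (d - i))" "\<forall>i\<in>{1..d}. c i \<in> P i"
    by (rule H_E)
  have "- x = (\<Sum>i\<in>{1..d}. - c i * f ^ (d - i))"
    unfolding c(1) by (simp add: sum_negf)
  also have "\<dots> \<in> H d" by (intro H_I P_uminus bspec[OF c(2)])
  finally show ?thesis .
qed

lemma H_mult:
  assumes "x \<in> H d" "y \<in> H e"
  shows "x * y \<in> H (d + e)"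
proof -
  from assms(1) obtain c where c: "x = (\<Sum>i\<in>{1..d}. c i * f ^ (d - i))" "\<forall>i\<in>{1..d}. c i \<in> P i"
    by (rule H_E)
  from assms(2) obtain c' where c': "y = (\<Sum>i\<in>{1..e}. c' i * f ^ (e - i))" "\<forall>i\<in>{1..e}. c' i \<in> P i"
    by (rule H_E)
  have "x * y = (\<Sum>i\<in>{1..d}. \<Sum>j\<in>{1..e}. (c i * c' j) * f ^ (d + e - (i + j)))"
    unfolding c(1) c'(1) sum_product
  proof (intro sum.cong refl)
    fix i j assume "i \<in> {1..d}" "j \<in> {1..e}"
    then have "d + e - (i + j) = (d - i) + (e - j)" by auto
    then show "c i * f ^ (d - i) * (c' j * f ^ (e - j)) = c i * c' j * f ^ (d + e - (i + j))"
      by (simp add: power_add ac_simps)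
  qed
  also have "\<dots> \<in> H (d + e)"
    by (intro H_sum H_term P_mult bspec[OF c(2)] bspec[OF c'(2)]) auto
  finally show ?thesis .
qed

lemma H_mult_power:
  assumes "x \<in> H d"
  shows "x * f ^ e \<in> H (d + e)"
proof -
  from assms obtain c where c: "x = (\<Sum>i\<in>{1..d}. c i * f ^ (d - i))" "\<forall>i\<in>{1..d}. c i \<in> P i"
    by (rule H_E)
  have "x * f ^ e = (\<Sum>i\<in>{1..d}. c i * f ^ (d + e - i))"
    unfolding c(1) sum_distrib_right
  proof (intro sum.cong refl)
    fix i assume "i \<in> {1..d}"
    then have "d + e - i = (d - i) + e" by auto
    then show "c i * f ^ (d - i) * f ^ e = c i * f ^ (d + e - i)"
      by (simp add: power_add ac_simps)
  qed
  also have "\<dots> \<in> H (d + e)"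
    by (intro H_sum H_term bspec[OF c(2)]) auto
  finally show ?thesis .
qed

lemma mon_times_H: "h \<in> mon d \<Longrightarrow> x \<in> H e \<Longrightarrow> x * h \<in> H (d + e)"
proof -
  assume h: "h \<in> mon d" and x: "x \<in> H e"
  have "x * h = x * (h - f ^ d) + x * f ^ d" by (simp add: algebra_simps)
  also have "\<dots> \<in> H (e + d)"
    using h x by (intro H_add H_mult H_mult_power) (auto simp: mon_def)
  finally show ?thesis by (simp add: add.commute)
qed

lemma mon_mult: "h \<in> mon d \<Longrightarrow> g \<in> mon e \<Longrightarrow> h * g \<in> mon (d + e)"
proof -
  assume h: "h \<in> mon d" and g: "g \<in> mon e"
  have "h * g - f ^ (d + e) = (h - f ^ d) * g + (g - f ^ e) * f ^ d"
    by (simp add: algebra_simps power_add)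
  also have "\<dots> \<in> H (d + e)"
    using mon_times_H[OF g, of "h - f ^ d" d] H_mult_power[of "g - f ^ e" e d] h g
    by (auto intro!: H_add simp: mon_def add.commute)
  finally show ?thesis by (simp add: mon_def)
qed

lemma mon_diff_H: "h \<in> mon d \<Longrightarrow> x \<in> H d \<Longrightarrow> h - x \<in> mon d"
  using H_add[OF _ H_uminus, of "h - f ^ d" d x] by (simp add: mon_def algebra_simps)

text \<open>
  Gaussian elimination of the unknowns \<open>v j\<close>, one at a time: multiplying through by the
  pivot \<open>h - C j j\<close>, which is again monic, avoids division.
\<close>

lemma elimination:
  assumes "finite J" "j0 \<notin> J" "d \<ge> 1" "h \<in> mon d"
    and "\<And>i j. i \<in> insert j0 J \<Longrightarrow> j \<in> insert j0 J \<Longrightarrow> C i j \<in> H d"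
    and "\<And>i. i \<in> insert j0 J \<Longrightarrow> h * v i = (\<Sum>j\<in>insert j0 J. C i j * v j)"
  shows "\<exists>D\<ge>1. \<exists>g\<in>mon D. g * v j0 = 0"
  using assms
proof (induction J arbitrary: d h C rule: finite_induct)
  case empty
  have "h * v j0 = C j0 j0 * v j0" using empty.prems(5)[of j0] by simp
  then have "(h - C j0 j0) * v j0 = 0" by (simp add: algebra_simps)
  moreover have "h - C j0 j0 \<in> mon d" using empty.prems by (intro mon_diff_H) auto
  ultimately show ?case using empty.prems(2) by blast
next
  case (insert k J)
  let ?J = "insert j0 J"
  have k: "k \<notin> ?J" and fin: "finite ?J" and ins: "insert j0 (insert k J) = insert k ?J"
    using insert by auto
  define g where "g = h - C k k"
  \<comment> \<open>Row \<open>i\<close> is multiplied by \<open>g\<close>, and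
    \<open>g * v k\<close> is then replaced by the rest of row \<open>k\<close>. Both products have
    degree \<open>d + d\<close>, the degree of the smaller system.\<close>
  define C' where "C' i j = C i j * g + C i k * C k j" for i j
  have g: "g \<in> mon d" unfolding g_def using insert.prems by (intro mon_diff_H) auto
  have row: "h * v i = C i k * v k + (\<Sum>j\<in>?J. C i j * v j)" if "i \<in> insert k ?J" for i
    using insert.prems(5)[of i] that k fin unfolding ins by simp
  have gk: "g * v k = (\<Sum>j\<in>?J. C k j * v j)"
    using row[of k] by (simp add: g_def algebra_simps)
  have eq: "(h * g) * v i = (\<Sum>j\<in>?J. C' i j * v j)" if i: "i \<in> ?J" for i
  proof -
    have "(h * g) * v i = g * (h * v i)" by (simp add: ac_simps)
    also have "\<dots> = C i k * (g * v k) + g * (\<Sum>j\<in>?J. C i j * v j)"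
      using i by (subst row) (auto simp: algebra_simps)
    also have "\<dots> = (\<Sum>j\<in>?J. C' i j * v j)"
      unfolding gk sum_distrib_left sum.distrib[symmetric] C'_def
      by (intro sum.cong refl) (simp only: ring_distribs ac_simps)
    finally show ?thesis .
  qed
  have "C' i j \<in> H (d + d)" if "i \<in> ?J" "j \<in> ?J" for i j
    unfolding C'_def using that insert.prems(4) g
    by (intro H_add mon_times_H H_mult) auto
  then show ?case
    using insert.IH[of "d + d" "h * g" C'] eq insert.prems(1,2) mon_mult[OF insert.prems(3) g]
    by auto
qed

end

lemma (in cring) finsum_in_ideal:
  assumes J: "ideal J R" and x: "\<And>i. i \<in> I \<Longrightarrow> x i \<in> J"
  shows "(\<Oplus>i\<in>I. x i) \<in> J"
proof -
  interpret ideal J R by (rule J)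
  show ?thesis
    using x
  proof (induction I rule: infinite_finite_induct)
    case (insert i I)
    then have "x \<in> insert i I \<rightarrow> carrier R" using Icarr by auto
    then show ?case
      using insert by (simp add: Icarr additive_subgroup.a_closed[OF is_additive_subgroup])
  qed (use additive_subgroup.zero_closed[OF is_additive_subgroup] in auto)
qed

section \<open>Integrality of monomial fractions\<close>

context graded_semigroup
begin

text \<open>The summand from \<open>S\<close> is absorbed by one of the factors from
  \<open>E\<close>. The power \<open>npow E 0 = S\<close> has no factor to absorb it, hence
  \<open>Suc n\<close>.\<close>

lemma npow_Suc_mset:
  "x \<in> npow E (Suc n) \<Longrightarrow> sideal E \<Longrightarrow> \<exists>M. size M = Suc n \<and> set_mset M \<subseteq> E \<and> sum_mset M = x"
proof (induction n arbitrary: x)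
  case 0
  then obtain y z where "x = y + z" "y \<in> S" "z \<in> E" by (auto elim: msumE)
  then have "x \<in> E" using sideal_add[OF 0(2), of z y] by (simp add: add.commute)
  then show ?case by (intro exI[of _ "{#x#}"]) auto
next
  case (Suc n)
  then have "x \<in> msum (npow E (Suc n)) E" by simp
  then obtain y z where yz: "x = y + z" "y \<in> npow E (Suc n)" "z \<in> E" by (rule msumE)
  then obtain M where "size M = Suc n" "set_mset M \<subseteq> E" "sum_mset M = y"
    using Suc by blast
  then show ?case using yz by (intro exI[of _ "add_mset z M"]) (auto simp: add.commute)
qed

lemma npow_add:
  assumes E: "sideal E" and "x \<in> npow E i" "y \<in> npow E j"
  shows "x + y \<in> npow E (i + j)"
  using assms(3)
proof (induction j arbitrary: y)
  case 0
  then show ?case using sideal_add[OF sideal_npow[OF E]] assms(2) by simp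
next
  case (Suc j)
  then obtain y1 z where "y = y1 + z" "y1 \<in> npow E j" "z \<in> E" by (auto elim: msumE)
  then show ?case using Suc.IH[of y1] msumI[of "x + y1" _ z E] by (simp add: add.assoc)
qed

text \<open>
  In a long product of elements of \<open>X\<close> some \<open>m\<close> occurs at least \<open>K\<close> times, and these \<open>K\<close>
  factors can be traded for \<open>K\<close> elements of \<open>E\<close>.
\<close>

lemma exchange:
  assumes E: "sideal E" and X: "finite X"
    and root: "\<And>m. m \<in> X \<Longrightarrow> \<exists>K\<ge>1. sum_mset (replicate_mset K m) \<in> npow E K"
  shows "\<exists>B N. finite B \<and> B \<subseteq> E \<and> N \<ge> 1 \<and> (\<forall>M. set_mset M \<subseteq> X \<union> B \<longrightarrow> size M = Suc N \<longrightarrow>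
    (\<exists>b\<in>B. \<exists>M'. set_mset M' \<subseteq> X \<union> B \<and> size M' = N \<and> sum_mset M = b + sum_mset M'))"
proof -
  have "\<exists>K Q. K \<ge> 1 \<and> size Q = K \<and> set_mset Q \<subseteq> E \<and> sum_mset Q = sum_mset (replicate_mset K m)"
    if "m \<in> X" for m
  proof -
    obtain K where K: "K \<ge> 1" "sum_mset (replicate_mset K m) \<in> npow E K" using root[OF \<open>m \<in> X\<close>] by blast
    then obtain K' where K': "K = Suc K'" by (cases K) auto
    show ?thesis using npow_Suc_mset[OF _ E] K unfolding K' by metis
  qed
  then obtain K Q where KQ: "\<And>m. m \<in> X \<Longrightarrow> K m \<ge> (1::nat) \<and> size (Q m) = K m \<and> set_mset (Q m) \<subseteq> E \<and>
      sum_mset (Q m) = sum_mset (replicate_mset (K m) m)"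
    by metis
  define B where "B = (\<Union>m\<in>X. set_mset (Q m))"
  \<comment> \<open>More than \<open>sum K X\<close> elements of \<open>X\<close> force some
    \<open>m\<close> to occur at least \<open>K m\<close> times; the \<open>Suc\<close> also secures
    \<open>N >= 1\<close>.\<close>
  define N where "N = Suc (\<Sum>m\<in>X. K m)"
  have "\<exists>b\<in>B. \<exists>M'. set_mset M' \<subseteq> X \<union> B \<and> size M' = N \<and> sum_mset M = b + sum_mset M'"
    if M: "set_mset M \<subseteq> X \<union> B" "size M = Suc N" for M
  \<comment> \<open>An element of \<open>B\<close> already present in \<open>M\<close> serves as
    \<open>b\<close>. Otherwise all of \<open>M\<close> comes from \<open>X\<close> and the
    pigeonhole argument applies.\<close>
  proof (cases "set_mset M \<inter> B = {}")
    case False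
    then obtain b where b: "b \<in># M" "b \<in> B" by auto
    then obtain M' where "M = add_mset b M'" by (metis insert_DiffM)
    then show ?thesis using b M by (intro bexI[of _ b] exI[of _ M']) auto
  next
    case True
    then have MX: "set_mset M \<subseteq> X" using M by auto
    have "\<exists>m\<in>X. count M m \<ge> K m"
    proof (rule ccontr)
      assume "\<not> ?thesis"
      then have "(\<Sum>m\<in>X. count M m) \<le> (\<Sum>m\<in>X. K m)" by (intro sum_mono) auto
      moreover have "size M = (\<Sum>m\<in>X. count M m)"
        unfolding size_multiset_overloaded_eq using MX X
        by (intro sum.mono_neutral_left) (auto simp: not_in_iff)
      ultimately show False using M(2) by (simp add: N_def)
    qed
    then obtain m where m: "m \<in> X" "replicate_mset (K m) m \<subseteq># M"
      by (auto simp: count_le_replicate_mset_subset_eq)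
    then obtain M'' where M'': "M = replicate_mset (K m) m + M''"
      using mset_subset_eq_exists_conv by blast
    have "Q m \<noteq> {#}" using KQ[OF m(1)] by auto
    then obtain b Q' where Q': "Q m = add_mset b Q'" by (meson multiset_cases)
    have b: "b \<in> B" "set_mset Q' \<subseteq> B" using Q' m(1) unfolding B_def by force+
    have "sum_mset M = b + sum_mset (Q' + M'')"
      using KQ[OF m(1)] Q' unfolding M'' by (simp add: add.assoc[symmetric])
    moreover have "size (Q' + M'') = N"
      using KQ[OF m(1)] Q' M(2) unfolding M'' by simp
    moreover have "set_mset (Q' + M'') \<subseteq> X \<union> B" using b(2) M(1) unfolding M'' by auto
    ultimately show ?thesis using b(1) by blast
  qed
  moreover have "finite B" "B \<subseteq> E" using X KQ by (auto simp: B_def)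
  ultimately show ?thesis by (intro exI[of _ B] exI[of _ N]) (auto simp: N_def)
qed

lemma finite_msets_of_size: "finite A \<Longrightarrow> finite {M. set_mset M \<subseteq> A \<and> size M = n}"
proof (induction n)
  case (Suc n)
  have "{M. set_mset M \<subseteq> A \<and> size M = Suc n}
    \<subseteq> (\<lambda>(x, M). add_mset x M) ` (A \<times> {M. set_mset M \<subseteq> A \<and> size M = n})"
  proof
    fix M assume M: "M \<in> {M. set_mset M \<subseteq> A \<and> size M = Suc n}"
    then obtain x M' where "M = add_mset x M'" by (metis (mono_tags) mem_Collect_eq size_eq_Suc_imp_eq_union)
    then show "M \<in> (\<lambda>(x, M). add_mset x M) ` (A \<times> {M. set_mset M \<subseteq> A \<and> size M = n})"
      using M by auto
  qed
  with Suc show ?case by (meson finite_SigmaI finite_imageI finite_subset)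
qed simp

text \<open>
  The monomials in \<open>U\<close> below span a finite module \<open>V\<close> with \<open>f V \<subseteq> I V\<close>, where \<open>I\<close> is the ideal
  of \<open>E\<close>; a monomial is a unit of the group ring, so \<open>V\<close> is faithful.
\<close>

lemma integral_equation:
  fixes f :: "'m \<Rightarrow>\<^sub>0 'k::field"
  assumes E: "sideal E"
    and root: "\<And>m. m \<in> Poly_Mapping.keys f \<Longrightarrow> \<exists>K\<ge>1. sum_mset (replicate_mset K m) \<in> npow E K"
  shows "\<exists>D\<ge>1. \<exists>c. (\<forall>i\<in>{1..D}. c i \<in> supported_on (npow E i)) \<and>
    f ^ D + (\<Sum>i\<in>{1..D}. c i * f ^ (D - i)) = 0"
proof (cases "f = 0")
  case True
  then show ?thesis by (intro exI[of _ 1] conjI exI[of _ "\<lambda>_. 0"]) auto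
next
  case False
  define P :: "nat \<Rightarrow> ('m \<Rightarrow>\<^sub>0 'k) set" where "P i = supported_on (npow E i)" for i
  interpret gf: graded_family f P
  proof
    fix x y i j assume "x \<in> P i" "y \<in> P j"
    then have "x * y \<in> supported_on (msum (npow E i) (npow E j))"
      unfolding P_def by (rule supported_on_mult)
    then show "x * y \<in> P (i + j)"
      unfolding P_def by (rule supported_on_mono) (auto elim!: msumE intro: npow_add[OF E])
  qed (auto simp: P_def supported_on_add supported_on_uminus)
  let ?X = "Poly_Mapping.keys f"
  obtain B N where B: "finite B" "B \<subseteq> E" "N \<ge> 1"
    and ex: "\<And>M. set_mset M \<subseteq> ?X \<union> B \<Longrightarrow> size M = Suc N \<Longrightarrow>
      \<exists>b\<in>B. \<exists>M'. set_mset M' \<subseteq> ?X \<union> B \<and> size M' = N \<and> sum_mset M = b + sum_mset M'"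
    using exchange[OF E _ root] by (metis finite_keys)
  define U where "U = sum_mset ` {M. set_mset M \<subseteq> ?X \<union> B \<and> size M = N}"
  have finU: "finite U" unfolding U_def using B by (intro finite_imageI finite_msets_of_size) auto
  obtain x where x: "x \<in> ?X" using False by (metis equals0I poly_mapping_sum_singles sum.empty)
  define u where "u = sum_mset (replicate_mset N x)"
  have u: "u \<in> U" unfolding U_def u_def using x by (intro imageI) auto
  have "\<exists>b w'. b \<in> E \<and> w' \<in> U \<and> m + w = b + w'" if "m \<in> ?X" "w \<in> U" for m w
  proof -
    obtain M where M: "w = sum_mset M" "set_mset M \<subseteq> ?X \<union> B" "size M = N"
      using \<open>w \<in> U\<close> by (auto simp: U_def)
    have "set_mset (add_mset m M) \<subseteq> ?X \<union> B" "size (add_mset m M) = Suc N"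
      using M that(1) by simp_all
    from ex[OF this] obtain b M' where *: "b \<in> B" "set_mset M' \<subseteq> ?X \<union> B" "size M' = N"
        "sum_mset (add_mset m M) = b + sum_mset M'"
      by blast
    then have "sum_mset M' \<in> U" unfolding U_def by (intro imageI) simp
    then show ?thesis using * B(2) M(1) by auto
  qed
  then obtain b t where bt: "\<And>m w. m \<in> ?X \<Longrightarrow> w \<in> U \<Longrightarrow> b m w \<in> E \<and> t m w \<in> U \<and> m + w = b m w + t m w"
    by metis
  \<comment> \<open>The matrix of multiplication by \<open>f\<close> on the span of
    \<open>U\<close>: the term of \<open>f\<close> at \<open>m\<close> sends \<open>w\<close> to a
    multiple of \<open>t m w\<close> with exponent \<open>b m w\<close> in \<open>E\<close>, and
    terms with the same target are collected.\<close>
  define C where "C w w' = (\<Sum>m\<in>{m\<in>?X. t m w = w'}. Poly_Mapping.single (b m w) (Poly_Mapping.lookup f m))" for w w'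
  let ?v = "\<lambda>w. Poly_Mapping.single w (1::'k)"
  have E1: "E \<subseteq> npow E 1" using msumI[of 0 S _ E] by (auto simp: One_nat_def)
  have "C w w' \<in> gf.H 1" if "w \<in> U" "w' \<in> U" for w w'
    unfolding C_def
  proof (rule gf.H_sum)
    fix m assume "m \<in> {m\<in>?X. t m w = w'}"
    then have "Poly_Mapping.single (b m w) (Poly_Mapping.lookup f m) \<in> P 1"
      using bt[of m w] that E1 unfolding P_def by (intro supported_on_single) auto
    from gf.H_term[OF this, of 1] show "Poly_Mapping.single (b m w) (Poly_Mapping.lookup f m) \<in> gf.H 1" by simp
  qed
  moreover have "f * ?v w = (\<Sum>w'\<in>U. C w w' * ?v w')" if w: "w \<in> U" for w
  proof -
    have "f * ?v w = (\<Sum>m\<in>?X. Poly_Mapping.single m (Poly_Mapping.lookup f m)) * ?v w"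
      using poly_mapping_sum_singles[of f] by simp
    also have "\<dots> = (\<Sum>m\<in>?X. Poly_Mapping.single (m + w) (Poly_Mapping.lookup f m))"
      by (simp add: sum_distrib_right mult_single)
    also have "\<dots> = (\<Sum>m\<in>?X. Poly_Mapping.single (b m w) (Poly_Mapping.lookup f m) * ?v (t m w))"
      using bt[OF _ w] by (intro sum.cong refl) (simp add: mult_single)
    also have "\<dots> = (\<Sum>w'\<in>U. \<Sum>m\<in>{m\<in>?X. t m w = w'}.
        Poly_Mapping.single (b m w) (Poly_Mapping.lookup f m) * ?v (t m w))"
      using finU bt[OF _ w] by (intro sum.group[symmetric]) auto
    also have "\<dots> = (\<Sum>w'\<in>U. C w w' * ?v w')"
      unfolding C_def sum_distrib_right by (intro sum.cong refl) auto
    finally show ?thesis .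
  qed
  moreover have "f \<in> gf.mon 1" by (simp add: gf.mon_def gf.H_zero)
  ultimately obtain D g where D: "D \<ge> 1" "g \<in> gf.mon D" "g * ?v u = 0"
    using gf.elimination[of "U - {u}" u 1 f C ?v] finU u by (auto simp: insert_absorb)
  have "g = g * ?v u * ?v (- u)" by (simp add: mult.assoc mult_single)
  then have "g = 0" using D(3) by simp
  then have "- (f ^ D) \<in> gf.H D" using D(2) by (simp add: gf.mon_def)
  then obtain c where c: "- (f ^ D) = (\<Sum>i\<in>{1..D}. c i * f ^ (D - i))" "\<forall>i\<in>{1..D}. c i \<in> P i"
    by (rule gf.H_E)
  have "f ^ D + (\<Sum>i\<in>{1..D}. c i * f ^ (D - i)) = 0"
    unfolding c(1)[symmetric] by simp
  then show ?thesis
    using D(1) c(2) unfolding P_def by (intro exI[of _ D] conjI exI[of _ c])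
qed

text \<open>Dividing the equation of degree \<open>D\<close> for \<open>f\<close> by
  \<open>s ^ D\<close> gives one for the fraction: the \<open>i\<close>-th coefficient receives the
  denominator \<open>s ^ i\<close>, and all terms then share \<open>s ^ D\<close>.\<close>

lemma fr_in_integral_closure:
  fixes f s :: "'m \<Rightarrow>\<^sub>0 'k::field"
  assumes E: "sideal E" and f: "f \<in> supported_on S" and s: "s \<in> const_units"
    and root: "\<And>m. m \<in> Poly_Mapping.keys f \<Longrightarrow> \<exists>K\<ge>1. sum_mset (replicate_mset K m) \<in> npow E K"
  shows "fr f s \<in> integral_closure L (Loc E)"
proof -
  obtain D c where D: "D \<ge> 1" "\<And>i. i \<in> {1..D} \<Longrightarrow> c i \<in> supported_on (npow E i)"
      "f ^ D + (\<Sum>i\<in>{1..D}. c i * f ^ (D - i)) = 0"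
    using integral_equation[OF E root] by blast
  have cS: "c i \<in> supported_on S" if "i \<in> {1..D}" for i
    using D(2)[OF that] sideal_subset[OF sideal_npow[OF E]] by (rule supported_on_mono)
  let ?c = "\<lambda>i. fr (c i) (s ^ i)"
  interpret cring "L :: ('m, 'k) germ ring" by (rule cring_L)
  have "?c i \<otimes>\<^bsub>L\<^esub> (fr f s [^]\<^bsub>L\<^esub> (D - i)) = fr (c i * f ^ (D - i)) (s ^ D)" if "i \<in> {1..D}" for i
    using that by (simp add: pow_fr f s mult_fr cS A_power W_power flip: power_add)
  then have sum: "(\<Oplus>\<^bsub>L\<^esub>i\<in>{1..D}. ?c i \<otimes>\<^bsub>L\<^esub> (fr f s [^]\<^bsub>L\<^esub> (D - i))) =
    (\<Oplus>\<^bsub>L\<^esub>i\<in>{1..D}. fr (c i * f ^ (D - i)) (s ^ D))"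
    by (intro finsum_cong') (auto intro!: fr_closed A_mult A_power W_power cS f s)
  have fin: "(\<Oplus>\<^bsub>L\<^esub>i\<in>{1..D}. fr (c i * f ^ (D - i)) (s ^ D)) =
      fr (\<Sum>i\<in>{1..D}. c i * f ^ (D - i)) (s ^ D) \<and> (\<Sum>i\<in>{1..D}. c i * f ^ (D - i)) \<in> supported_on S"
    by (intro finsum_fr A_mult A_power W_power cS f s) auto
  then have mem: "(\<Sum>i\<in>{1..D}. c i * f ^ (D - i)) \<in> supported_on S" ..
  have "fr f s [^]\<^bsub>L\<^esub> D \<oplus>\<^bsub>L\<^esub> (\<Oplus>\<^bsub>L\<^esub>i\<in>{1..D}. ?c i \<otimes>\<^bsub>L\<^esub> (fr f s [^]\<^bsub>L\<^esub> (D - i))) = fr 0 (s ^ D)"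
    using add_fr_same[OF A_power[OF f] mem W_power[OF s], of D D] D(3) sum fin by (simp add: pow_fr f s)
  also have "\<dots> = \<zero>\<^bsub>L\<^esub>"
    unfolding zero_L by (rule fr_eqI) (simp_all add: closures W_power s)
  finally show ?thesis
    unfolding integral_closure_def pow_Loc[OF E]
    using D W_power[OF s] fr_closed[OF f s]
    by (intro CollectI conjI exI[of _ D] exI[of _ ?c]) (auto intro!: LocI)
qed

lemma chi_pow:
  assumes "m \<in> S"
  shows "(chi S m :: ('m, 'k::field) germ) [^]\<^bsub>L\<^esub> (k::nat) = chi S (sum_mset (replicate_mset k m))"
proof -
  have "Poly_Mapping.single m (1::'k) ^ k = Poly_Mapping.single (sum_mset (replicate_mset k m)) 1"
    by (induction k) (auto simp: mult_single)
  then show ?thesis using assms by (simp add: chi_eq pow_fr W_one)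
qed

text \<open>
  If \<open>wt m < h\<close>, every term of an integral equation for \<open>x = chi S m\<close> other than \<open>x ^ n\<close>
  has weight larger than that of \<open>x ^ n\<close>.
\<close>

lemma integral_closure_weight:
  fixes wt :: "'m \<Rightarrow> real"
  assumes E: "sideal E" and m: "m \<in> S"
    and wt_add: "\<And>x y. wt (x + y) = wt x + wt y" and wt_nonneg: "\<And>x. x \<in> S \<Longrightarrow> wt x \<ge> 0"
    and h: "\<And>x. x \<in> E \<Longrightarrow> wt x \<ge> h"
    and int: "(chi S m :: ('m, 'k::field) germ) \<in> integral_closure L (Loc E)"
  shows "wt m \<ge> h"
proof (rule ccontr)
  assume neg: "\<not> wt m \<ge> h"
  \<comment> \<open>Elements of weight at least \<open>r\<close> form a semigroup ideal, so a lower
    bound on weights becomes membership in an ideal of the local ring.\<close>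
  define hs where "hs r = {x \<in> S. wt x \<ge> r}" for r
  have hs: "sideal (hs r)" for r
    by (rule sidealI) (auto simp: hs_def wt_add S_add add_increasing2 wt_nonneg)
  have wt0: "wt 0 = 0" using wt_add[of 0 0] by simp
  have Eh: "npow E i \<subseteq> hs (real i * h)" for i
  proof (induction i)
    case (Suc i)
    show ?case
    proof
      fix x assume "x \<in> npow E (Suc i)"
      then obtain y z where "x = y + z" "y \<in> npow E i" "z \<in> E" by (auto elim: msumE)
      then show "x \<in> hs (real (Suc i) * h)"
        using Suc h[of z] sideal_subset[OF E] S_add by (fastforce simp: hs_def wt_add algebra_simps)
    qed
  qed (auto simp: hs_def wt_nonneg)
  let ?x = "chi S m :: ('m, 'k) germ"
  let ?mult = "\<lambda>k. sum_mset (replicate_mset k m)"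
  have mS: "?mult k \<in> S" for k by (induction k) (auto intro: S_add m)
  have mwt: "wt (?mult k) = real k * wt m" for k
    by (induction k) (auto simp: wt0 wt_add algebra_simps)
  note xk = chi_pow[OF m]
  interpret cring "L :: ('m, 'k) germ ring" by (rule cring_L)
  obtain n c where n: "n \<ge> 1" "\<And>i. i \<in> {1..n} \<Longrightarrow> c i \<in> (Loc (npow E i) :: ('m, 'k) germ set)"
    and eq: "(?x [^]\<^bsub>L\<^esub> n) \<oplus>\<^bsub>L\<^esub> (\<Oplus>\<^bsub>L\<^esub>i\<in>{1..n}. c i \<otimes>\<^bsub>L\<^esub> (?x [^]\<^bsub>L\<^esub> (n - i))) = \<zero>\<^bsub>L\<^esub>"
    using int unfolding integral_closure_def pow_Loc[OF E] by blast
  \<comment> \<open>Replacing \<open>i\<close> factors of weight \<open>wt m\<close> by factors of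
    weight at least \<open>h\<close> gains at least \<open>i * (h - wt m)\<close>. The gain at
    \<open>i = 1\<close> is the smallest, which makes \<open>r\<close> a common bound for all terms
    but \<open>x ^ n\<close>.\<close>
  define r where "r = real n * wt m + (h - wt m)"
  interpret J: ideal "Loc (hs r)" "L :: ('m, 'k) germ ring" by (rule ideal_Loc[OF hs])
  have "c i \<otimes>\<^bsub>L\<^esub> (?x [^]\<^bsub>L\<^esub> (n - i)) \<in> Loc (hs r)" if i: "i \<in> {1..n}" for i
  proof -
    obtain f s where fs: "c i = fr f s" "f \<in> supported_on (npow E i)" "s \<in> const_units"
      using n(2)[OF i] by (auto simp: Loc_def)
    have fS: "f \<in> supported_on S" using fs(2) sideal_subset[OF sideal_npow[OF E]] by (rule supported_on_mono)
    have "f * Poly_Mapping.single (?mult (n - i)) 1 \<in> supported_on (msum (npow E i) {?mult (n - i)})"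
      using fs(2) by (rule supported_on_mult) simp
    moreover have "msum (npow E i) {?mult (n - i)} \<subseteq> hs r"
    proof
      fix x assume "x \<in> msum (npow E i) {?mult (n - i)}"
      then obtain y where y: "x = y + ?mult (n - i)" "y \<in> npow E i" by (auto elim: msumE)
      have "1 * (h - wt m) \<le> real i * (h - wt m)"
        using i neg by (intro mult_right_mono) auto
      then have "r \<le> real i * h + (real n - real i) * wt m"
        unfolding r_def by (simp add: algebra_simps)
      moreover have "wt x \<ge> real i * h + (real n - real i) * wt m"
        using y Eh[of i] i by (auto simp: hs_def wt_add mwt of_nat_diff)
      moreover have "x \<in> S" using y Eh[of i] mS by (auto simp: hs_def intro!: S_add)
      ultimately show "x \<in> hs r" by (simp add: hs_def)
    qed
    ultimately have "f * Poly_Mapping.single (?mult (n - i)) 1 \<in> supported_on (hs r)"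
      by (rule supported_on_mono)
    then show ?thesis
      unfolding xk fs(1) unfolding chi_eq using fs(3) fS mS by (simp add: mult_fr W_one LocI)
  qed
  then have sum: "(\<Oplus>\<^bsub>L\<^esub>i\<in>{1..n}. c i \<otimes>\<^bsub>L\<^esub> (?x [^]\<^bsub>L\<^esub> (n - i))) \<in> Loc (hs r)" (is "?s \<in> _")
    by (rule finsum_in_ideal[OF J.ideal_axioms])
  have xn: "?x [^]\<^bsub>L\<^esub> n \<in> carrier L" using m by (simp add: chi_in_L)
  have "?x [^]\<^bsub>L\<^esub> n = \<ominus>\<^bsub>L\<^esub> ?s"
    using minus_equality[OF eq J.Icarr[OF sum] xn] by simp
  also have "\<dots> \<in> Loc (hs r)" using sum by (rule J.a_inv_closed)
  finally have "?mult n \<in> hs r" unfolding xk using chi_in_Loc_iff[OF hs mS] by blast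
  then show False using neg by (simp add: hs_def r_def mwt)
qed

lemma npow_split: "x \<in> npow E (i + j) \<Longrightarrow> x \<in> msum (npow E i) (npow E j)"
proof (induction j arbitrary: x)
  case 0
  then show ?case using msumI[of x _ 0 S] by simp
next
  case (Suc j)
  then obtain x' e where x: "x = x' + e" "x' \<in> npow E (i + j)" "e \<in> E" by (auto elim: msumE)
  obtain y z where "x' = y + z" "y \<in> npow E i" "z \<in> npow E j" using Suc.IH[OF x(2)] by (rule msumE)
  then show ?case
    using x msumI[of y "npow E i" "z + e" "npow E (Suc j)"] msumI[of z "npow E j" e E]
    by (simp add: add.assoc)
qed

lemma npow_mult: "npow E (n * k) \<subseteq> npow (npow E n) k"
proof (induction k)
  case (Suc k)
  show ?case
  proof
    fix x assume "x \<in> npow E (n * Suc k)"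
    then have "x \<in> msum (npow E (n * k)) (npow E n)"
      using npow_split[of x E "n * k" n] by (simp add: add.commute)
    then obtain y z where "x = y + z" "y \<in> npow E (n * k)" "z \<in> npow E n" by (rule msumE)
    then show "x \<in> npow (npow E n) (Suc k)"
      using Suc msumI[of y "npow (npow E n) k" z "npow E n"] by auto
  qed
qed simp

lemma replicate_in_npow: "x \<in> E \<Longrightarrow> sum_mset (replicate_mset n x) \<in> npow E n"
proof (induction n)
  case (Suc n)
  then show ?case using msumI[of "sum_mset (replicate_mset n x)" "npow E n" x E] by (simp add: add.commute)
qed simp

lemma weight_npow:
  fixes wt :: "'m \<Rightarrow> real"
  assumes wt_add: "\<And>x y. wt (x + y) = wt x + wt y" and wt_nonneg: "\<And>x. x \<in> S \<Longrightarrow> wt x \<ge> 0"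
    and h: "\<And>x. x \<in> E \<Longrightarrow> wt x \<ge> h" and x: "x \<in> npow E n"
  shows "wt x \<ge> real n * h"
  using x
proof (induction n arbitrary: x)
  case (Suc n)
  then obtain y z where "x = y + z" "y \<in> npow E n" "z \<in> E" by (auto elim: msumE)
  then show ?case using Suc.IH[of y] h[of z] by (simp add: wt_add algebra_simps)
qed (simp add: wt_nonneg)

end

section \<open>Polyhedra and lattices\<close>

text \<open>
  Rounding \<open>N x\<close> down gives an integer vector whose image under \<open>A\<close> is bounded independently of
  \<open>N\<close>, so two multiples have the same image. This replaces rational linear algebra both for
  convex combinations (rounding is monotone) and for normals of rational hyperplanes.
\<close>

lemma integer_kernel_approx:
  fixes A :: "'j \<Rightarrow> 'i \<Rightarrow> int" and x :: "'i \<Rightarrow> real"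
  assumes I: "finite I" and J: "finite J"
    and kernel: "\<And>j. j \<in> J \<Longrightarrow> (\<Sum>i\<in>I. of_int (A j i) * x i) = 0"
  shows "\<exists>N N'. N + K \<le> N' \<and>
    (\<forall>j\<in>J. (\<Sum>i\<in>I. A j i * (\<lfloor>real N' * x i\<rfloor> - \<lfloor>real N * x i\<rfloor>)) = 0)"
proof -
  define F where "F N = (\<lambda>j\<in>J. \<Sum>i\<in>I. A j i * \<lfloor>real N * x i\<rfloor>)" for N :: nat
  \<comment> \<open>Rounding moves each coordinate by less than 1, and the unrounded value of row
    \<open>j\<close> is 0.\<close>
  define b where "b j = (\<Sum>i\<in>I. \<bar>A j i\<bar>)" for j
  have bound: "\<bar>\<Sum>i\<in>I. A j i * \<lfloor>real N * x i\<rfloor>\<bar> \<le> b j" if "j \<in> J" for N j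
  proof -
    have "(\<Sum>i\<in>I. of_int (A j i) * Archimedean_Field.frac (real N * x i)) =
        real N * (\<Sum>i\<in>I. of_int (A j i) * x i) - of_int (\<Sum>i\<in>I. A j i * \<lfloor>real N * x i\<rfloor>)"
      by (simp add: Archimedean_Field.frac_def sum_distrib_left sum_subtractf algebra_simps)
    then have "\<bar>of_int (\<Sum>i\<in>I. A j i * \<lfloor>real N * x i\<rfloor>)\<bar> = \<bar>\<Sum>i\<in>I. of_int (A j i) * Archimedean_Field.frac (real N * x i)\<bar>"
      using kernel[OF that] by simp
    also have "\<dots> \<le> (\<Sum>i\<in>I. \<bar>of_int (A j i) * Archimedean_Field.frac (real N * x i)\<bar>)"
      by (rule sum_abs)
    also have "\<dots> \<le> (\<Sum>i\<in>I. \<bar>of_int (A j i)\<bar>)"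
    proof (rule sum_mono)
      fix i
      have "Archimedean_Field.frac (real N * x i) \<le> 1" using frac_lt_1[of "real N * x i"] by simp
      then show "\<bar>of_int (A j i) * Archimedean_Field.frac (real N * x i)\<bar> \<le> \<bar>real_of_int (A j i)\<bar>"
        by (simp add: abs_mult mult_left_le)
    qed
    finally show ?thesis unfolding b_def by (simp flip: of_int_abs of_int_sum)
  qed
  have "range F \<subseteq> PiE J (\<lambda>j. {- b j..b j})"
    using bound by (auto simp: F_def abs_le_iff minus_le_iff)
  then have "finite (range F)" by (rule finite_subset) (simp add: J finite_PiE)
  \<comment> \<open>Some value of \<open>F\<close> is taken infinitely often, so the second index
    can be pushed \<open>K\<close> beyond the first. This gap later keeps the rounded vector from
    vanishing.\<close>
  then obtain N where N: "infinite {N'. F N' = F N}"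
    using pigeonhole_infinite[of UNIV F] by auto
  then obtain N' where N': "N' \<ge> N + K" "F N' = F N"
    using infinite_nat_iff_unbounded_le[of "{N'. F N' = F N}"] by auto
  have "(\<Sum>i\<in>I. A j i * (\<lfloor>real N' * x i\<rfloor> - \<lfloor>real N * x i\<rfloor>)) = 0" if "j \<in> J" for j
    using fun_cong[OF N'(2), of j] that by (simp add: F_def right_diff_distrib sum_subtractf)
  then show ?thesis using N'(1) by blast
qed

section \<open>Finitely generated cones and polyhedra\<close>

lemma convex_cone_hull_finite_image:
  fixes f :: "'i \<Rightarrow> 'v::real_vector"
  assumes I: "finite I"
  shows "convex_cone hull (f ` I) = {\<Sum>i\<in>I. c i *\<^sub>R f i |c. \<forall>i\<in>I. 0 \<le> c i}" (is "_ = ?R")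
proof
  show "convex_cone hull (f ` I) \<subseteq> ?R"
  proof (rule hull_minimal)
    show "f ` I \<subseteq> ?R"
    proof
      fix y assume "y \<in> f ` I"
      then obtain i where i: "i \<in> I" "y = f i" by auto
      have "y = (\<Sum>j\<in>I. (if j = i then 1 else 0) *\<^sub>R f j)"
        using I i by (subst sum.remove[of _ i]) (auto intro!: sum.neutral)
      then show "y \<in> ?R" by (intro CollectI exI[of _ "\<lambda>j. if j = i then 1 else 0"]) auto
    qed
    show "convex_cone ?R"
      unfolding convex_cone_iff
    proof (intro conjI ballI allI impI)
      show "0 \<in> ?R" by (intro CollectI exI[of _ "\<lambda>_. 0"]) auto
      fix x assume "x \<in> ?R"
      then obtain c where c: "x = (\<Sum>i\<in>I. c i *\<^sub>R f i)" "\<forall>i\<in>I. 0 \<le> c i" by auto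
      show "t *\<^sub>R x \<in> ?R" if "t \<ge> 0" for t
        using c that
        by (intro CollectI exI[of _ "\<lambda>i. t * c i"]) (simp add: scaleR_sum_right)
      fix y assume "y \<in> ?R"
      then obtain c' where c': "y = (\<Sum>i\<in>I. c' i *\<^sub>R f i)" "\<forall>i\<in>I. 0 \<le> c' i" by auto
      show "x + y \<in> ?R"
        using c c' by (intro CollectI exI[of _ "\<lambda>i. c i + c' i"]) (simp add: scaleR_add_left sum.distrib)
    qed
  qed
  have "(\<Sum>i\<in>I. c i *\<^sub>R f i) \<in> convex_cone hull (f ` I)" if "\<forall>i\<in>I. 0 \<le> c i" for c
  proof -
    have "(\<Sum>i\<in>I'. c i *\<^sub>R f i) \<in> convex_cone hull (f ` I)" if "finite I'" "I' \<subseteq> I" for I'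
      using that
    proof (induction I')
      case (insert i I')
      then show ?case
        using \<open>\<forall>i\<in>I. 0 \<le> c i\<close>
        by (auto intro!: convex_cone_hull_add convex_cone_hull_mul intro: hull_inc[of "f i"])
    qed (simp add: convex_cone_hull_contains_0)
    then show ?thesis using I by blast
  qed
  then show "?R \<subseteq> convex_cone hull (f ` I)" by auto
qed

text \<open>If 0 were a convex combination of the nonzero generators, the negative of one of them
  would lie in the cone. So a hyperplane separates 0 from the compact hull of these generators, and
  its normal is positive on each of them.\<close>

lemma pointed_cone_functional:
  fixes P :: "'v::euclidean_space set"
  assumes P: "finite P" and pointed: "convex_cone hull P \<inter> uminus ` (convex_cone hull P) = {0}"
  shows "\<exists>w. \<forall>x\<in>convex_cone hull P. x \<noteq> 0 \<longrightarrow> 0 < w \<bullet> x"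
proof -
  define P' where "P' = P - {0}"
  have P': "finite P'" using P by (simp add: P'_def)
  have hullP: "convex_cone hull P = convex_cone hull P'"
  proof
    have "P \<subseteq> convex_cone hull P'"
    proof
      fix p assume "p \<in> P"
      then show "p \<in> convex_cone hull P'"
        by (cases "p = 0") (auto simp: P'_def convex_cone_hull_contains_0 hull_inc)
    qed
    then show "convex_cone hull P \<subseteq> convex_cone hull P'"
      using convex_cone_convex_cone_hull by (rule hull_minimal)
  qed (simp add: P'_def hull_mono)
  have "0 \<notin> convex hull P'"
  proof
    assume "0 \<in> convex hull P'"
    then obtain l where l: "\<And>p. p \<in> P' \<Longrightarrow> 0 \<le> l p" "sum l P' = 1" "(\<Sum>p\<in>P'. l p *\<^sub>R p) = 0"
      unfolding convex_hull_finite[OF P'] by auto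
    then obtain p where p: "p \<in> P'" "l p > 0"
      by (metis less_eq_real_def sum.neutral zero_neq_one)
    have "- p = (1 / l p) *\<^sub>R (\<Sum>q\<in>P' - {p}. l q *\<^sub>R q)"
      using l(3) p P' by (simp add: sum.remove[OF P' p(1)] add_eq_0_iff)
    also have "(\<Sum>q\<in>P' - {p}. l q *\<^sub>R q) = (\<Sum>q\<in>P'. (if q = p then 0 else l q) *\<^sub>R q)"
      using P' p(1) by (intro sum.mono_neutral_cong_left) auto
    also have "(1 / l p) *\<^sub>R \<dots> \<in> convex_cone hull P'"
      using convex_cone_hull_finite_image[OF P', of "\<lambda>q. q"] l(1) p(2)
      by (intro convex_cone_hull_mul) (auto intro!: exI[of _ "\<lambda>q. if q = p then 0 else l q"])
    finally have "- p \<in> convex_cone hull P" using hullP by simp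
    moreover have "p \<in> convex_cone hull P" using p by (auto simp: P'_def intro: hull_inc)
    ultimately have "p \<in> convex_cone hull P \<inter> uminus ` (convex_cone hull P)"
      by (auto intro!: image_eqI[of _ _ "- p"])
    then have "p = 0" using pointed by simp
    then show False using p by (simp add: P'_def)
  qed
  moreover have "closed (convex hull P')"
    by (simp add: P' compact_imp_closed finite_imp_compact_convex_hull)
  ultimately obtain w b where w: "w \<bullet> 0 < b" "\<forall>x\<in>convex hull P'. b < w \<bullet> x"
    using separating_hyperplane_closed_point[of "convex hull P'" 0] by auto
  have wp: "0 < w \<bullet> p" if "p \<in> P'" for p
    using w that hull_inc[of p P' convex] by force
  have "0 < w \<bullet> x" if x: "x \<in> convex_cone hull P" "x \<noteq> 0" for x
  proof -
    from x(1) obtain c where c: "x = (\<Sum>p\<in>P'. c p *\<^sub>R p)" "\<forall>p\<in>P'. 0 \<le> c p"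
      unfolding hullP using convex_cone_hull_finite_image[OF P', of "\<lambda>q. q"] by auto
    have "\<exists>p\<in>P'. c p \<noteq> 0"
    proof (rule ccontr)
      assume "\<not> ?thesis"
      then have "x = 0" unfolding c(1) by (intro sum.neutral) simp
      then show False using x(2) by simp
    qed
    then obtain p where p: "p \<in> P'" "c p \<noteq> 0" by blast
    have "w \<bullet> x = (\<Sum>p\<in>P'. c p * (w \<bullet> p))" by (simp add: c(1) inner_sum_right)
    also have "\<dots> > 0"
      using c(2) p wp by (intro sum_pos2[OF P' p(1)]) (auto simp: less_eq_real_def)
    finally show ?thesis .
  qed
  then show ?thesis by blast
qed

text \<open>Homogenization: the points of \<open>P\<close> at height 1 and the directions of
  \<open>Q\<close> at height 0 generate a polyhedral cone \<open>K\<close> whose slice at height 1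
  is the set in question.\<close>

lemma polyhedron_convex_hull_plus_cone:
  fixes P Q :: "'v::euclidean_space set"
  assumes P: "finite P" and Q: "finite Q"
  shows "polyhedron {x + y |x y. x \<in> convex hull P \<and> y \<in> convex_cone hull Q}" (is "polyhedron ?C")
proof -
  define f :: "'v + 'v \<Rightarrow> 'v \<times> real" where "f = case_sum (\<lambda>p. (p, 1)) (\<lambda>q. (q, 0))"
  define K where "K = convex_cone hull (f ` (P <+> Q))"
  have fin: "finite (P <+> Q)" using P Q by simp
  have "x \<in> ?C \<longleftrightarrow> (x, 1) \<in> K" for x
  proof -
    have sum: "(\<Sum>i\<in>P <+> Q. c i *\<^sub>R f i) = ((\<Sum>p\<in>P. c (Inl p) *\<^sub>R p) + (\<Sum>q\<in>Q. c (Inr q) *\<^sub>R q), (\<Sum>p\<in>P. c (Inl p)))" for c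
      using P Q by (simp add: f_def sum.Plus prod_eq_iff fst_sum snd_sum)
    have "(x, 1) \<in> K \<longleftrightarrow> (\<exists>c. (\<forall>i\<in>P <+> Q. 0 \<le> c i) \<and>
        x = (\<Sum>p\<in>P. c (Inl p) *\<^sub>R p) + (\<Sum>q\<in>Q. c (Inr q) *\<^sub>R q) \<and> 1 = (\<Sum>p\<in>P. c (Inl p)))"
      unfolding K_def convex_cone_hull_finite_image[OF fin] sum by auto
    also have "\<dots> \<longleftrightarrow> (\<exists>a b. (\<forall>p\<in>P. 0 \<le> a p) \<and> (\<forall>q\<in>Q. 0 \<le> b q) \<and>
        x = (\<Sum>p\<in>P. a p *\<^sub>R p) + (\<Sum>q\<in>Q. b q *\<^sub>R q) \<and> sum a P = 1)" (is "?l = ?r")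
    proof
      assume ?l
      then obtain c where "\<forall>i\<in>P <+> Q. 0 \<le> c i"
        "x = (\<Sum>p\<in>P. c (Inl p) *\<^sub>R p) + (\<Sum>q\<in>Q. c (Inr q) *\<^sub>R q)" "1 = (\<Sum>p\<in>P. c (Inl p))"
        by blast
      then show ?r by (intro exI[of _ "c \<circ> Inl"] exI[of _ "c \<circ> Inr"]) auto
    next
      assume ?r
      then obtain a b where "\<forall>p\<in>P. 0 \<le> a p" "\<forall>q\<in>Q. 0 \<le> b q"
        "x = (\<Sum>p\<in>P. a p *\<^sub>R p) + (\<Sum>q\<in>Q. b q *\<^sub>R q)" "sum a P = 1"
        by blast
      then show ?l by (intro exI[of _ "case_sum a b"]) auto
    qed
    also have "\<dots> \<longleftrightarrow> x \<in> ?C"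
      unfolding convex_hull_finite[OF P] convex_cone_hull_finite_image[OF Q, of "\<lambda>q. q", simplified]
      by blast
    finally show ?thesis by simp
  qed
  then have C: "?C = {x. (x, 1) \<in> K}" by blast
  have "polyhedron K" unfolding K_def using fin by (intro polyhedron_convex_cone_hull) auto
  then obtain F where F: "finite F" "K = \<Inter>F" "\<forall>h\<in>F. \<exists>a b. a \<noteq> 0 \<and> h = {z. a \<bullet> z \<le> b}"
    unfolding polyhedron_def by blast
  have "{x. (x, 1) \<in> K} = \<Inter>((\<lambda>h. {x. (x, 1) \<in> h}) ` F)" by (auto simp: F(2))
  also have "polyhedron \<dots>"
  proof (rule polyhedron_Inter)
    fix X assume "X \<in> (\<lambda>h. {x. (x, 1) \<in> h}) ` F"
    then obtain h where h: "h \<in> F" "X = {x. (x, 1) \<in> h}" by blast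
    then obtain a :: "'v \<times> real" and b where "h = {z. a \<bullet> z \<le> b}" using F(3) by blast
    with h(2) have "X = {x. a \<bullet> (x, 1) \<le> b}" by simp
    \<comment> \<open>Here \<open>fst a\<close> may be 0; the slice is then empty or the whole
      space.\<close>
    then have "X = {x. fst a \<bullet> x \<le> b - snd a}" by (simp add: inner_prod_def le_diff_eq)
    then show "polyhedron X" by (simp add: polyhedron_halfspace_le)
  qed (simp add: F(1))
  finally show ?thesis unfolding C .
qed

text \<open>In an irredundant system of halfspaces every bounding hyperplane cuts out a facet, and a
  point outside violates one of the halfspaces. The signs are reversed to obtain an inward
  normal.\<close>

lemma polyhedron_facet_separation:
  fixes C :: "'v::euclidean_space set"
  assumes C: "polyhedron C" and full: "affine hull C = UNIV" and x: "x \<notin> C"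
  shows "\<exists>u c. u \<noteq> 0 \<and> C \<subseteq> {y. c \<le> u \<bullet> y} \<and> (C \<inter> {y. u \<bullet> y = c}) facet_of C \<and> u \<bullet> x < c"
proof -
  obtain F where F: "finite F" "C = (affine hull C) \<inter> \<Inter>F"
      "\<forall>h\<in>F. \<exists>a b. a \<noteq> 0 \<and> h = {x. a \<bullet> x \<le> b}"
      "\<And>F'. F' \<subset> F \<Longrightarrow> C \<subset> (affine hull C) \<inter> \<Inter>F'"
    using C unfolding polyhedron_Int_affine_minimal by meson
  then obtain a b where ab: "\<And>h. h \<in> F \<Longrightarrow> a h \<noteq> 0 \<and> h = {x. a h \<bullet> x \<le> b h}" by metis
  have CF: "C = \<Inter>F" using F(2) full by simp
  then obtain h where h: "h \<in> F" "x \<notin> h" using x by auto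
  have "(C \<inter> {y. a h \<bullet> y = b h}) facet_of C"
    using facet_of_polyhedron_explicit[OF F(1,2) ab F(4)] h(1) by blast
  moreover have "C \<subseteq> h" using h CF by auto
  ultimately show ?thesis
    using ab[OF h(1)] h(2) by (intro exI[of _ "- a h"] exI[of _ "- b h"]) auto
qed

text \<open>The component \<open>v\<close> of \<open>z\<close> orthogonal to \<open>u\<close> can be
  added to a point of the first hyperplane without leaving it. Hence \<open>z\<close> is orthogonal
  to \<open>v\<close>, which forces \<open>v = 0\<close>.\<close>

lemma hyperplane_subset_imp_parallel:
  fixes u z :: "'v::euclidean_space"
  assumes u: "u \<noteq> 0" and sub: "{x. u \<bullet> x = c} \<subseteq> {x. z \<bullet> x = d}"
  shows "\<exists>r. z = r *\<^sub>R u"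
proof -
  define r where "r = (z \<bullet> u) / (u \<bullet> u)"
  define v where "v = z - r *\<^sub>R u"
  define x0 where "x0 = (c / (u \<bullet> u)) *\<^sub>R u"
  have uv: "u \<bullet> v = 0" using u by (simp add: v_def r_def inner_diff_right inner_commute)
  have "u \<bullet> x0 = c" using u by (simp add: x0_def)
  moreover have "u \<bullet> (x0 + v) = c" using uv \<open>u \<bullet> x0 = c\<close> by (simp add: inner_add_right)
  ultimately have "z \<bullet> x0 = d" "z \<bullet> (x0 + v) = d" using sub by blast+
  then have "z \<bullet> v = 0" by (simp add: inner_add_right)
  then have "v \<bullet> v = 0" using uv by (simp add: v_def inner_diff_left inner_diff_right inner_commute)
  then show ?thesis by (auto simp: v_def)
qed

text \<open>A facet of a full dimensional set spans a hyperplane, on which both functionals are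
  constant. The factor \<open>r\<close> may be zero or negative, since \<open>z\<close> is only
  known to be constant on \<open>F\<close>.\<close>

lemma facet_normal_unique:
  fixes C :: "'v::euclidean_space set"
  assumes facet: "F facet_of C" and full: "affine hull C = UNIV"
    and u: "u \<noteq> 0" "F \<subseteq> {x. u \<bullet> x = c}" and z: "F \<subseteq> {x. z \<bullet> x = d}"
  shows "\<exists>r. z = r *\<^sub>R u"
proof -
  have "aff_dim C = DIM('v)" by (metis full aff_dim_affine_hull aff_dim_UNIV)
  then have "aff_dim F = DIM('v) - 1" using facet by (simp add: facet_of_def)
  then obtain a b where a: "a \<noteq> 0" "affine hull F = {x. a \<bullet> x = b}"
    using aff_dim_eq_hyperplane by blast
  have "affine hull F \<subseteq> {x. u \<bullet> x = c}" using u(2) affine_hyperplane by (rule hull_minimal)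
  then obtain r where r: "u = r *\<^sub>R a" using hyperplane_subset_imp_parallel[OF a(1)] a(2) by metis
  have "affine hull F \<subseteq> {x. z \<bullet> x = d}" using z affine_hyperplane by (rule hull_minimal)
  then obtain s where s: "z = s *\<^sub>R a" using hyperplane_subset_imp_parallel[OF a(1)] a(2) by metis
  have "z = (s / r) *\<^sub>R u" using r s u(1) by auto
  then show ?thesis by blast
qed

text \<open>The sign is decided by a point of \<open>C\<close> off the facet, where both normals
  exceed their values on the facet.\<close>

lemma facet_normal_unique_pos:
  fixes C :: "'v::euclidean_space set"
  assumes facet: "F facet_of C" and full: "affine hull C = UNIV"
    and u: "inward_normal C F u" and z: "inward_normal C F z"
  shows "\<exists>r>0. z = r *\<^sub>R u"
proof -
  obtain c where c: "u \<noteq> 0" "C \<subseteq> {x. c \<le> u \<bullet> x}" "F = C \<inter> {x. u \<bullet> x = c}"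
    using u unfolding inward_normal_def by blast
  obtain d where d: "z \<noteq> 0" "C \<subseteq> {x. d \<le> z \<bullet> x}" "F = C \<inter> {x. z \<bullet> x = d}"
    using z unfolding inward_normal_def by blast
  obtain r where r: "z = r *\<^sub>R u"
    using facet_normal_unique[OF facet full c(1), of c z d] c(3) d(3) by blast
  have "F \<noteq> {}" "F \<subset> C" using facet facet_of_imp_subset facet_of_irrefl by (auto simp: facet_of_def)
  then obtain x y where x: "x \<in> F" and y: "y \<in> C" "y \<notin> F" by blast
  have uy: "u \<bullet> y > u \<bullet> x" using x y c by fastforce
  have "z \<bullet> y > z \<bullet> x" using x y d by fastforce
  then have "r * (u \<bullet> y - u \<bullet> x) > 0" by (simp add: r algebra_simps)
  then have "r > 0" using uy by (simp add: zero_less_mult_iff)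
  then show ?thesis using r by blast
qed

section \<open>Integer vectors and primitive normals\<close>

lemma rvec_nth [simp]: "rvec u $ i = real_of_int (u $ i)"
  by (simp add: rvec_def)

lemma rvec_0 [simp]: "rvec 0 = 0" and rvec_add: "rvec (u + v) = rvec u + rvec v"
  and rvec_diff: "rvec (u - v) = rvec u - rvec v" and rvec_eq_iff [simp]: "rvec u = rvec v \<longleftrightarrow> u = v"
  by (simp_all add: vec_eq_iff)

lemma rvec_eq_0_iff [simp]: "rvec u = 0 \<longleftrightarrow> u = 0"
  by (simp add: vec_eq_iff)

lemma rvec_inner: "rvec u \<bullet> rvec m = real_of_int (scalar_product u m)"
  by (simp add: inner_vec_def scalar_product_def)

text \<open>After cross multiplication with the \<open>j\<close>-th entries, the gcd over
  \<open>i\<close> of either side is the absolute value of the multiplier. So \<open>u $ j\<close>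
  and \<open>z $ j\<close> agree up to sign, and positivity of \<open>r\<close> gives
  \<open>r = 1\<close>.\<close>

lemma primitive_eqI:
  assumes u: "primitive u" and z: "primitive z" and r: "r > 0" "rvec z = r *\<^sub>R rvec u"
  shows "z = u"
proof -
  have "u \<noteq> 0" using u by (auto simp: primitive_def)
  then obtain j where j: "u $ j \<noteq> 0" by (auto simp: vec_eq_iff)
  have zr: "real_of_int (z $ i) = r * real_of_int (u $ i)" for i
    using r(2) by (metis rvec_nth scaleR_conv_of_real vector_scaleR_component of_real_eq_id id_apply)
  have cross: "(u $ j) * (z $ i) = (z $ j) * (u $ i)" for i
  proof -
    have "real_of_int ((u $ j) * (z $ i)) = real_of_int ((z $ j) * (u $ i))" by (simp add: zr)
    then show ?thesis by (simp only: of_int_eq_iff)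
  qed
  have "Gcd ((*) (u $ j) ` range (($) z)) = Gcd ((*) (z $ j) ` range (($) u))"
    by (simp add: image_image cross)
  then have "\<bar>u $ j\<bar> = \<bar>z $ j\<bar>"
    using u z by (simp add: Gcd_mult primitive_def)
  moreover have "sgn (real_of_int (z $ j)) = sgn (real_of_int (u $ j))"
    using r(1) by (simp add: zr sgn_mult)
  ultimately have "r = 1" using j r(1) zr[of j]
    by (metis abs_mult abs_of_pos mult_cancel_right1 mult.commute of_int_abs of_int_eq_0_iff abs_eq_0)
  then show ?thesis using r(2) by simp
qed

lemma primitive_multiple:
  fixes z :: "int ^ 'n"
  assumes "z \<noteq> 0"
  shows "\<exists>u r. primitive u \<and> r > 0 \<and> rvec u = r *\<^sub>R rvec z"
proof -
  define d where "d = (GCD i\<in>UNIV. z $ i)"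
  have d: "d > 0"
  proof -
    have "d \<noteq> 0" using assms by (auto simp: d_def vec_eq_iff)
    moreover have "d \<ge> 0" unfolding d_def by simp
    ultimately show ?thesis by simp
  qed
  define u where "u = (\<chi> i. z $ i div d)"
  have zu: "z $ i = d * u $ i" for i by (simp add: u_def d_def)
  have "d = Gcd ((*) d ` range (($) u))"
    by (subst d_def) (simp add: zu image_image)
  then have "d = d * Gcd (range (($) u))" using d by (simp add: Gcd_mult abs_mult)
  then have "primitive u" using d by (simp add: primitive_def)
  moreover have "rvec u = (1 / of_int d) *\<^sub>R rvec z"
    using d by (simp add: vec_eq_iff zu)
  ultimately show ?thesis using d by (intro exI[of _ u] exI[of _ "1 / of_int d"]) simp
qed

section \<open>Newton polyhedra\<close>

lemma sum_replicate_mset_int_vec: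
  fixes m :: "int ^ 'n"
  shows "sum_mset (replicate_mset k m) = int k *s m"
  by (induction k) (auto simp: vec_eq_iff algebra_simps)

lemma sum_delta_vec:
  fixes g :: "int ^ 'n"
  assumes "finite A" "g \<in> A"
  shows "(\<Sum>h\<in>A. int (if h = g then k else 0) *s h) = int k *s g"
  using assms by (subst sum.remove[of _ g]) (auto intro!: sum.neutral)

lemma rvec_mult: "rvec (k *s m) = real_of_int k *\<^sub>R rvec m"
  by (simp add: vec_eq_iff)

lemma wt_cone_hull: "wt_cone (add_submonoid hull G) = convex_cone hull (rvec ` G)"
proof
  have "add_submonoid {m. rvec m \<in> convex_cone hull (rvec ` G)}"
    by (auto simp: add_submonoid_def convex_cone_hull_contains_0 rvec_add intro: convex_cone_hull_add)
  then have "add_submonoid hull G \<subseteq> {m. rvec m \<in> convex_cone hull (rvec ` G)}"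
    by (intro hull_minimal) (auto intro: hull_inc)
  then have "rvec ` (add_submonoid hull G) \<subseteq> convex_cone hull (rvec ` G)" by blast
  then show "wt_cone (add_submonoid hull G) \<subseteq> convex_cone hull (rvec ` G)"
    unfolding wt_cone_def using convex_cone_convex_cone_hull by (rule hull_minimal)
  show "convex_cone hull (rvec ` G) \<subseteq> wt_cone (add_submonoid hull G)"
    unfolding wt_cone_def by (intro hull_mono image_mono hull_subset)
qed

text \<open>\<open>affine_semigroup\<close> with its choices made explicit: nonzero generators, so
  that every \<open>chi S g\<close> lies in the maximal ideal, and a functional \<open>w\<close>
  witnessing pointedness.\<close>

locale affine_cone =
  fixes S G :: "(int ^ 'n::finite) set" and w :: "real ^ 'n"
  assumes G_finite: "finite G" and G_nonzero: "0 \<notin> G" and S_def: "S = add_submonoid hull G"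
    and w_pos: "\<And>x. x \<in> wt_cone S \<Longrightarrow> x \<noteq> 0 \<Longrightarrow> 0 < w \<bullet> x"
    and full_dim: "aff_dim (wt_cone S) = int CARD('n)"
begin

lemma add_submonoid_S: "add_submonoid S"
  unfolding S_def by (rule hull_in) (auto simp: add_submonoid_def)

lemma rvec_in_wt_cone: "m \<in> S \<Longrightarrow> rvec m \<in> wt_cone S"
  by (auto simp: wt_cone_def intro: hull_inc)

sublocale graded_semigroup S "\<lambda>m. w \<bullet> rvec m"
  by standard (auto simp: add_submonoid_S rvec_add inner_add_right rvec_in_wt_cone w_pos)

lemma G_subset: "G \<subseteq> S"
  unfolding S_def by (rule hull_subset)

lemma nat_mult_in_S: "m \<in> S \<Longrightarrow> int k *s m \<in> S"
  using replicate_in_npow[of m S k, unfolded sum_replicate_mset_int_vec]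
    sideal_subset[OF sideal_npow[OF sideal_S]] by blast

lemma sum_in_S: "finite A \<Longrightarrow> (\<And>x. x \<in> A \<Longrightarrow> f x \<in> S) \<Longrightarrow> sum f A \<in> S"
  by (induction A rule: finite_induct) (auto intro: S_add)

lemma S_combination:
  assumes "m \<in> S"
  shows "\<exists>c. m = (\<Sum>g\<in>G. int (c g) *s g)"
proof -
  let ?T = "{\<Sum>g\<in>G. int (c g) *s g |c. True}"
  have "add_submonoid ?T"
    unfolding add_submonoid_def
  proof (intro conjI ballI)
    show "0 \<in> ?T" by (auto intro!: exI[of _ "\<lambda>_. 0"] simp: vec_eq_iff)
    fix x y assume "x \<in> ?T" "y \<in> ?T"
    then obtain c d where "x = (\<Sum>g\<in>G. int (c g) *s g)" "y = (\<Sum>g\<in>G. int (d g) *s g)" by auto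
    then have "x + y = (\<Sum>g\<in>G. int (c g + d g) *s g)"
      by (simp add: vec_eq_iff sum.distrib ring_distribs)
    then show "x + y \<in> ?T" unfolding mem_Collect_eq by (intro exI[of _ "\<lambda>g. c g + d g"]) simp
  qed
  moreover have "G \<subseteq> ?T"
  proof
    fix h assume h: "h \<in> G"
    have "h = (\<Sum>g\<in>G. int (if g = h then 1 else 0) *s g)"
      using sum_delta_vec[OF G_finite h, of 1] by simp
    then show "h \<in> ?T" unfolding mem_Collect_eq by (intro exI[of _ "\<lambda>g. if g = h then 1 else 0"]) simp
  qed
  ultimately have "S \<subseteq> ?T" unfolding S_def by (intro hull_minimal)
  then show ?thesis using assms by blast
qed

lemma wt_cone_eq: "wt_cone S = convex_cone hull (rvec ` G)"
  unfolding S_def by (rule wt_cone_hull)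

lemma wt_cone_zero: "0 \<in> wt_cone S"
  by (simp add: wt_cone_def convex_cone_hull_contains_0)

lemma wt_cone_scale: "x \<in> wt_cone S \<Longrightarrow> 0 \<le> c \<Longrightarrow> c *\<^sub>R x \<in> wt_cone S"
  by (simp add: wt_cone_def convex_cone_hull_mul)

lemma wt_cone_add: "x \<in> wt_cone S \<Longrightarrow> y \<in> wt_cone S \<Longrightarrow> x + y \<in> wt_cone S"
  by (simp add: wt_cone_def convex_cone_hull_add)

lemma w_nonneg: "x \<in> wt_cone S \<Longrightarrow> 0 \<le> w \<bullet> x"
  using w_pos[of x] by (cases "x = 0") auto

text \<open>Depends on the exponents alone, which keeps the ring out of the convex geometry.\<close>

definition newton :: "(int ^ 'n) set \<Rightarrow> (real ^ 'n) set" where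
  "newton E = {x + y |x y. x \<in> convex hull (rvec ` E) \<and> y \<in> wt_cone S}"

lemma rvec_in_newton: "e \<in> E \<Longrightarrow> rvec e \<in> newton E"
  unfolding newton_def using wt_cone_zero
  by (intro CollectI exI[of _ "rvec e"] exI[of _ 0]) (auto intro: hull_inc)

lemma newton_add: "x \<in> newton E \<Longrightarrow> y \<in> wt_cone S \<Longrightarrow> x + y \<in> newton E"
  unfolding newton_def using wt_cone_add by (force simp: add.assoc)

lemma newton_ge:
  assumes u: "u \<in> dual_cone S" and h: "\<And>e. e \<in> E \<Longrightarrow> h \<le> u \<bullet> rvec e" and x: "x \<in> newton E"
  shows "h \<le> u \<bullet> x"
proof -
  obtain y z where yz: "x = y + z" "y \<in> convex hull (rvec ` E)" "z \<in> wt_cone S"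
    using x by (auto simp: newton_def)
  have "convex hull (rvec ` E) \<subseteq> {y. u \<bullet> y \<ge> h}"
    using h by (intro hull_minimal convex_halfspace_ge) auto
  then have "h \<le> u \<bullet> y" using yz by auto
  moreover have "0 \<le> u \<bullet> z" using u yz by (auto simp: dual_cone_def)
  ultimately show ?thesis by (simp add: yz inner_add_right)
qed

text \<open>An integral \<open>u\<close> in the dual cone takes natural number values on
  \<open>E\<close>, so the minimum is attained even when \<open>E\<close> is infinite; cone
  directions can only increase the value.\<close>

lemma support_fun_newton:
  assumes u: "rvec u \<in> dual_cone S" and E: "E \<subseteq> S" "E \<noteq> {}"
  shows "\<exists>e\<in>E. support_fun (newton E) (rvec u) = rvec u \<bullet> rvec e \<and>
    (\<forall>e'\<in>E. rvec u \<bullet> rvec e \<le> rvec u \<bullet> rvec e')"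
proof -
  have nonneg: "0 \<le> scalar_product u m" if "m \<in> S" for m
    using u rvec_in_wt_cone[OF that] by (auto simp: dual_cone_def rvec_inner)
  obtain e where e: "e \<in> E" "\<And>e'. e' \<in> E \<Longrightarrow> nat (scalar_product u e) \<le> nat (scalar_product u e')"
    using ex_has_least_nat[of "\<lambda>e. e \<in> E" _ "\<lambda>e. nat (scalar_product u e)"] E(2) by blast
  have min: "rvec u \<bullet> rvec e \<le> rvec u \<bullet> rvec e'" if "e' \<in> E" for e'
    using e(2)[OF that] nonneg[of e] nonneg[of e'] e(1) that E(1) by (auto simp: rvec_inner)
  have "support_fun (newton E) (rvec u) = rvec u \<bullet> rvec e"
    unfolding support_fun_def
    using newton_ge[OF u min] rvec_in_newton[OF e(1)]
    by (intro cInf_eq_minimum) auto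
  then show ?thesis using e(1) min by blast
qed

lemma affine_hull_newton:
  assumes "E \<noteq> {}"
  shows "affine hull (newton E) = UNIV"
proof -
  obtain e where e: "e \<in> E" using assms by blast
  have "(+) (rvec e) ` wt_cone S \<subseteq> newton E"
    using newton_add[OF rvec_in_newton[OF e]] by auto
  then have "aff_dim ((+) (rvec e) ` wt_cone S) \<le> aff_dim (newton E)" by (rule aff_dim_subset)
  then have "aff_dim (newton E) = DIM(real ^ 'n)"
    using full_dim aff_dim_le_DIM[of "newton E"] by (simp add: aff_dim_translation_eq)
  then show ?thesis using aff_dim_eq_full by blast
qed

text \<open>
  For an \<open>m\<^sub>S\<close>-primary ideal, finite generation does not need Dickson's lemma: the
  exponents of its generators can be bounded by those of the pure powers it contains.
\<close>

lemma finite_basis: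
  assumes E: "sideal E" and mult: "\<And>g. g \<in> G \<Longrightarrow> \<exists>k. int k *s g \<in> E"
  shows "\<exists>B. finite B \<and> B \<subseteq> E \<and> E \<subseteq> msum B S"
proof -
  obtain k where k: "\<And>g. g \<in> G \<Longrightarrow> int (k g) *s g \<in> E" using mult by metis
  define B where "B = E \<inter> (\<lambda>c. \<Sum>g\<in>G. int (c g) *s g) ` PiE G (\<lambda>g. {..k g})"
  have "finite B" unfolding B_def by (intro finite_Int disjI2 finite_imageI finite_PiE G_finite) auto
  moreover have "m \<in> msum B S" if m: "m \<in> E" for m
  proof -
    obtain c where c: "m = (\<Sum>g\<in>G. int (c g) *s g)" using S_combination m sideal_subset[OF E] by blast
    show ?thesis
    proof (cases "\<exists>g\<in>G. k g \<le> c g")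
      case False
      have "m = (\<Sum>g\<in>G. int (restrict c G g) *s g)" unfolding c by (intro sum.cong) auto
      moreover have "restrict c G \<in> PiE G (\<lambda>g. {..k g})" using False by auto
      ultimately have "m \<in> B" using m unfolding B_def by blast
      then show ?thesis using subset_msum_S by blast
    next
      case True
      then obtain g where g: "g \<in> G" "k g \<le> c g" by blast
      \<comment> \<open>Here \<open>m\<close> is the sum of the pure multiple
        \<open>int (k g) *s g\<close> and an element of \<open>S\<close>; the pure multiple itself
        has bounded coefficients and so belongs to \<open>B\<close>.\<close>
      have "int (k g) *s g = (\<Sum>h\<in>G. int (restrict (\<lambda>h. if h = g then k g else 0) G h) *s h)"
        unfolding sum_delta_vec[OF G_finite g(1), of "k g", symmetric] by (intro sum.cong) auto
      moreover have "restrict (\<lambda>h. if h = g then k g else 0) G \<in> PiE G (\<lambda>g. {..k g})" by auto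
      ultimately have kg: "int (k g) *s g \<in> B" using k[of g] g unfolding B_def by blast
      have "m = int (c g) *s g + (\<Sum>h\<in>G - {g}. int (c h) *s h)"
        unfolding c using g G_finite by (simp add: sum.remove)
      also have "int (c g) *s g = int (k g) *s g + int (c g - k g) *s g"
        using g(2) by (simp add: vec_eq_iff of_nat_diff algebra_simps)
      finally have "m = int (k g) *s g + (int (c g - k g) *s g + (\<Sum>h\<in>G - {g}. int (c h) *s h))"
        by (simp only: add.assoc)
      moreover have "int (c g - k g) *s g + (\<Sum>h\<in>G - {g}. int (c h) *s h) \<in> S"
        using g G_subset G_finite by (intro S_add sum_in_S nat_mult_in_S) auto
      ultimately show ?thesis using msumI[OF kg] by simp
    qed
  qed
  ultimately show ?thesis unfolding B_def by blast
qed

text \<open>Elements of \<open>S\<close> added to the generators \<open>B\<close> are cone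
  directions, which \<open>newton B\<close> absorbs, and \<open>newton B\<close> is convex. Thus
  finite data describe the polyhedron.\<close>

lemma newton_eq:
  assumes B: "B \<subseteq> E" "E \<subseteq> msum B S"
  shows "newton E = {x + y |x y. x \<in> convex hull (rvec ` B) \<and> y \<in> convex_cone hull (rvec ` G)}"
proof -
  have "newton E = newton B"
  proof
    show "newton B \<subseteq> newton E"
      unfolding newton_def using hull_mono[of "rvec ` B" "rvec ` E" convex] B(1) by blast
    have "convex (\<Union>x\<in>convex hull (rvec ` B). \<Union>y\<in>wt_cone S. {x + y})"
      unfolding wt_cone_def by (intro convex_sums convex_convex_hull convex_convex_cone_hull)
    also have "(\<Union>x\<in>convex hull (rvec ` B). \<Union>y\<in>wt_cone S. {x + y}) = newton B"
      by (auto simp: newton_def)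
    finally have conv: "convex (newton B)" .
    have "rvec ` E \<subseteq> newton B"
    proof (rule image_subsetI)
      fix e assume "e \<in> E"
      then have "e \<in> msum B S" using B(2) by blast
      then obtain b s where "e = b + s" "b \<in> B" "s \<in> S" by (rule msumE)
      then show "rvec e \<in> newton B"
        by (simp add: rvec_add newton_add rvec_in_newton rvec_in_wt_cone)
    qed
    then have "convex hull (rvec ` E) \<subseteq> newton B" using conv by (rule hull_minimal)
    then show "newton E \<subseteq> newton B"
      unfolding newton_def[of E] using newton_add by blast
  qed
  then show ?thesis by (simp add: newton_def wt_cone_eq)
qed

lemma newton_combination:
  assumes B: "finite B" "B \<subseteq> E" "E \<subseteq> msum B S" and x: "x \<in> newton E"
  shows "\<exists>l y. (\<forall>b\<in>B. 0 \<le> l b) \<and> sum l B = 1 \<and> y \<in> wt_cone S \<and> x = (\<Sum>b\<in>B. l b *\<^sub>R rvec b) + y"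
proof -
  obtain z y where zy: "x = z + y" "z \<in> convex hull (rvec ` B)" "y \<in> wt_cone S"
    using x unfolding newton_eq[OF B(2,3)] wt_cone_eq by blast
  have inj: "inj_on rvec B" by (auto intro: inj_onI)
  obtain l' where l': "\<And>p. p \<in> rvec ` B \<Longrightarrow> 0 \<le> l' p" "sum l' (rvec ` B) = 1"
    "(\<Sum>p\<in>rvec ` B. l' p *\<^sub>R p) = z"
    using zy(2) B(1) by (auto simp: convex_hull_finite)
  show ?thesis
    using l' zy by (intro exI[of _ "l' \<circ> rvec"] exI[of _ y]) (auto simp: sum.reindex[OF inj])
qed

lemma polyhedron_newton:
  assumes "finite B" "B \<subseteq> E" "E \<subseteq> msum B S"
  shows "polyhedron (newton E)"
  unfolding newton_eq[OF assms(2,3)] using assms(1) G_finite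
  by (intro polyhedron_convex_hull_plus_cone) auto

text \<open>If \<open>u\<close> were negative at a cone point \<open>y\<close>, it would be
  unbounded below on the ray from an exponent in direction \<open>y\<close>; \<open>t\<close> is
  chosen so that the value drops below \<open>c\<close>.\<close>

lemma inward_normal_dual:
  assumes "E \<noteq> {}" "newton E \<subseteq> {x. c \<le> u \<bullet> x}"
  shows "u \<in> dual_cone S"
proof (rule ccontr)
  assume "u \<notin> dual_cone S"
  then obtain y where y: "y \<in> wt_cone S" "u \<bullet> y < 0" by (auto simp: dual_cone_def not_le)
  obtain e where e: "e \<in> E" using assms(1) by blast
  define t where "t = (\<bar>c - u \<bullet> rvec e\<bar> + 1) / (- (u \<bullet> y))"
  have "t \<ge> 0" unfolding t_def using y by (intro divide_nonneg_pos) auto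
  then have "rvec e + t *\<^sub>R y \<in> newton E" by (intro newton_add rvec_in_newton e wt_cone_scale y)
  then have "c \<le> u \<bullet> rvec e + t * (u \<bullet> y)" using assms(2) by (auto simp: inner_add_right)
  moreover have "t * (u \<bullet> y) = - (\<bar>c - u \<bullet> rvec e\<bar> + 1)" using y by (simp add: t_def field_simps)
  ultimately show False by linarith
qed

text \<open>Compactness means that points of \<open>F\<close> have no cone component, so
  \<open>F\<close> lies in the affine span of the exponents \<open>BF\<close>. Normals to these form
  the kernel of an integer matrix, where rounding finds a nonzero integer vector \<open>z\<close>.
  Being constant on \<open>F\<close>, \<open>z\<close> is a multiple of \<open>u\<close>.\<close>

lemma compact_facet_normal_integral:
  assumes B: "finite B" "B \<subseteq> E" "E \<subseteq> msum B S" and ne: "E \<noteq> {}"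
    and facet: "F facet_of newton E" and u: "u \<noteq> 0" "newton E \<subseteq> {x. c \<le> u \<bullet> x}"
      "F = newton E \<inter> {x. u \<bullet> x = c}"
    and compact: "{x. u \<bullet> x = 0} \<inter> wt_cone S = {0}"
  shows "\<exists>z r. primitive z \<and> r > 0 \<and> rvec z = r *\<^sub>R u"
proof -
  have dual: "u \<in> dual_cone S" using inward_normal_dual[OF ne u(2)] .
  define BF where "BF = {b\<in>B. u \<bullet> rvec b = c}"
  have comb: "\<exists>l. sum l BF = 1 \<and> x = (\<Sum>b\<in>BF. l b *\<^sub>R rvec b)" if "x \<in> F" for x
  proof -
    obtain l y where ly: "\<forall>b\<in>B. 0 \<le> l b" "sum l B = 1" "y \<in> wt_cone S"
        "x = (\<Sum>b\<in>B. l b *\<^sub>R rvec b) + y"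
      using newton_combination[OF B] \<open>x \<in> F\<close> u(3) by blast
    have ge: "c \<le> u \<bullet> rvec b" if "b \<in> B" for b
      using u(2) rvec_in_newton[of b E] that B(2) by auto
    \<comment> \<open>The value \<open>c\<close> is an average of values at least \<open>c\<close>
      plus a nonnegative cone contribution, so every weighted excess vanishes and so does the cone
      part.\<close>
    have "c = (\<Sum>b\<in>B. l b * (u \<bullet> rvec b)) + u \<bullet> y"
      using \<open>x \<in> F\<close> u(3) by (simp add: ly(4) inner_add_right inner_sum_right)
    moreover have "(\<Sum>b\<in>B. l b * (u \<bullet> rvec b)) = (\<Sum>b\<in>B. l b * (u \<bullet> rvec b - c)) + c"
      using ly(2) by (simp add: algebra_simps sum_subtractf flip: sum_distrib_left)
    moreover have nn: "\<forall>b\<in>B. 0 \<le> l b * (u \<bullet> rvec b - c)" using ly(1) ge by simp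
    moreover have "0 \<le> u \<bullet> y" using dual ly(3) by (auto simp: dual_cone_def)
    ultimately have "u \<bullet> y = 0" "(\<Sum>b\<in>B. l b * (u \<bullet> rvec b - c)) = 0"
      using sum_nonneg[of B "\<lambda>b. l b * (u \<bullet> rvec b - c)"] by auto
    then have y: "y = 0" and z: "\<forall>b\<in>B. l b * (u \<bullet> rvec b - c) = 0"
      using compact ly(3) nn B(1) by (auto simp: sum_nonneg_eq_0_iff)
    have l0: "u \<bullet> rvec b = c" if "b \<in> B" "l b \<noteq> 0" for b using z that by auto
    have "sum l BF = sum l B" "(\<Sum>b\<in>BF. l b *\<^sub>R rvec b) = (\<Sum>b\<in>B. l b *\<^sub>R rvec b)"
      using l0 B(1) by (auto simp: BF_def intro!: sum.mono_neutral_left)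
    then show ?thesis using ly y by auto
  qed
  have "F \<noteq> {}" using facet by (simp add: facet_of_def)
  then obtain b0 where b0: "b0 \<in> BF" using comb by force
  have finBF: "finite BF" using B(1) by (simp add: BF_def)
  obtain j where j: "u $ j \<noteq> 0" using u(1) by (auto simp: vec_eq_iff)
  \<comment> \<open>Multiples of \<open>u $ j\<close> whose indices differ by at least
    \<open>K\<close> are more than 1 apart, so their floors differ and \<open>z $ j\<close> is
    nonzero.\<close>
  obtain K :: nat where K: "real K * \<bar>u $ j\<bar> > 1"
    using reals_Archimedean3[of "\<bar>u $ j\<bar>"] j by auto
  have "(\<Sum>i\<in>UNIV. of_int ((b - b0) $ i) * u $ i) = 0" if "b \<in> BF" for b
  proof -
    have "(\<Sum>i\<in>UNIV. of_int ((b - b0) $ i) * u $ i) = u \<bullet> rvec b - u \<bullet> rvec b0"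
      by (simp add: inner_vec_def algebra_simps sum_subtractf)
    then show ?thesis using that b0 by (simp add: BF_def)
  qed
  then obtain N N' where N: "N + K \<le> N'"
    "\<forall>b\<in>BF. (\<Sum>i\<in>UNIV. (b - b0) $ i * (\<lfloor>real N' * u $ i\<rfloor> - \<lfloor>real N * u $ i\<rfloor>)) = 0"
    using integer_kernel_approx[of UNIV BF "\<lambda>b i. (b - b0) $ i" "($) u" K] finBF by auto
  define z where "z = (\<chi> i. \<lfloor>real N' * u $ i\<rfloor> - \<lfloor>real N * u $ i\<rfloor>)"
  have "z $ j \<noteq> 0"
  proof
    assume "z $ j = 0"
    then have "\<lfloor>real N' * u $ j\<rfloor> = \<lfloor>real N * u $ j\<rfloor>" by (simp add: z_def)
    then have "\<bar>real N' * u $ j - real N * u $ j\<bar> \<le> 1" by linarith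
    then have "(real N' - real N) * \<bar>u $ j\<bar> \<le> 1"
      using N(1) by (simp add: abs_mult flip: left_diff_distrib)
    moreover have "real K * \<bar>u $ j\<bar> \<le> (real N' - real N) * \<bar>u $ j\<bar>"
      using N(1) by (intro mult_right_mono) auto
    ultimately show False using K by linarith
  qed
  then have z0: "z \<noteq> 0" by (metis zero_index)
  have zb: "rvec z \<bullet> rvec b = rvec z \<bullet> rvec b0" if "b \<in> BF" for b
  proof -
    have "scalar_product z (b - b0) = 0"
      using N(2) that by (simp add: scalar_product_def z_def mult.commute)
    then have "rvec z \<bullet> rvec (b - b0) = 0" by (simp add: rvec_inner)
    then show ?thesis by (simp add: rvec_diff inner_diff_right)
  qed
  have "F \<subseteq> {x. rvec z \<bullet> x = rvec z \<bullet> rvec b0}"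
  proof
    fix x assume "x \<in> F"
    then obtain l where l: "sum l BF = 1" "x = (\<Sum>b\<in>BF. l b *\<^sub>R rvec b)" using comb by blast
    have "rvec z \<bullet> x = (\<Sum>b\<in>BF. l b * (rvec z \<bullet> rvec b0))"
      unfolding l(2) inner_sum_right by (intro sum.cong) (auto simp: zb)
    then show "x \<in> {x. rvec z \<bullet> x = rvec z \<bullet> rvec b0}" using l(1) by (simp flip: sum_distrib_right)
  qed
  moreover have "F \<subseteq> {x. u \<bullet> x = c}" using u(3) by blast
  ultimately obtain r where r: "rvec z = r *\<^sub>R u"
    using facet_normal_unique[OF facet affine_hull_newton[OF ne] u(1)] by blast
  have "r \<noteq> 0" using z0 r by auto
  \<comment> \<open>Constancy on \<open>F\<close> leaves the sign of \<open>r\<close> open; it is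
    corrected here to obtain an inward normal.\<close>
  define z' where "z' = (if r > 0 then z else - z)"
  have z': "rvec z' = \<bar>r\<bar> *\<^sub>R u" using r by (simp add: z'_def vec_eq_iff)
  have "z' \<noteq> 0" using z0 by (simp add: z'_def)
  then obtain v s where "primitive v" "s > 0" "rvec v = s *\<^sub>R rvec z'"
    using primitive_multiple by blast
  then show ?thesis using z' \<open>r \<noteq> 0\<close> by (intro exI[of _ v] exI[of _ "s * \<bar>r\<bar>"]) auto
qed

section \<open>Normals of compact facets\<close>

definition normals :: "(int ^ 'n) set \<Rightarrow> (int ^ 'n) set" where
  "normals E = {u. primitive u \<and> rvec u \<in> dual_cone S \<and>
     (\<exists>F. compact_facet S (newton E) F \<and> inward_normal (newton E) F (rvec u))}"

text \<open>\<open>compact_facet\<close> grants the condition on the kernel to some inward normal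
  \<open>v\<close> of the facet; \<open>rvec u\<close> is a positive multiple of
  \<open>v\<close>.\<close>

lemma normals_pos:
  assumes ne: "E \<noteq> {}" and u: "u \<in> normals E" and x: "x \<in> wt_cone S" "x \<noteq> 0"
  shows "0 < rvec u \<bullet> x"
proof -
  obtain F v where F: "F facet_of newton E" "inward_normal (newton E) F v"
      "{x. v \<bullet> x = 0} \<inter> wt_cone S = {0}" "inward_normal (newton E) F (rvec u)"
    using u by (auto simp: normals_def compact_facet_def)
  obtain r where r: "r > 0" "rvec u = r *\<^sub>R v"
    using facet_normal_unique_pos[OF F(1) affine_hull_newton[OF ne] F(2,4)] by blast
  have "v \<bullet> x \<noteq> 0" using F(3) x by auto
  then have "rvec u \<bullet> x \<noteq> 0" using r by simp
  moreover have "0 \<le> rvec u \<bullet> x" using u x by (auto simp: normals_def dual_cone_def)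
  ultimately show ?thesis by simp
qed

text \<open>Distinct primitive inward normals belong to distinct facets, and a polyhedron has
  finitely many facets.\<close>

lemma finite_normals:
  assumes "finite B" "B \<subseteq> E" "E \<subseteq> msum B S" "E \<noteq> {}"
  shows "finite (normals E)"
proof -
  have "\<exists>F. F facet_of newton E \<and> inward_normal (newton E) F (rvec u)" if "u \<in> normals E" for u
    using that by (auto simp: normals_def compact_facet_def)
  then obtain F where F: "\<And>u. u \<in> normals E \<Longrightarrow> F u facet_of newton E \<and> inward_normal (newton E) (F u) (rvec u)"
    by metis
  have "inj_on F (normals E)"
  proof (rule inj_onI)
    fix u z assume uz: "u \<in> normals E" "z \<in> normals E" "F u = F z"
    then obtain r where "r > 0" "rvec z = r *\<^sub>R rvec u"
      using facet_normal_unique_pos[OF _ affine_hull_newton[OF assms(4)], of "F u" "rvec u" "rvec z"] F by metis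
    then show "u = z" using primitive_eqI[of u z r] uz by (simp add: normals_def)
  qed
  moreover have "finite {F. F facet_of newton E}"
    using polyhedron_newton[OF assms(1-3)] by (rule finite_polyhedron_facets)
  moreover have "F ` normals E \<subseteq> {F. F facet_of newton E}" using F by blast
  ultimately show ?thesis by (meson finite_imageD finite_subset)
qed

text \<open>
  A facet normal outside the interior of the dual cone vanishes on some generator of \<open>S\<close>;
  since \<open>E\<close> contains a multiple of it, the corresponding inequality already holds on the cone.
\<close>

lemma newton_membership:
  assumes B: "finite B" "B \<subseteq> E" "E \<subseteq> msum B S" and ne: "E \<noteq> {}" and ES: "E \<subseteq> S"
    and mult: "\<And>g. g \<in> G \<Longrightarrow> \<exists>k. int k *s g \<in> E"
    and x: "x \<in> wt_cone S" "\<And>u. u \<in> normals E \<Longrightarrow> support_fun (newton E) (rvec u) \<le> rvec u \<bullet> x"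
  shows "x \<in> newton E"
proof (rule ccontr)
  assume "x \<notin> newton E"
  then obtain u c where u: "u \<noteq> 0" "newton E \<subseteq> {y. c \<le> u \<bullet> y}"
      "(newton E \<inter> {y. u \<bullet> y = c}) facet_of newton E" "u \<bullet> x < c"
    using polyhedron_facet_separation[OF polyhedron_newton[OF B] affine_hull_newton[OF ne]] by blast
  define F where "F = newton E \<inter> {y. u \<bullet> y = c}"
  have dual: "u \<in> dual_cone S" using inward_normal_dual[OF ne u(2)] .
  show False
  proof (cases "{x. u \<bullet> x = 0} \<inter> wt_cone S = {0}")
    case False
    then obtain y where y: "y \<in> wt_cone S" "u \<bullet> y = 0" "y \<noteq> 0"
      using wt_cone_zero by fastforce
    obtain l where l: "y = (\<Sum>g\<in>G. l g *\<^sub>R rvec g)" "\<forall>g\<in>G. 0 \<le> l g"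
      using y(1) unfolding wt_cone_eq convex_cone_hull_finite_image[OF G_finite] by blast
    have ug: "0 \<le> u \<bullet> rvec g" if "g \<in> G" for g
      using dual rvec_in_wt_cone[of g] that G_subset by (auto simp: dual_cone_def)
    have "(\<Sum>g\<in>G. l g * (u \<bullet> rvec g)) = 0" using y(2) by (simp add: l(1) inner_sum_right)
    then have z: "\<forall>g\<in>G. l g * (u \<bullet> rvec g) = 0"
      using l(2) ug G_finite by (subst (asm) sum_nonneg_eq_0_iff) auto
    have "\<exists>g\<in>G. l g \<noteq> 0"
    proof (rule ccontr)
      assume "\<not> ?thesis"
      then have "y = 0" unfolding l(1) by (intro sum.neutral) simp
      then show False using y(3) by simp
    qed
    then obtain g where g: "g \<in> G" "u \<bullet> rvec g = 0" using z by auto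
    then obtain k where "int k *s g \<in> E" using mult[of g] by blast
    then have "rvec (int k *s g) \<in> newton E" by (rule rvec_in_newton)
    then have "c \<le> 0" using u(2) g(2) by (auto simp: rvec_mult)
    moreover have "0 \<le> u \<bullet> x" using dual x(1) by (auto simp: dual_cone_def)
    ultimately show False using u(4) by simp
  next
    case True
    have F: "F facet_of newton E" using u(3) by (simp add: F_def)
    have "inward_normal (newton E) F u" using u by (auto simp: inward_normal_def F_def)
    then have compact: "compact_facet S (newton E) F" using F True by (auto simp: compact_facet_def)
    \<comment> \<open>The separating normal \<open>u\<close> is merely real. It is rescaled to a
      primitive integral \<open>z\<close>, to which the hypothesis on \<open>x\<close>
      applies.\<close>
    obtain z r where zr: "primitive z" "r > 0" "rvec z = r *\<^sub>R u"
      using compact_facet_normal_integral[OF B ne F u(1,2) F_def True] by blast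
    have "inward_normal (newton E) F (rvec z)"
      unfolding inward_normal_def zr(3)
      using u(1,2) zr(2) by (intro conjI exI[of _ "r * c"]) (auto simp: F_def)
    moreover have zdual: "rvec z \<in> dual_cone S" using dual zr by (auto simp: dual_cone_def)
    ultimately have "z \<in> normals E" using zr(1) compact by (auto simp: normals_def)
    then have "support_fun (newton E) (rvec z) \<le> r * (u \<bullet> x)" using x(2) zr by fastforce
    moreover obtain e where "e \<in> E" "support_fun (newton E) (rvec z) = rvec z \<bullet> rvec e"
      using support_fun_newton[OF zdual ES ne] by blast
    moreover have "c \<le> u \<bullet> rvec e" using rvec_in_newton[OF \<open>e \<in> E\<close>] u(2) by auto
    ultimately have "r * (u \<bullet> rvec e) \<le> r * (u \<bullet> x)" using zr by simp
    then show False using zr(2) \<open>c \<le> u \<bullet> rvec e\<close> u(4) by simp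
  qed
qed

text \<open>Without normals the membership test would be vacuous and would put 0 into the Newton
  polyhedron, where \<open>w\<close> is positive.\<close>

lemma normals_nonempty:
  assumes B: "finite B" "B \<subseteq> E" "E \<subseteq> msum B S" and ne: "E \<noteq> {}" and ES: "E \<subseteq> S" and E0: "0 \<notin> E"
    and mult: "\<And>g. g \<in> G \<Longrightarrow> \<exists>k. int k *s g \<in> E"
  shows "normals E \<noteq> {}"
proof
  assume "normals E = {}"
  then have "0 \<in> newton E"
    using newton_membership[OF B ne ES mult wt_cone_zero] by simp
  then obtain x y where xy: "0 = x + y" "x \<in> convex hull (rvec ` E)" "y \<in> wt_cone S"
    unfolding newton_def by blast
  have "0 < w \<bullet> rvec e" if "e \<in> E" for e
    using that ES E0 by (intro w_pos rvec_in_wt_cone) auto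
  then have "convex hull (rvec ` E) \<subseteq> {x. w \<bullet> x > 0}"
    by (intro hull_minimal convex_halfspace_gt) auto
  then have "0 < w \<bullet> x" using xy by blast
  moreover have "0 \<le> w \<bullet> y" using xy by (simp add: w_nonneg)
  moreover have "w \<bullet> x + w \<bullet> y = 0" using xy(1) by (simp flip: inner_add_right)
  ultimately show False by simp
qed

section \<open>Multiples of lattice points in the Newton polyhedron\<close>

lemma combination_in_npow:
  assumes E: "sideal E" and B: "finite B" "B \<subseteq> E"
  shows "(\<Sum>b\<in>B. int (c b) *s b) \<in> npow E (sum c B)"
  using B
proof (induction B)
  case (insert b B)
  have "int (c b) *s b \<in> npow E (c b)"
    using replicate_in_npow[of b E "c b", unfolded sum_replicate_mset_int_vec] insert by simp
  then show ?case using insert npow_add[OF E] by simp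
qed simp

text \<open>Multiplied by \<open>N\<close>, the combination for \<open>m / N\<close> is a
  homogeneous real relation between exponents, generators and \<open>m\<close>. Rounding makes it an
  integral relation with nonnegative coefficients, in which \<open>m\<close> is taken
  \<open>K\<close> times and the exponents \<open>N * K\<close> times in total.\<close>

lemma multiple_in_npow:
  assumes E: "sideal E" and B: "finite B" "B \<subseteq> E" "E \<subseteq> msum B S"
    and m: "(1 / real N) *\<^sub>R rvec m \<in> newton E" and N: "N \<ge> 1"
  shows "\<exists>K\<ge>1. sum_mset (replicate_mset K m) \<in> npow (npow E N) K"
proof -
  obtain l y where ly: "\<forall>b\<in>B. 0 \<le> l b" "sum l B = 1" "y \<in> wt_cone S"
      "(1 / real N) *\<^sub>R rvec m = (\<Sum>b\<in>B. l b *\<^sub>R rvec b) + y"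
    using newton_combination[OF B m] by blast
  obtain c where c: "y = (\<Sum>g\<in>G. c g *\<^sub>R rvec g)" "\<forall>g\<in>G. 0 \<le> c g"
    using ly(3) unfolding wt_cone_eq convex_cone_hull_finite_image[OF G_finite] by blast
  define x :: "(int ^ 'n) + (int ^ 'n) + unit \<Rightarrow> real" where
    "x = case_sum (\<lambda>b. real N * l b) (case_sum (\<lambda>g. real N * c g) (\<lambda>_. 1))"
  \<comment> \<open>The row \<open>None\<close> says that the coefficients of the exponents add up
    to \<open>N\<close> times that of \<open>m\<close>; the rows \<open>Some i\<close> are the
    coordinates of the vector relation.\<close>
  define A :: "'n option \<Rightarrow> (int ^ 'n) + (int ^ 'n) + unit \<Rightarrow> int" where
    "A = case_option (case_sum (\<lambda>_. 1) (case_sum (\<lambda>_. 0) (\<lambda>_. - int N)))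
           (\<lambda>i. case_sum (\<lambda>b. b $ i) (case_sum (\<lambda>g. g $ i) (\<lambda>_. - (m $ i))))"
  define I where "I = B <+> G <+> {()}"
  have fin: "finite I" using B(1) G_finite by (simp add: I_def)
  have sumI: "sum f I = (\<Sum>b\<in>B. f (Inl b)) + ((\<Sum>g\<in>G. f (Inr (Inl g))) + f (Inr (Inr ())))"
    for f :: "_ \<Rightarrow> 'z::comm_monoid_add"
    using B(1) G_finite by (simp add: I_def sum.Plus)
  have "(\<Sum>i\<in>I. of_int (A j i) * x i) = 0" for j
  proof (cases j)
    case None
    then show ?thesis using ly(2) by (simp add: sumI A_def x_def flip: sum_distrib_left)
  next
    case (Some i)
    have "rvec m $ i = real N * (((\<Sum>b\<in>B. l b *\<^sub>R rvec b) + y) $ i)"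
      unfolding ly(4)[symmetric] using N by simp
    then show ?thesis
      using Some by (simp add: sumI A_def x_def c(1) sum_distrib_left algebra_simps)
  qed
  then obtain n n' where n: "n + 1 \<le> n'"
    "\<forall>j. (\<Sum>i\<in>I. A j i * (\<lfloor>real n' * x i\<rfloor> - \<lfloor>real n * x i\<rfloor>)) = 0"
    using integer_kernel_approx[of I UNIV A x 1] fin by auto
  define z where "z i = nat (\<lfloor>real n' * x i\<rfloor> - \<lfloor>real n * x i\<rfloor>)" for i
  have z: "int (z i) = \<lfloor>real n' * x i\<rfloor> - \<lfloor>real n * x i\<rfloor>" if "i \<in> I" for i
  proof -
    have "x i \<ge> 0" using that ly(1) c(2) by (auto simp: I_def x_def)
    then have "real n * x i \<le> real n' * x i" using n(1) by (intro mult_right_mono) auto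
    then show ?thesis using floor_mono by (fastforce simp: z_def)
  qed
  have eq: "(\<Sum>i\<in>I. A j i * int (z i)) = 0" for j
    using n(2) z by simp
  \<comment> \<open>The coefficient of \<open>m\<close> in the real relation is 1, so its two
    multiples \<open>n\<close> and \<open>n'\<close> are not changed by rounding.\<close>
  define K where "K = n' - n"
  have "z (Inr (Inr ())) = K" using n(1) by (simp add: z_def x_def K_def)
  then have K: "int (z (Inr (Inr ()))) = int K" by simp
  have "(\<Sum>b\<in>B. int (z (Inl b))) = int N * int K"
    using eq[of None] K by (simp add: sumI A_def)
  then have "int (\<Sum>b\<in>B. z (Inl b)) = int (N * K)" by simp
  then have size: "(\<Sum>b\<in>B. z (Inl b)) = N * K" by (simp only: of_nat_eq_iff)
  have "int K *s m = (\<Sum>b\<in>B. int (z (Inl b)) *s b) + (\<Sum>g\<in>G. int (z (Inr (Inl g))) *s g)"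
    unfolding vec_eq_iff
  proof
    fix i
    show "(int K *s m) $ i = ((\<Sum>b\<in>B. int (z (Inl b)) *s b) + (\<Sum>g\<in>G. int (z (Inr (Inl g))) *s g)) $ i"
      using eq[of "Some i"] K by (simp add: sumI A_def algebra_simps)
  qed
  also have "\<dots> \<in> npow E (N * K)"
    using combination_in_npow[OF E B(1,2), of "\<lambda>b. z (Inl b)"] G_finite G_subset
    unfolding size
    by (intro sideal_add[OF sideal_npow[OF E]] sum_in_S nat_mult_in_S) auto
  also note npow_mult
  finally show ?thesis
    unfolding sum_replicate_mset_int_vec using n(1) by (intro exI[of _ K]) (simp add: K_def)
qed

end

section \<open>The exponent\<close>

text \<open>\<open>toric_val\<close> evaluates an unspecified representative; the one selected still
  presents \<open>x\<close> as a fraction with an admissible denominator.\<close>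

lemma (in graded_semigroup) toric_rep:
  fixes x :: "('m, 'k::field) germ"
  assumes "x \<in> carrier L"
  obtains f s where "(SOME r. r \<in> x) = (f, s)" "f \<in> supported_on S" "s \<in> const_units" "x = fr f s"
proof -
  obtain f0 s0 where x: "x = fr f0 s0" "f0 \<in> supported_on S" "s0 \<in> const_units"
    using assms by (rule carrier_LE)
  then have "(f0, s0) \<in> x" by (simp add: mem_fr_iff)
  then have "(SOME r. r \<in> x) \<in> x" by (rule someI)
  moreover obtain f s where fs: "(SOME r. r \<in> x) = (f, s)" by (cases "SOME r. r \<in> x")
  ultimately have "(f, s) \<in> fr f0 s0" using x(1) by simp
  then have *: "f \<in> supported_on S" "s \<in> const_units" "s * f0 = s0 * f"
    using x by (auto simp: mem_fr_iff)
  then have "x = fr f s" unfolding x(1) using x by (intro fr_eqI) auto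
  with fs * show ?thesis using that by blast
qed

context affine_cone
begin

lemma dual_nonneg: "rvec u \<in> dual_cone S \<Longrightarrow> m \<in> S \<Longrightarrow> 0 \<le> rvec u \<bullet> rvec m"
  using rvec_in_wt_cone by (auto simp: dual_cone_def)

text \<open>The constant term of \<open>s\<close> has value 0 and no exponent in \<open>S\<close>
  has a negative one. Denominators therefore do not affect \<open>toric_val\<close>.\<close>

lemma poly_val_unit:
  fixes s :: "int ^ 'n \<Rightarrow>\<^sub>0 'k::field"
  assumes u: "rvec u \<in> dual_cone S" and s: "s \<in> const_units"
  shows "poly_val u s = 0"
proof (rule antisym)
  have "0 \<in> Poly_Mapping.keys s" using s by (simp add: const_units_def in_keys_iff)
  then have "poly_val u s \<le> ereal (real_of_int (scalar_product u 0))"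
    unfolding poly_val_def by (rule INF_lower)
  then show "poly_val u s \<le> 0" by (simp add: zero_ereal_def flip: rvec_inner)
  have "Poly_Mapping.keys s \<subseteq> S" using s by (auto simp: const_units_def supported_on_def)
  then show "0 \<le> poly_val u s"
    unfolding poly_val_def using dual_nonneg[OF u] by (intro INF_greatest) (auto simp: rvec_inner)
qed

lemma toric_val_ge:
  fixes x :: "(int ^ 'n, 'k::field) germ"
  assumes u: "rvec u \<in> dual_cone S" and E: "sideal E" and h: "\<And>e. e \<in> E \<Longrightarrow> h \<le> rvec u \<bullet> rvec e"
    and x: "x \<in> Loc E"
  shows "ereal h \<le> toric_val u x"
proof -
  have "x \<in> carrier L" using Loc_subset[OF E] x by blast
  then obtain f s where fs: "(SOME r. r \<in> x) = (f, s)" "f \<in> supported_on S" "s \<in> const_units" "x = fr f s"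
    by (rule toric_rep)
  have fE: "f \<in> supported_on E" using fr_in_Loc_iff[OF E fs(2,3)] x fs(4) by simp
  have "poly_val u s = 0" by (rule poly_val_unit[OF u fs(3)])
  moreover have "ereal h \<le> poly_val u f"
    unfolding poly_val_def using fE h by (intro INF_greatest) (auto simp: supported_on_def rvec_inner)
  ultimately show ?thesis by (simp add: toric_val_def fs(1))
qed

text \<open>The selected numerator is \<open>s\<close> times the monomial; its coefficient at
  \<open>e\<close> is the constant term of \<open>s\<close>, hence nonzero.\<close>

lemma toric_val_chi_le:
  assumes u: "rvec u \<in> dual_cone S" and e: "e \<in> S"
  shows "toric_val u (chi S e :: (int ^ 'n, 'k::field) germ) \<le> ereal (rvec u \<bullet> rvec e)"
proof -
  let ?x = "chi S e :: (int ^ 'n, 'k) germ" and ?m = "Poly_Mapping.single e (1 :: 'k)"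
  obtain f s where fs: "(SOME r. r \<in> ?x) = (f, s)" "f \<in> supported_on S" "s \<in> const_units" "?x = fr f s"
    using chi_in_L[OF e] by (rule toric_rep)
  have f: "f = s * ?m"
    using fs(4) fr_eq_iff[of ?m 1 f s] fs(2,3) e by (simp add: chi_eq W_one)
  obtain s' where s': "s' \<in> supported_on (S - {0})"
      "s = Poly_Mapping.single 0 (Poly_Mapping.lookup s 0) + s'"
    using split_const[OF W_in_A[OF fs(3)]] .
  have "e \<notin> Poly_Mapping.keys (s' * ?m)"
  proof
    assume "e \<in> Poly_Mapping.keys (s' * ?m)"
    then obtain d where "e = d + e" "d \<in> Poly_Mapping.keys s'" using keys_mult[of s' ?m] by auto
    then show False using s'(1) by (auto simp: supported_on_def)
  qed
  moreover have "f = Poly_Mapping.single e (Poly_Mapping.lookup s 0) + s' * ?m"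
    unfolding f by (subst s'(2)) (simp add: distrib_right mult_single)
  ultimately have "Poly_Mapping.lookup f e = Poly_Mapping.lookup s 0"
    by (simp add: lookup_add in_keys_iff)
  then have "e \<in> Poly_Mapping.keys f" using fs(3) by (simp add: in_keys_iff const_units_def)
  then have "poly_val u f \<le> ereal (rvec u \<bullet> rvec e)"
    unfolding poly_val_def rvec_inner by (rule INF_lower)
  then show ?thesis using poly_val_unit[OF u fs(3)] by (simp add: toric_val_def fs(1))
qed

lemma ideal_val_Loc:
  assumes u: "rvec u \<in> dual_cone S" and E: "sideal E" "E \<noteq> {}"
  shows "ideal_val (toric_val u) (Loc E :: (int ^ 'n, 'k::field) germ set)
    = ereal (support_fun (newton E) (rvec u))"
proof -
  obtain e where e: "e \<in> E" "support_fun (newton E) (rvec u) = rvec u \<bullet> rvec e"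
    "\<And>e'. e' \<in> E \<Longrightarrow> rvec u \<bullet> rvec e \<le> rvec u \<bullet> rvec e'"
    using support_fun_newton[OF u sideal_subset[OF E(1)] E(2)] by blast
  have eS: "e \<in> S" using e(1) sideal_subset[OF E(1)] by blast
  show ?thesis
    unfolding ideal_val_def
  proof (rule antisym)
    have "(chi S e :: (int ^ 'n, 'k) germ) \<in> Loc E" using chi_in_Loc_iff[OF E(1) eS] e(1) by blast
    then have "(INF x\<in>Loc E. toric_val u (x :: (int ^ 'n, 'k) germ)) \<le> toric_val u (chi S e :: (int ^ 'n, 'k) germ)"
      by (rule INF_lower)
    also have "\<dots> \<le> ereal (rvec u \<bullet> rvec e)" by (rule toric_val_chi_le[OF u eS])
    finally show "(INF x\<in>Loc E. toric_val u (x :: (int ^ 'n, 'k) germ)) \<le> ereal (support_fun (newton E) (rvec u))"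
      by (simp add: e(2))
    show "ereal (support_fun (newton E) (rvec u)) \<le> (INF x\<in>Loc E. toric_val u (x :: (int ^ 'n, 'k) germ))"
      unfolding e(2) using e(3) by (intro INF_greatest toric_val_ge[OF u E(1)]) auto
  qed
qed

text \<open>The minimum is attained at a nonzero exponent, where a compact normal is positive. This
  makes the denominators of the formula nonzero.\<close>

lemma support_fun_pos:
  assumes ne: "E \<noteq> {}" and u: "u \<in> normals E" and F: "F \<subseteq> S" "F \<noteq> {}" "0 \<notin> F"
  shows "0 < support_fun (newton F) (rvec u)"
proof -
  have "rvec u \<in> dual_cone S" using u by (simp add: normals_def)
  then obtain e where e: "e \<in> F" "support_fun (newton F) (rvec u) = rvec u \<bullet> rvec e"
    using support_fun_newton F by blast
  have "e \<noteq> 0" "e \<in> S" using e(1) F by auto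
  then show ?thesis unfolding e(2) using normals_pos[OF ne u] rvec_in_wt_cone by simp
qed

section \<open>Containment of powers and the exponent\<close>

lemma integral_closure_imp_support_le:
  assumes u: "rvec u \<in> dual_cone S" and E: "sideal E" "E \<noteq> {}" and F: "sideal F" "F \<noteq> {}"
    and sub: "(Loc (npow F i) :: (int ^ 'n, 'k::field) germ set) \<subseteq> integral_closure L (Loc (npow E j))"
  shows "real j * support_fun (newton E) (rvec u) \<le> real i * support_fun (newton F) (rvec u)"
proof -
  let ?wt = "\<lambda>m. rvec u \<bullet> rvec m"
  have add: "?wt (x + y) = ?wt x + ?wt y" for x y by (simp add: rvec_add inner_add_right)
  obtain e where e: "support_fun (newton E) (rvec u) = ?wt e" "\<And>e'. e' \<in> E \<Longrightarrow> ?wt e \<le> ?wt e'"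
    using support_fun_newton[OF u sideal_subset[OF E(1)] E(2)] by blast
  obtain f where f: "f \<in> F" "support_fun (newton F) (rvec u) = ?wt f"
    using support_fun_newton[OF u sideal_subset[OF F(1)] F(2)] by blast
  \<comment> \<open>The containment is tested on a single monomial, the \<open>i\<close>-th power of
    one of least weight in \<open>F\<close>.\<close>
  have m: "int i *s f \<in> npow F i"
    using replicate_in_npow[OF f(1), of i, unfolded sum_replicate_mset_int_vec] .
  have mS: "int i *s f \<in> S" using m sideal_subset[OF sideal_npow[OF F(1)]] by blast
  have "(chi S (int i *s f) :: (int ^ 'n, 'k) germ) \<in> integral_closure L (Loc (npow E j))"
    using sub m chi_in_Loc_iff[OF sideal_npow[OF F(1)] mS] by blast
  moreover have "real j * ?wt e \<le> ?wt x" if "x \<in> npow E j" for x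
    using that by (intro weight_npow[where wt = ?wt and E = E] add dual_nonneg[OF u] e(2))
  ultimately have "real j * ?wt e \<le> ?wt (int i *s f)"
    by (intro integral_closure_weight[where wt = ?wt, OF sideal_npow[OF E(1)] mS add dual_nonneg[OF u]])
  then show ?thesis by (simp add: e f rvec_mult)
qed

text \<open>Divided by \<open>j\<close>, the weight bound on an exponent \<open>m\<close> of the
  numerator is what \<open>newton_membership\<close> asks of a cone point;
  \<open>multiple_in_npow\<close> then supplies the root condition of
  \<open>fr_in_integral_closure\<close>.\<close>

lemma support_le_imp_integral_closure:
  assumes E: "sideal E" and B: "finite B" "B \<subseteq> E" "E \<subseteq> msum B S" and ne: "E \<noteq> {}"
    and mult: "\<And>g. g \<in> G \<Longrightarrow> \<exists>k. int k *s g \<in> E"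
    and F: "sideal F" "F \<noteq> {}" and j: "j \<ge> 1"
    and le: "\<And>u. u \<in> normals E \<Longrightarrow>
      real j * support_fun (newton E) (rvec u) \<le> real i * support_fun (newton F) (rvec u)"
  shows "(Loc (npow F i) :: (int ^ 'n, 'k::field) germ set) \<subseteq> integral_closure L (Loc (npow E j))"
proof
  fix x :: "(int ^ 'n, 'k) germ" assume "x \<in> Loc (npow F i)"
  then obtain f s where x: "x = fr f s" "f \<in> supported_on (npow F i)" "s \<in> const_units"
    by (auto simp: Loc_def)
  show "x \<in> integral_closure L (Loc (npow E j))"
    unfolding x(1)
  proof (rule fr_in_integral_closure[OF sideal_npow[OF E] _ x(3)])
    show "f \<in> supported_on S"
      using x(2) sideal_subset[OF sideal_npow[OF F(1)]] by (rule supported_on_mono)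
    fix m assume "m \<in> Poly_Mapping.keys f"
    then have m: "m \<in> npow F i" using x(2) by (auto simp: supported_on_def)
    then have mS: "m \<in> S" using sideal_subset[OF sideal_npow[OF F(1)]] by blast
    have "(1 / real j) *\<^sub>R rvec m \<in> newton E"
    proof (rule newton_membership[OF B ne sideal_subset[OF E] mult])
      show "(1 / real j) *\<^sub>R rvec m \<in> wt_cone S"
        using rvec_in_wt_cone[OF mS] by (intro wt_cone_scale) auto
      fix u assume u: "u \<in> normals E"
      let ?wt = "\<lambda>m. rvec u \<bullet> rvec m"
      have ud: "rvec u \<in> dual_cone S" using u by (simp add: normals_def)
      obtain e where e: "support_fun (newton F) (rvec u) = ?wt e" "\<And>e'. e' \<in> F \<Longrightarrow> ?wt e \<le> ?wt e'"
        using support_fun_newton[OF ud sideal_subset[OF F(1)] F(2)] by blast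
      have "real i * ?wt e \<le> ?wt m"
        using m e(2)
        by (intro weight_npow[where wt = ?wt and E = F] dual_nonneg[OF ud]) (auto simp: rvec_add inner_add_right)
      then have "real j * support_fun (newton E) (rvec u) \<le> ?wt m" using le[OF u] e(1) by simp
      then show "support_fun (newton E) (rvec u) \<le> rvec u \<bullet> ((1 / real j) *\<^sub>R rvec m)"
        using j by (simp add: field_simps)
    qed
    then show "\<exists>K\<ge>1. sum_mset (replicate_mset K m) \<in> npow (npow E j) K"
      using multiple_in_npow[OF E B _ j] by blast
  qed
qed

text \<open>The factor \<open>t\<close> cancels from the inequalities between support functions. So
  one containment with \<open>t >= 1\<close> already forces \<open>M <= q / p\<close>, and this
  bound in turn gives the containment for all \<open>t >= 1\<close>. The exponent is thus the
  infimum of the positive rationals that are at least \<open>M\<close>.\<close>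

lemma exponent_Loc:
  assumes E: "sideal E" "E \<noteq> {}" "0 \<notin> E" and mult: "\<And>g. g \<in> G \<Longrightarrow> \<exists>k. int k *s g \<in> E"
    and F: "sideal F" "F \<noteq> {}" "0 \<notin> F"
  defines "r \<equiv> \<lambda>u. support_fun (newton E) (rvec u) / support_fun (newton F) (rvec u)"
  shows "finite (normals E) \<and> normals E \<noteq> {} \<and>
    exponent L (Loc F) (Loc E :: (int ^ 'n, 'k::field) germ set) = ereal (Max (r ` normals E))"
proof -
  obtain B where B: "finite B" "B \<subseteq> E" "E \<subseteq> msum B S"
    using finite_basis[OF E(1) mult] by blast
  note ES = sideal_subset[OF E(1)] and FS = sideal_subset[OF F(1)]
  have fin: "finite (normals E)" by (rule finite_normals[OF B E(2)])
  have ne: "normals E \<noteq> {}" by (rule normals_nonempty[OF B E(2) ES E(3) mult])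
  have hE: "0 < support_fun (newton E) (rvec u)" if "u \<in> normals E" for u
    using support_fun_pos[OF E(2) that ES E(2,3)] .
  have hF: "0 < support_fun (newton F) (rvec u)" if "u \<in> normals E" for u
    using support_fun_pos[OF E(2) that FS F(2,3)] .
  define M where "M = Max (r ` normals E)"
  have rM: "r u \<le> M" if "u \<in> normals E" for u using fin that by (simp add: M_def)
  have "M \<in> r ` normals E" unfolding M_def using fin ne by (intro Max_in) auto
  then obtain u0 where u0: "u0 \<in> normals E" "M = r u0" by blast
  have M0: "M > 0" using hE[OF u0(1)] hF[OF u0(1)] by (simp add: u0(2) r_def)
  let ?P = "\<lambda>p q. \<forall>\<^sub>F t in sequentially. (Loc F :: (int ^ 'n, 'k) germ set) [^]\<^bsub>ideals_set L\<^esub> (q * t)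
      \<subseteq> integral_closure L (Loc E [^]\<^bsub>ideals_set L\<^esub> (p * t))"
  have lower: "M \<le> real q / real p" if "p > 0" and P: "?P p q" for p q :: nat
  proof -
    obtain t where t: "t \<ge> 1" "(Loc F :: (int ^ 'n, 'k) germ set) [^]\<^bsub>ideals_set L\<^esub> (q * t)
      \<subseteq> integral_closure L (Loc E [^]\<^bsub>ideals_set L\<^esub> (p * t))"
      using P unfolding eventually_sequentially by (metis nle_le)
    have "rvec u0 \<in> dual_cone S" using u0(1) by (simp add: normals_def)
    then have "real (p * t) * support_fun (newton E) (rvec u0) \<le> real (q * t) * support_fun (newton F) (rvec u0)"
      using t(2) unfolding pow_Loc[OF E(1)] pow_Loc[OF F(1)]
      by (rule integral_closure_imp_support_le[OF _ E(1,2) F(1,2)])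
    then have "real t * (real p * support_fun (newton E) (rvec u0)) \<le> real t * (real q * support_fun (newton F) (rvec u0))"
      by (simp add: ac_simps)
    then have "real p * support_fun (newton E) (rvec u0) \<le> real q * support_fun (newton F) (rvec u0)"
      using t(1) by simp
    then show ?thesis
      using \<open>p > 0\<close> hF[OF u0(1)] by (simp add: u0(2) r_def field_simps)
  qed
  have upper: "?P p q" if "p > 0" "M \<le> real q / real p" for p q :: nat
    unfolding eventually_sequentially
  proof (intro exI[of _ 1] allI impI)
    fix t :: nat assume t: "t \<ge> 1"
    show "(Loc F :: (int ^ 'n, 'k) germ set) [^]\<^bsub>ideals_set L\<^esub> (q * t)
      \<subseteq> integral_closure L (Loc E [^]\<^bsub>ideals_set L\<^esub> (p * t))"
      unfolding pow_Loc[OF E(1)] pow_Loc[OF F(1)]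
    proof (rule support_le_imp_integral_closure[OF E(1) B E(2) mult F(1,2)])
      show "p * t \<ge> 1" using t that(1) by simp
      fix u assume u: "u \<in> normals E"
      have "r u \<le> real q / real p" using rM[OF u] that(2) by simp
      then have "real p * support_fun (newton E) (rvec u) \<le> real q * support_fun (newton F) (rvec u)"
        using that(1) hF[OF u] by (simp add: r_def field_simps)
      then have "real t * (real p * support_fun (newton E) (rvec u)) \<le> real t * (real q * support_fun (newton F) (rvec u))"
        by (rule mult_left_mono) simp
      then show "real (p * t) * support_fun (newton E) (rvec u) \<le> real (q * t) * support_fun (newton F) (rvec u)"
        by (simp add: ac_simps)
    qed
  qed
  define A where "A = {ereal (real q / real p) | p q. p > 0 \<and> q > 0 \<and> ?P p q}"
  have "Inf A = ereal M"
  proof (rule antisym)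
    show "ereal M \<le> Inf A" using lower by (auto simp: A_def intro!: Inf_greatest)
    show "Inf A \<le> ereal M"
    proof (rule dense_ge)
      fix x assume "ereal M < x"
      then obtain y where y: "ereal M < ereal y" "ereal y < x" using ereal_dense2 by blast
      then obtain z where z: "z \<in> \<rat>" "M < z" "z < y" using Rats_dense_in_real by auto
      obtain q p :: nat where qp: "p \<noteq> 0" "\<bar>z\<bar> = real q / real p" using z(1) by (rule Rats_abs_nat_div_natE)
      have zq: "z = real q / real p" using z(2) M0 qp(2) by simp
      then have "q > 0" using z(2) M0 by (cases "q = 0") auto
      then have "ereal z \<in> A" unfolding A_def using qp(1) zq upper[of p q] z(2) by auto
      then have "Inf A \<le> ereal z" by (rule Inf_lower)
      also have "\<dots> \<le> x" using z(3) y(2) by (meson ereal_less_eq(3) less_imp_le order_trans)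
      finally show "Inf A \<le> x" .
    qed
  qed
  then show ?thesis using fin ne by (simp add: exponent_def A_def M_def)
qed

section \<open>Translation to monomial ideals of the local ring\<close>

lemma exponent_set_Loc: "sideal E \<Longrightarrow> exponent_set S (Loc E :: (int ^ 'n, 'k::field) germ set) = E"
  using chi_in_Loc_iff sideal_subset by (fastforce simp: exponent_set_def)

lemma newton_polyhedron_eq: "newton_polyhedron S I = newton (exponent_set S I)"
  by (simp add: newton_polyhedron_def newton_def)

lemma compact_normals_eq: "compact_normals S I = normals (exponent_set S I)"
  by (simp add: compact_normals_def normals_def newton_polyhedron_eq)

lemma monomial_idealE:
  assumes "monomial_ideal S (I :: (int ^ 'n, 'k::field) germ set)"
  shows "sideal (exponent_set S I)" "I = Loc (exponent_set S I)"
proof -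
  obtain B where B: "B \<subseteq> S" "I = Idl\<^bsub>local_ring S\<^esub> (chi S ` B)"
    using assms by (auto simp: monomial_ideal_def)
  then have I: "I = Loc (msum B S)" unfolding local_ring_eq by (simp add: genideal_chi)
  have s: "sideal (msum B S)" using B(1) by (rule sideal_msum_S)
  show "sideal (exponent_set S I)" "I = Loc (exponent_set S I)"
    unfolding I exponent_set_Loc[OF s] using s by auto
qed

lemma Loc_zero_exponent:
  assumes "sideal E" "0 \<in> E"
  shows "Loc E = (carrier L :: (int ^ 'n, 'k::field) germ set)"
proof -
  have "E = S" using sideal_add[OF assms(1,2)] sideal_subset[OF assms(1)] by auto
  then show ?thesis by (simp add: Loc_S)
qed

lemma Loc_empty: "Loc {} = {\<zero>\<^bsub>L\<^esub> :: (int ^ 'n, 'k::field) germ}"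
proof -
  have "fr 0 s = (\<zero>\<^bsub>L\<^esub> :: (int ^ 'n, 'k) germ)" if "s \<in> const_units" for s
    unfolding zero_L using that by (intro fr_eqI) (simp_all add: W_one)
  moreover have "(1 :: int ^ 'n \<Rightarrow>\<^sub>0 'k) \<in> const_units" by (rule W_one)
  ultimately show ?thesis by (auto simp: Loc_def supported_on_def zero_L)
qed

text \<open>The rank is at least 1, while the cone on no generators is a point.\<close>

lemma G_nonempty: "G \<noteq> {}"
proof
  assume "G = {}"
  then have "wt_cone S = {0}" by (simp add: wt_cone_eq)
  then show False using full_dim by simp
qed

text \<open>The radical of \<open>a\<close> is the maximal ideal and \<open>g\<close> is nonzero, so
  some power of \<open>chi S g\<close> lies in \<open>a\<close>.\<close>

lemma primary_multiple:
  assumes a: "primary_to (local_ring S) (local_max_ideal S) (a :: (int ^ 'n, 'k::field) germ set)"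
    and g: "g \<in> G"
  shows "\<exists>k. int k *s g \<in> exponent_set S a"
proof -
  have gS: "g \<in> S" using g G_subset by blast
  interpret cring "L :: (int ^ 'n, 'k) germ ring" by (rule cring_L)
  have "(chi S g :: (int ^ 'n, 'k) germ) \<in> local_max_ideal S"
    unfolding local_max_ideal_def local_ring_eq using g gS G_nonzero chi_in_L
    by (intro subsetD[OF genideal_self]) auto
  then have "(chi S g :: (int ^ 'n, 'k) germ) \<in> radical L a"
    using a by (simp add: primary_to_def local_ring_eq)
  then obtain k where "(chi S g :: (int ^ 'n, 'k) germ) [^]\<^bsub>L\<^esub> (k::nat) \<in> a"
    by (auto simp: radical_def)
  then have "chi S (int k *s g) \<in> a"
    by (simp add: chi_pow[OF gS] del: sum_mset_replicate_mset) (simp only: sum_replicate_mset_int_vec)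
  then show ?thesis using nat_mult_in_S[OF gS] by (auto simp: exponent_set_def)
qed

end

lemma affine_semigroup_cone:
  fixes S :: "(int ^ 'n::finite) set"
  assumes "affine_semigroup S"
  shows "\<exists>G w. affine_cone S G w"
proof -
  obtain G where G: "finite G" "S = add_submonoid hull G"
    using assms by (auto simp: affine_semigroup_def fin_gen_submonoid_def)
  have "add_submonoid hull G = add_submonoid hull (G - {0})"
  proof
    have "add_submonoid (add_submonoid hull (G - {0}))"
      by (rule hull_in) (auto simp: add_submonoid_def)
    moreover from this have "G \<subseteq> add_submonoid hull (G - {0})"
      using hull_subset[of "G - {0}" add_submonoid] by (auto simp: add_submonoid_def)
    ultimately show "add_submonoid hull G \<subseteq> add_submonoid hull (G - {0})" by (intro hull_minimal)
  qed (simp add: hull_mono)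
  then have S: "S = add_submonoid hull (G - {0})" using G(2) by simp
  have "wt_cone S = convex_cone hull (rvec ` G)" unfolding G(2) by (rule wt_cone_hull)
  then obtain w where "\<forall>x\<in>wt_cone S. x \<noteq> 0 \<longrightarrow> 0 < w \<bullet> x"
    using pointed_cone_functional[of "rvec ` G"] G(1) assms by (auto simp: affine_semigroup_def)
  then have "affine_cone S (G - {0}) w"
    using G(1) S assms by unfold_locales (auto simp: affine_semigroup_def)
  then show ?thesis by blast
qed

theorem theorem10p11:
  fixes S :: "(int ^ 'n::finite) set"
    and a b :: "(int ^ 'n, 'k::field) germ set"
  assumes "affine_semigroup S"
    and "monomial_ideal S a" and "primary_to (local_ring S) (local_max_ideal S) a"
    and "monomial_ideal S b" and "b \<noteq> carrier (local_ring S)"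
    and "b \<noteq> {\<zero>\<^bsub>local_ring S\<^esub>}"
  shows "finite (compact_normals S a) \<and> compact_normals S a \<noteq> {} \<and>
    exponent (local_ring S) b a =
      ereal (Max ((\<lambda>u. support_fun (newton_polyhedron S a) (rvec u) /
                       support_fun (newton_polyhedron S b) (rvec u)) ` compact_normals S a)) \<and>
    (\<exists>u\<in>compact_normals S a. exponent (local_ring S) b a =
       ideal_val (toric_val u) a / ideal_val (toric_val u) b)"
proof -
  obtain G w where "affine_cone S G w" using affine_semigroup_cone[OF assms(1)] by blast
  then interpret affine_cone S G w .
  define E where "E = exponent_set S a"
  define F where "F = exponent_set S b"
  have E: "sideal E" "a = Loc E" using monomial_idealE[OF assms(2)] by (auto simp: E_def)
  have F: "sideal F" "b = Loc F" using monomial_idealE[OF assms(4)] by (auto simp: F_def)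
  have mult: "\<exists>k. int k *s g \<in> E" if "g \<in> G" for g
    unfolding E_def by (rule primary_multiple[OF assms(3) that])
  have E_ne: "E \<noteq> {}" using G_nonempty mult by blast
  have "a \<noteq> carrier L"
    using assms(3) unfolding primary_to_def primary_ideal_def local_ring_eq by blast
  then have E0: "0 \<notin> E" using Loc_zero_exponent[OF E(1)] E(2) by blast
  have F_ne: "F \<noteq> {}" using assms(6) Loc_empty F(2) by (auto simp: local_ring_eq)
  have F0: "0 \<notin> F" using assms(5) Loc_zero_exponent[OF F(1)] F(2) by (auto simp: local_ring_eq)
  let ?r = "\<lambda>u. support_fun (newton E) (rvec u) / support_fun (newton F) (rvec u)"
  have main: "finite (normals E)" "normals E \<noteq> {}" "exponent L b a = ereal (Max (?r ` normals E))"
    using exponent_Loc[OF E(1) E_ne E0 mult F(1) F_ne F0] unfolding E(2) F(2) by blast+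
  then have "Max (?r ` normals E) \<in> ?r ` normals E" by (intro Max_in) auto
  then obtain u where u: "u \<in> normals E" "Max (?r ` normals E) = ?r u" by blast
  have dual: "rvec u \<in> dual_cone S" using u(1) by (simp add: normals_def)
  \<comment> \<open>With a positive real denominator the quotient of the two \<open>ereal\<close>
    values is the real quotient.\<close>
  have "0 < support_fun (newton F) (rvec u)"
    by (rule support_fun_pos[OF E_ne u(1) sideal_subset[OF F(1)] F_ne F0])
  moreover have "ideal_val (toric_val u) a = ereal (support_fun (newton E) (rvec u))"
    unfolding E(2) by (rule ideal_val_Loc[OF dual E(1) E_ne])
  moreover have "ideal_val (toric_val u) b = ereal (support_fun (newton F) (rvec u))"
    unfolding F(2) by (rule ideal_val_Loc[OF dual F(1) F_ne])
  ultimately have "exponent L b a = ideal_val (toric_val u) a / ideal_val (toric_val u) b"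
    using main(3) u(2) by simp
  with main u(1) show ?thesis
    unfolding local_ring_eq newton_polyhedron_eq compact_normals_eq E_def F_def by blast
qed

end
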